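(* Let $0<\lambda<\mu$ and $\nu=\lambda/\mu$. Then $\rho=(1-\nu^2)\sum_{n\ge0}\nu^{2n}|e_n\rangle\langle e_n|$ is the unique $\mathcal T$-invariant state and, for every initial state (density matrix) $\eta$ on $\mathsf h$, \[ \lim_{t\to\infty}\mathcal T_{*t}(\eta)=\rho \] in trace norm.
   Context: Let $\mathsf h=\ell^2(\mathbb N)$ with canonical orthonormal basis $(e_n)_{n\ge0}$ and let $N$ be the number operator, $Ne_n=ne_n$. Fix $r>0$ and set $\omega_n=n(n+r-1)$ for $n\ge0$. On $\mathrm{Dom}(N)=\{u=\sum_n u_ne_n:\sum_n n^2|u_n|^2<\infty\}$ define $Be_n=\omega_n^{1/2}e_{n-1}$ for $n\ge1$, $Be_0=0$, and $B^+e_n=\omega_{n+1}^{1/2}e_{n+1}$. Fix real numbers $\lambda,\mu>0$ and $\zeta^+,\zeta^-$. Let $G$ be the operator with domain $\mathrm{Dom}(N^2)$ given by $Ge_n=-\big((\tfrac{\lambda^2}{2}+i\zeta^+)\omega_{n+1}+(\tfrac{\mu^2}{2}+i\zeta^-)\omega_n\big)e_n$, generating the contraction semigroup $P_t=e^{tG}$, and let $L_1=\mu B$, $L_2=\lambda B^+$. The quantum Markov semigroup $\mathcal T=(\mathcal T_t)_{t\ge0}$ on $\mathcal B(\mathsf h)$ is the minimal quantum dynamical semigroup associated with $G,L_1,L_2$, i.e. the minimal solution of $\langle v,\mathcal T_t(x)u\rangle=\langle P_tv,xP_tu\rangle+\sum_{\ell=1}^2\int_0^t\langle L_\ell P_{t-s}v,\mathcal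 T_s(x)L_\ell P_{t-s}u\rangle\,ds$ for $u,v\in\mathrm{Dom}(G)$, $x\in\mathcal B(\mathsf h)$; its formal generator is $\mathcal L(x)=-\frac{\lambda^2}{2}(BB^+x-2BxB^++xBB^+)-\frac{\mu^2}{2}(B^+Bx-2B^+xB+xB^+B)+i[\zeta^+BB^++\zeta^-B^+B,x]$. It is identity preserving when $\lambda\le\mu$. $\mathcal T_*=(\mathcal T_{*t})_{t\ge0}$ is the predual semigroup on trace-class operators, $\mathrm{tr}(\mathcal T_{*t}(\eta)x)=\mathrm{tr}(\eta\,\mathcal T_t(x))$. *)

theory Defs
  imports "HOL-Analysis.Analysis"
begin

text \<open>Concrete model of h = l2(N): vectors are sequences nat => complex,
 bounded operators are represented by their matrices  M i j = < e_i, M e_j >.\<close>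

type_synonym vec = "nat \<Rightarrow> complex"
type_synonym mat = "nat \<Rightarrow> nat \<Rightarrow> complex"

definition ell2 :: "vec \<Rightarrow> bool" where
  "ell2 u \<longleftrightarrow> summable (\<lambda>n. (cmod (u n))^2)"

definition vnorm :: "vec \<Rightarrow> real" where
  "vnorm u = sqrt (\<Sum>n. (cmod (u n))^2)"

definition inprod :: "vec \<Rightarrow> vec \<Rightarrow> complex" where
  "inprod v u = (\<Sum>n. cnj (v n) * u n)"

definition mapply :: "mat \<Rightarrow> vec \<Rightarrow> vec" where
  "mapply M u = (\<lambda>i. \<Sum>j. M i j * u j)"

definition bounded_op :: "mat \<Rightarrow> bool" where
  "bounded_op M \<longleftrightarrow>
     (\<forall>u. ell2 u \<longrightarrow> (\<forall>i. summable (\<lambda>j. M i j * u j)) \<and> ell2 (mapply M u)) \<and>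
     (\<exists>C. \<forall>u. ell2 u \<longrightarrow> vnorm (mapply M u) \<le> C * vnorm u)"

definition mmult :: "mat \<Rightarrow> mat \<Rightarrow> mat" where
  "mmult M N = (\<lambda>i k. \<Sum>j. M i j * N j k)"

definition adj :: "mat \<Rightarrow> mat" where
  "adj M = (\<lambda>i j. cnj (M j i))"

definition positive_op :: "mat \<Rightarrow> bool" where
  "positive_op M \<longleftrightarrow> bounded_op M \<and>
     (\<forall>u. ell2 u \<longrightarrow> Im (inprod u (mapply M u)) = 0 \<and> 0 \<le> Re (inprod u (mapply M u)))"

definition op_le :: "mat \<Rightarrow> mat \<Rightarrow> bool" where
  "op_le A B \<longleftrightarrow> positive_op (B - A)"

definition opabs :: "mat \<Rightarrow> mat" where
  "opabs M = (THE B. positive_op B \<and> mmult B B = mmult (adj M) M)"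

definition trace_class :: "mat \<Rightarrow> bool" where
  "trace_class M \<longleftrightarrow> bounded_op M \<and> summable (\<lambda>n. Re (opabs M n n))"

definition trace_norm :: "mat \<Rightarrow> real" where
  "trace_norm M = (\<Sum>n. Re (opabs M n n))"

definition tr :: "mat \<Rightarrow> complex" where
  "tr M = (\<Sum>n. M n n)"

definition density :: "mat \<Rightarrow> bool" where
  "density M \<longleftrightarrow> positive_op M \<and> trace_class M \<and> tr M = 1"

definition positive_map :: "(mat \<Rightarrow> mat) \<Rightarrow> bool" where
  "positive_map \<Phi> \<longleftrightarrow>
     (\<forall>x. bounded_op x \<longrightarrow> bounded_op (\<Phi> x)) \<and>
     (\<forall>x y a b. bounded_op x \<longrightarrow> bounded_op y \<longrightarrow>
         \<Phi> (\<lambda>i j. a * x i j + b * y i j) = (\<lambda>i j. a * \<Phi> x i j + b * \<Phi> y i j)) \<and>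
     (\<forall>x. positive_op x \<longrightarrow> positive_op (\<Phi> x))"

definition omega :: "real \<Rightarrow> nat \<Rightarrow> real" where
  "omega r n = real n * (real n + r - 1)"

text \<open>Dom(G) = Dom(N^2)\<close>
definition domG :: "vec \<Rightarrow> bool" where
  "domG u \<longleftrightarrow> summable (\<lambda>n. (real n)^4 * (cmod (u n))^2)"

text \<open>eigenvalue of G on e_n\<close>
definition geig :: "real \<Rightarrow> real \<Rightarrow> real \<Rightarrow> real \<Rightarrow> real \<Rightarrow> nat \<Rightarrow> complex" where
  "geig r lam mu zp zm n =
     - ((complex_of_real (lam^2/2) + \<i> * complex_of_real zp) * complex_of_real (omega r (Suc n))
      + (complex_of_real (mu^2/2) + \<i> * complex_of_real zm) * complex_of_real (omega r n))"

definition Pt :: "real \<Rightarrow> real \<Rightarrow> real \<Rightarrow> real \<Rightarrow> real \<Rightarrow> real \<Rightarrow> vec \<Rightarrow> vec" where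
  "Pt r lam mu zp zm t u = (\<lambda>n. exp (complex_of_real t * geig r lam mu zp zm n) * u n)"

text \<open>B e_n = omega_n^(1/2) e_(n-1),  B^+ e_n = omega_(n+1)^(1/2) e_(n+1)\<close>
definition Bop :: "real \<Rightarrow> vec \<Rightarrow> vec" where
  "Bop r u = (\<lambda>m. complex_of_real (sqrt (omega r (Suc m))) * u (Suc m))"

definition Bplus :: "real \<Rightarrow> vec \<Rightarrow> vec" where
  "Bplus r u = (\<lambda>m. if m = 0 then 0 else complex_of_real (sqrt (omega r m)) * u (m - 1))"

definition L1 :: "real \<Rightarrow> real \<Rightarrow> vec \<Rightarrow> vec" where
  "L1 r mu u = (\<lambda>m. complex_of_real mu * Bop r u m)"

definition L2 :: "real \<Rightarrow> real \<Rightarrow> vec \<Rightarrow> vec" where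
  "L2 r lam u = (\<lambda>m. complex_of_real lam * Bplus r u m)"

definition solves_qds_eq ::
  "real \<Rightarrow> real \<Rightarrow> real \<Rightarrow> real \<Rightarrow> real \<Rightarrow> (real \<Rightarrow> mat \<Rightarrow> mat) \<Rightarrow> bool" where
  "solves_qds_eq r lam mu zp zm S \<longleftrightarrow>
    (\<forall>t\<ge>0. \<forall>u v x. domG u \<longrightarrow> domG v \<longrightarrow> bounded_op x \<longrightarrow>
      (\<exists>I1 I2.
        ((\<lambda>s. inprod (L1 r mu (Pt r lam mu zp zm (t - s) v))
                 (mapply (S s x) (L1 r mu (Pt r lam mu zp zm (t - s) u)))) has_integral I1) {0..t} \<and>
        ((\<lambda>s. inprod (L2 r lam (Pt r lam mu zp zm (t - s) v))
                 (mapply (S s x) (L2 r lam (Pt r lam mu zp zm (t - s) u)))) has_integral I2) {0..t} \<and>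
        inprod v (mapply (S t x) u) =
          inprod (Pt r lam mu zp zm t v) (mapply x (Pt r lam mu zp zm t u)) + I1 + I2))"

definition minimal_qds ::
  "real \<Rightarrow> real \<Rightarrow> real \<Rightarrow> real \<Rightarrow> real \<Rightarrow> (real \<Rightarrow> mat \<Rightarrow> mat) \<Rightarrow> bool" where
  "minimal_qds r lam mu zp zm T \<longleftrightarrow>
     (\<forall>t\<ge>0. positive_map (T t)) \<and> solves_qds_eq r lam mu zp zm T \<and>
     (\<forall>S. (\<forall>t\<ge>0. positive_map (S t)) \<and> solves_qds_eq r lam mu zp zm S \<longrightarrow>
        (\<forall>t\<ge>0. \<forall>x. positive_op x \<longrightarrow> op_le (T t x) (S t x)))"

definition predual :: "(real \<Rightarrow> mat \<Rightarrow> mat) \<Rightarrow> real \<Rightarrow> mat \<Rightarrow> mat" where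
  "predual T t \<eta> = (THE \<sigma>. trace_class \<sigma> \<and>
      (\<forall>x. bounded_op x \<longrightarrow> tr (mmult \<sigma> x) = tr (mmult \<eta> (T t x))))"

definition invariant_state :: "(real \<Rightarrow> mat \<Rightarrow> mat) \<Rightarrow> mat \<Rightarrow> bool" where
  "invariant_state T \<sigma> \<longleftrightarrow> density \<sigma> \<and>
     (\<forall>t\<ge>0. \<forall>x. bounded_op x \<longrightarrow> tr (mmult \<sigma> (T t x)) = tr (mmult \<sigma> x))"

definition rho :: "real \<Rightarrow> mat" where
  "rho \<nu> = (\<lambda>i j. if i = j then complex_of_real ((1 - \<nu>^2) * \<nu>^(2*i)) else 0)"

end

theory Submission
  imports Defs
begin

text \<open>
  In the basis \<open>e\<^sub>n\<close> the quantum dynamical equation decouples into one system of linear ODEs for each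
  diagonal \<open>(k + i, k + j)\<close> of the matrix of \<open>T\<^sub>t(x)\<close>. On the main diagonal it is the backward equation of a
  birth-death chain with birth rates \<open>\<lambda>\<^sup>2 \<omega>\<^sub>n\<^sub>+\<^sub>1\<close> and death rates \<open>\<mu>\<^sup>2 \<omega>\<^sub>n\<close>, reversible with respect to \<open>\<nu>\<^sup>2\<^sup>n\<close>.
  For bounded solutions the flux through the edge \<open>(n, n + 1)\<close> tends to \<open>0\<close>, so the mean with respect to
  \<open>\<nu>\<^sup>2\<^sup>n\<close> is conserved; this gives the invariance of \<open>\<rho>\<close>, \<open>T\<^sub>t(1) = 1\<close> and the normality of \<open>T\<^sub>t\<close>. With the
  weights \<open>\<nu>\<^sup>2\<^sup>k\<close> the quadratic energy of a diagonal dissipates the squared increments along the diagonal and,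
  off the main diagonal, also the squared entries themselves. Hence these are square integrable in time, and
  being Lipschitz they tend to \<open>0\<close>: every entry of \<open>T\<^sub>t(|e\<^sub>a\<rangle>\<langle>e\<^sub>b|)\<close> converges to that of
  \<open>\<langle>e\<^sub>b, \<rho> e\<^sub>a\<rangle> 1\<close>. Dually, the entries of \<open>T\<^sub>*\<^sub>t(\<eta>)\<close> converge to those of \<open>\<rho>\<close>, and for
  density matrices entrywise convergence implies convergence in trace norm.

  The boundedness of the entries is where minimality enters. As the chain comes down from infinity in finite
  time, the equation has further positive solutions, obtained by adding mass that enters from infinity;
  the Dyson series provides a solution \<open>S\<close> with \<open>S\<^sub>t(1) \<le> 1\<close>, and \<open>T\<^sub>t(1) \<le> S\<^sub>t(1)\<close> by minimality.
\<close>

section \<open>Square roots and the sign iteration for positive operators\<close>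

text \<open>The trace norm rests on \<open>opabs\<close>, a \<open>THE\<close> over positive square
  roots, so existence and uniqueness of roots come before any statement about it. The root is built
  over a real Hilbert space; it commutes with everything that commutes with the operator, in
  particular with multiplication by the imaginary unit, and so is complex linear again. Instead of a
  polar decomposition there are contractions U_k, polynomials in M, with M U_k -> |M|. The
  dissipation rests on one comparison: entry (k, l) is lost at a rate built from arithmetic means of
  two values of \<open>omega\<close> and gained at rates built from their geometric means. They
  agree only for k = l, so diagonal entries merely equalize, while all others are damped. Single
  entries of T_t(x) are controlled this way, but a state pairs with the whole operator. The bridge
  is a positive functional that is continuous along the projections \<open>proj M\<close>, together
  with a norm bound uniform in time. That bound comes from order alone: splitting into hermitian
  parts costs a factor 2 and polarization another 2. The resulting 4 is harmless, since only
  uniformity is used.\<close>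

definition symmetric_op :: "('a::real_inner \<Rightarrow>\<^sub>L 'a) \<Rightarrow> bool" where
  "symmetric_op A \<longleftrightarrow> (\<forall>x y. inner (A x) y = inner x (A y))"

definition pos_op :: "('a::real_inner \<Rightarrow>\<^sub>L 'a) \<Rightarrow> bool" where
  "pos_op A \<longleftrightarrow> symmetric_op A \<and> (\<forall>x. 0 \<le> inner x (A x))"

definition commuting :: "('a::real_normed_vector \<Rightarrow>\<^sub>L 'a) \<Rightarrow> ('a \<Rightarrow>\<^sub>L 'a) \<Rightarrow> bool" where
  "commuting A B \<longleftrightarrow> (\<forall>x. A (B x) = B (A x))"

lemma symmetric_opD: "symmetric_op A \<Longrightarrow> inner (A x) y = inner x (A y)"
  by (simp add: symmetric_op_def)

lemma pos_opD: "pos_op A \<Longrightarrow> 0 \<le> inner x (A x)" "pos_op A \<Longrightarrow> symmetric_op A"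
  by (simp_all add: pos_op_def)

lemma commuting_sym: "commuting A B \<longleftrightarrow> commuting B A"
  by (auto simp: commuting_def)

lemma commutingD: "commuting A B \<Longrightarrow> A (B x) = B (A x)"
  by (simp add: commuting_def)

text \<open>The discriminant criterion: at \<open>s = c\<close>, \<open>t = -b\<close> the form
  equals \<open>c * (a * c - b\<^sup>2)\<close>. It serves both Cauchy-Schwarz for positive
  operators and the two-by-two minors of positive matrices.\<close>

lemma nonneg_quadratic_form:
  fixes a b c :: real
  assumes q: "\<And>s t. 0 \<le> s\<^sup>2 * a + 2 * s * t * b + t\<^sup>2 * c"
  shows "b\<^sup>2 \<le> a * c"
proof (cases "c = 0")
  case True
  have "b = 0"
  proof (rule ccontr)
    assume "b \<noteq> 0"
    have "0 \<le> a + 2 * (- (a + 1) / (2 * b)) * b" using q[of 1 "- (a + 1) / (2 * b)"] True by simp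
    also have "\<dots> = -1" using \<open>b \<noteq> 0\<close> by (simp add: field_simps)
    finally show False by simp
  qed
  then show ?thesis using True by simp
next
  case False
  then have "0 < c" using q[of 0 1] by simp
  have "0 \<le> c\<^sup>2 * a + 2 * c * (-b) * b + (-b)\<^sup>2 * c" by (rule q)
  also have "\<dots> = c * (a * c - b\<^sup>2)" by (simp add: power2_eq_square algebra_simps)
  finally show ?thesis using \<open>0 < c\<close> by (simp add: zero_le_mult_iff)
qed

lemma pos_op_Cauchy_Schwarz:
  assumes "pos_op A"
  shows "(inner x (A y))\<^sup>2 \<le> inner x (A x) * inner y (A y)"
proof (rule nonneg_quadratic_form)
  fix s t
  have "inner y (A x) = inner x (A y)"
    using assms by (metis inner_commute pos_opD(2) symmetric_opD)
  moreover have "0 \<le> inner (s *\<^sub>R x + t *\<^sub>R y) (A (s *\<^sub>R x + t *\<^sub>R y))"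
    by (rule pos_opD[OF assms])
  ultimately show "0 \<le> s\<^sup>2 * inner x (A x) + 2 * s * t * inner x (A y) + t\<^sup>2 * inner y (A y)"
    by (simp add: blinfun.bilinear_simps inner_simps power2_eq_square algebra_simps)
qed

text \<open>Cauchy-Schwarz for the form of \<open>A\<close>, applied to \<open>x\<close> and
  \<open>A x\<close>, bounds \<open>|A x|^4\<close> by \<open>K^2 |x|^2 |A x|^2\<close>; cancelling
  \<open>|A x|^2\<close> leaves the norm bound.\<close>

lemma pos_op_norm_le:
  assumes "pos_op A" and "\<And>x. inner x (A x) \<le> K * (norm x)\<^sup>2" and "0 \<le> K"
  shows "norm A \<le> K"
proof (rule norm_blinfun_bound)
  fix x
  let ?y = "A x"
  have "(inner (A x) (A x))\<^sup>2 = (inner x (A ?y))\<^sup>2"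
    using assms(1) by (simp add: symmetric_opD pos_opD)
  also have "\<dots> \<le> inner x (A x) * inner ?y (A ?y)" by (rule pos_op_Cauchy_Schwarz[OF assms(1)])
  also have "\<dots> \<le> (K * (norm x)\<^sup>2) * (K * (norm ?y)\<^sup>2)"
    by (intro mult_mono assms pos_opD[OF assms(1)]) (use assms in auto)
  finally have *: "(norm ?y)\<^sup>2 * (norm ?y)\<^sup>2 \<le> (K * norm x)\<^sup>2 * (norm ?y)\<^sup>2"
    by (simp add: power2_norm_eq_inner[symmetric] power2_eq_square mult_ac)
  have "(norm ?y)\<^sup>2 \<le> (K * norm x)\<^sup>2 \<or> norm ?y = 0"
  proof (rule disjCI)
    assume "norm ?y \<noteq> 0"
    then have "0 < (norm ?y)\<^sup>2" by simp
    with * show "(norm ?y)\<^sup>2 \<le> (K * norm x)\<^sup>2" by (rule mult_right_le_imp_le)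
  qed
  then show "norm (A x) \<le> K * norm x"
    using assms(3) by (auto intro: power2_le_imp_le)
qed (use assms in auto)

lemma pos_op_inner_le:
  fixes A :: "'a::real_inner \<Rightarrow>\<^sub>L 'a"
  shows "inner x (A x) \<le> norm A * (norm x)\<^sup>2"
proof -
  have "inner x (A x) \<le> norm x * norm (A x)" by (rule norm_cauchy_schwarz)
  also have "\<dots> \<le> norm x * (norm A * norm x)" by (intro mult_left_mono norm_blinfun) auto
  finally show ?thesis by (simp add: power2_eq_square mult_ac)
qed

text \<open>For \<open>A = 1 - X\<close> a limit \<open>Y\<close> satisfies
  \<open>2 Y = A + Y^2\<close>, that is, \<open>(1 - Y)^2 = X\<close>. All iterates are polynomials
  in \<open>A\<close>.\<close>

primrec sqrt_iter :: "('a::real_normed_vector \<Rightarrow>\<^sub>L 'a) \<Rightarrow> nat \<Rightarrow> ('a \<Rightarrow>\<^sub>L 'a)" where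
  "sqrt_iter A 0 = 0"
| "sqrt_iter A (Suc n) = (1/2) *\<^sub>R (A + (sqrt_iter A n o\<^sub>L sqrt_iter A n))"

text \<open>The same iteration for the number 1, the extreme case of \<open>norm A \<le> 1\<close>;
  it increases and stays below 1.\<close>

primrec sqrt_majorant :: "nat \<Rightarrow> real" where
  "sqrt_majorant 0 = 0"
| "sqrt_majorant (Suc n) = (1 + (sqrt_majorant n)\<^sup>2) / 2"

lemma sqrt_majorant_bounds: "0 \<le> sqrt_majorant n" "sqrt_majorant n \<le> 1"
proof (induction n)
  case (Suc n)
  { case 1 show ?case by simp }
  { case 2 then show ?case using power_le_one[of "sqrt_majorant n" 2] Suc by simp }
qed simp_all

lemma sqrt_majorant_mono: "sqrt_majorant n \<le> sqrt_majorant (Suc n)"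
proof -
  have "sqrt_majorant (Suc n) - sqrt_majorant n = (1 - sqrt_majorant n)\<^sup>2 / 2"
    by (simp add: power2_eq_square field_simps)
  then show ?thesis by (smt (verit) divide_nonneg_nonneg zero_le_power2)
qed

lemma sqrt_iter_commuting: "commuting C A \<Longrightarrow> commuting C (sqrt_iter A n)"
  by (induction n) (auto simp: commuting_def blinfun.bilinear_simps)

lemma sqrt_iter_norm: "norm A \<le> 1 \<Longrightarrow> norm (sqrt_iter A n) \<le> sqrt_majorant n"
proof (induction n)
  case (Suc n)
  have "norm (sqrt_iter A n o\<^sub>L sqrt_iter A n) \<le> norm (sqrt_iter A n) * norm (sqrt_iter A n)"
    by (rule norm_blinfun_compose)
  also have "\<dots> \<le> (sqrt_majorant n)\<^sup>2"
    unfolding power2_eq_square using Suc by (intro mult_mono) (auto simp: sqrt_majorant_bounds)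
  finally have "norm (A + (sqrt_iter A n o\<^sub>L sqrt_iter A n)) \<le> 1 + (sqrt_majorant n)\<^sup>2"
    using Suc norm_triangle_ineq[of A "sqrt_iter A n o\<^sub>L sqrt_iter A n"] by linarith
  then show ?case by simp
qed simp

text \<open>The iterates commute, so the difference of two squares factors, and each increment is
  dominated by the increment of the scalar iteration. The latter telescopes, hence the operators
  converge in norm.\<close>

lemma sqrt_iter_diff:
  assumes "norm A \<le> 1"
  shows "norm (sqrt_iter A (Suc n) - sqrt_iter A n) \<le> sqrt_majorant (Suc n) - sqrt_majorant n"
proof (induction n)
  case 0
  then show ?case using assms by simp
next
  case (Suc n)
  let ?Y = "sqrt_iter A"
  have c: "commuting (?Y m) (?Y k)" for m k
    by (intro sqrt_iter_commuting) (subst commuting_sym, intro sqrt_iter_commuting, simp add: commuting_def)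
  have "?Y (Suc (Suc n)) - ?Y (Suc n) = (1/2) *\<^sub>R ((?Y (Suc n) - ?Y n) o\<^sub>L (?Y (Suc n) + ?Y n))"
  proof (rule blinfun_eqI)
    fix x
    have 1: "?Y (Suc (Suc n)) x = (1/2) *\<^sub>R (A x + ?Y (Suc n) (?Y (Suc n) x))"
      by (subst sqrt_iter.simps(2)) (simp only: blinfun.bilinear_simps blinfun_apply_blinfun_compose)
    have 2: "?Y (Suc n) x = (1/2) *\<^sub>R (A x + ?Y n (?Y n x))"
      by (subst sqrt_iter.simps(2)) (simp only: blinfun.bilinear_simps blinfun_apply_blinfun_compose)
    have "(?Y (Suc (Suc n)) - ?Y (Suc n)) x = ?Y (Suc (Suc n)) x - ?Y (Suc n) x"
      by (simp only: blinfun.bilinear_simps)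
    also have "\<dots> = (1/2) *\<^sub>R (?Y (Suc n) (?Y (Suc n) x) - ?Y n (?Y n x))"
      using 1 2 by (simp only: scaleR_right_diff_distrib[symmetric]) (simp add: algebra_simps)
    also have "\<dots> = ((1/2) *\<^sub>R ((?Y (Suc n) - ?Y n) o\<^sub>L (?Y (Suc n) + ?Y n))) x"
      using commutingD[OF c[of "Suc n" n], of x]
      by (simp only: blinfun.bilinear_simps blinfun_apply_blinfun_compose) (simp add: algebra_simps)
    finally show "(?Y (Suc (Suc n)) - ?Y (Suc n)) x
        = ((1/2) *\<^sub>R ((?Y (Suc n) - ?Y n) o\<^sub>L (?Y (Suc n) + ?Y n))) x" .
  qed
  then have "norm (?Y (Suc (Suc n)) - ?Y (Suc n))
      = norm ((?Y (Suc n) - ?Y n) o\<^sub>L (?Y (Suc n) + ?Y n)) / 2" by simp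
  also have "\<dots> \<le> norm (?Y (Suc n) - ?Y n) * norm (?Y (Suc n) + ?Y n) / 2"
    by (intro divide_right_mono norm_blinfun_compose) auto
  also have "\<dots> \<le> (sqrt_majorant (Suc n) - sqrt_majorant n) * (sqrt_majorant (Suc n) + sqrt_majorant n) / 2"
    using Suc.IH sqrt_majorant_bounds(1) norm_triangle_le[of "?Y (Suc n)" "?Y n"]
      sqrt_iter_norm[OF assms, of n] sqrt_iter_norm[OF assms, of "Suc n"]
    by (intro divide_right_mono mult_mono) (auto simp del: sqrt_iter.simps sqrt_majorant.simps
        simp: sqrt_majorant_mono sqrt_majorant_bounds)
  also have "\<dots> = ((sqrt_majorant (Suc n))\<^sup>2 - (sqrt_majorant n)\<^sup>2) / 2"
    by (simp add: power2_eq_square algebra_simps)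
  also have "\<dots> = sqrt_majorant (Suc (Suc n)) - sqrt_majorant (Suc n)"
    using sqrt_majorant.simps(2)[of n] sqrt_majorant.simps(2)[of "Suc n"]
    by (simp only: diff_divide_distrib add_divide_distrib)
  finally show ?case .
qed

lemma symmetric_op_sqrt_iter: "symmetric_op A \<Longrightarrow> symmetric_op (sqrt_iter A n)"
  by (induction n) (auto simp: symmetric_op_def blinfun.bilinear_simps inner_simps)

text \<open>The commutation clause is inherited from the polynomials in \<open>1 - X\<close>. It
  carries the uniqueness of roots, the positivity of commuting products and the complex linearity of
  roots.\<close>

lemma sqrt_exists_unit_ball:
  fixes X :: "'a::{real_inner,banach} \<Rightarrow>\<^sub>L 'a"
  assumes X: "pos_op X" and nX: "norm X \<le> 1"
  shows "\<exists>S. pos_op S \<and> S o\<^sub>L S = X \<and> (\<forall>C. commuting C X \<longrightarrow> commuting C S)"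
proof -
  define A where "A = id_blinfun - X"
  have Ax: "A x = x - X x" for x by (simp add: A_def blinfun.bilinear_simps)
  have symA: "symmetric_op A"
    using pos_opD(2)[OF X] by (auto simp: symmetric_op_def Ax inner_simps)
  have "inner x (X x) \<le> (norm x)\<^sup>2" for x
    using pos_op_inner_le[of x X] mult_right_mono[OF nX, of "(norm x)\<^sup>2"] by simp
  then have posA: "pos_op A"
    using symA by (auto simp: pos_op_def Ax inner_simps power2_norm_eq_inner)
  have nA: "norm A \<le> 1"
    using X by (intro pos_op_norm_le[OF posA])
      (auto simp: Ax inner_simps power2_norm_eq_inner pos_op_def)
  let ?Y = "sqrt_iter A"
  have "summable (\<lambda>n. ?Y (Suc n) - ?Y n)"
  proof (rule summable_comparison_test')
    have "convergent sqrt_majorant"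
      by (intro Bseq_mono_convergent BseqI'[where K = 1])
        (auto simp: sqrt_majorant_bounds incseq_SucI sqrt_majorant_mono intro: lift_Suc_mono_le
          simp del: sqrt_majorant.simps)
    then show "summable (\<lambda>n. sqrt_majorant (Suc n) - sqrt_majorant n)"
      by (auto simp: convergent_def intro: telescope_summable simp del: sqrt_majorant.simps)
  qed (use sqrt_iter_diff[OF nA] in auto)
  then have "convergent (\<lambda>n. \<Sum>k<n. (?Y (Suc k) - ?Y k))"
    by (auto simp: summable_iff_convergent)
  then have "convergent ?Y"
    by (subst (asm) sum_lessThan_telescope) simp
  then obtain Y where Y: "?Y \<longlonglongrightarrow> Y" by (auto simp: convergent_def)
  have app: "(\<lambda>n. ?Y n x) \<longlonglongrightarrow> Y x" for x
    by (intro blinfun.tendsto Y tendsto_const)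
  have nY: "norm Y \<le> 1"
    using sqrt_iter_norm[OF nA] sqrt_majorant_bounds(2)
    by (intro Lim_bounded[OF tendsto_norm[OF Y], of 0]) (auto intro: order_trans)
  have fixpoint: "Y x = (1/2) *\<^sub>R (A x + Y (Y x))" for x
  proof (rule LIMSEQ_unique[OF LIMSEQ_Suc[OF app]])
    have "(\<lambda>n. (1/2) *\<^sub>R (A x + ?Y n (?Y n x))) \<longlonglongrightarrow> (1/2) *\<^sub>R (A x + Y (Y x))"
      by (intro tendsto_intros blinfun.tendsto Y app)
    then show "(\<lambda>n. ?Y (Suc n) x) \<longlonglongrightarrow> (1/2) *\<^sub>R (A x + Y (Y x))"
      by (simp add: blinfun.bilinear_simps)
  qed
  have symY: "inner (Y x) y = inner x (Y y)" for x y
  proof (rule LIMSEQ_unique)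
    show "(\<lambda>n. inner (?Y n x) y) \<longlonglongrightarrow> inner (Y x) y" by (intro tendsto_intros app)
    have "(\<lambda>n. inner x (?Y n y)) \<longlonglongrightarrow> inner x (Y y)" by (intro tendsto_intros app)
    then show "(\<lambda>n. inner (?Y n x) y) \<longlonglongrightarrow> inner x (Y y)"
      using symmetric_op_sqrt_iter[OF symA] by (simp add: symmetric_op_def)
  qed
  define S where "S = id_blinfun - Y"
  have Sx: "S x = x - Y x" for x by (simp add: S_def blinfun.bilinear_simps)
  have "inner x (Y x) \<le> (norm x)\<^sup>2" for x
    using pos_op_inner_le[of x Y] mult_right_mono[OF nY, of "(norm x)\<^sup>2"] by simp
  then have "pos_op S"
    using symY by (auto simp: pos_op_def symmetric_op_def Sx inner_simps power2_norm_eq_inner)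
  \<comment> \<open>The fixed-point equation reads \<open>2 Y = A + Y^2\<close>, so
    \<open>(1 - Y)^2 = 1 - A = X\<close>.\<close>
  moreover have "S o\<^sub>L S = X"
  proof (rule blinfun_eqI)
    fix x
    have "2 *\<^sub>R Y x = A x + Y (Y x)" using arg_cong[OF fixpoint[of x], of "\<lambda>z. 2 *\<^sub>R z"] by simp
    then have "Y (Y x) = Y x + Y x - (x - X x)"
      by (simp add: Ax scaleR_2 algebra_simps)
    then show "(S o\<^sub>L S) x = X x"
      by (simp add: Sx blinfun.bilinear_simps algebra_simps)
  qed
  moreover have "commuting C S" if C: "commuting C X" for C
  proof -
    have "commuting C A" using C by (auto simp: commuting_def Ax blinfun.bilinear_simps)
    then have *: "commuting C (?Y n)" for n by (rule sqrt_iter_commuting)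
    have "C (Y x) = Y (C x)" for x
    proof (rule LIMSEQ_unique)
      show "(\<lambda>n. C (?Y n x)) \<longlonglongrightarrow> C (Y x)" by (intro blinfun.tendsto tendsto_const app)
      show "(\<lambda>n. C (?Y n x)) \<longlonglongrightarrow> Y (C x)" using app[of "C x"] by (simp add: commutingD[OF *])
    qed
    then show ?thesis by (auto simp: commuting_def Sx blinfun.bilinear_simps)
  qed
  ultimately show ?thesis by blast
qed

lemma sqrt_exists:
  fixes X :: "'a::{real_inner,banach} \<Rightarrow>\<^sub>L 'a"
  assumes X: "pos_op X"
  shows "\<exists>S. pos_op S \<and> S o\<^sub>L S = X \<and> (\<forall>C. commuting C X \<longrightarrow> commuting C S)"
proof (cases "X = 0")
  case True
  have "pos_op (0 :: 'a \<Rightarrow>\<^sub>L 'a)" by (simp add: pos_op_def symmetric_op_def)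
  with True show ?thesis by (intro exI[of _ 0]) (auto simp: commuting_def)
next
  case False
  define c where "c = norm X"
  have c: "0 < c" using False by (simp add: c_def)
  have "pos_op (inverse c *\<^sub>R X)"
    using X c by (auto simp: pos_op_def symmetric_op_def blinfun.bilinear_simps)
  moreover have "norm (inverse c *\<^sub>R X) \<le> 1" using c by (simp add: c_def)
  ultimately obtain S where S: "pos_op S" "S o\<^sub>L S = inverse c *\<^sub>R X"
    "\<And>C. commuting C (inverse c *\<^sub>R X) \<Longrightarrow> commuting C S"
    using sqrt_exists_unit_ball by blast
  have "pos_op (sqrt c *\<^sub>R S)"
    using S(1) c by (auto simp: pos_op_def symmetric_op_def blinfun.bilinear_simps)
  moreover have "(sqrt c *\<^sub>R S) o\<^sub>L (sqrt c *\<^sub>R S) = X"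
  proof (rule blinfun_eqI)
    fix x
    have "S (S x) = inverse c *\<^sub>R X x"
      using arg_cong[OF S(2), of "\<lambda>Z. blinfun_apply Z x"] by (simp add: blinfun.bilinear_simps)
    then show "((sqrt c *\<^sub>R S) o\<^sub>L (sqrt c *\<^sub>R S)) x = X x"
      using c by (simp add: blinfun.bilinear_simps mult.assoc[symmetric])
  qed
  moreover have "commuting C (sqrt c *\<^sub>R S)" if "commuting C X" for C
  proof -
    have "commuting C (inverse c *\<^sub>R X)"
      using that by (auto simp: commuting_def blinfun.bilinear_simps)
    from S(3)[OF this] show ?thesis by (auto simp: commuting_def blinfun.bilinear_simps)
  qed
  ultimately show ?thesis by blast
qed

text \<open>A root \<open>S\<close> of \<open>A\<close> also commutes with \<open>B\<close>, which
  turns the form into that of \<open>B\<close> at \<open>S x\<close>.\<close>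

lemma pos_op_commuting_product:
  fixes A :: "'a::{real_inner,banach} \<Rightarrow>\<^sub>L 'a"
  assumes "pos_op A" "pos_op B" "commuting A B"
  shows "0 \<le> inner x (A (B x))"
proof -
  obtain S where S: "pos_op S" "S o\<^sub>L S = A" "commuting B S"
    using sqrt_exists[OF assms(1)] assms(3) commuting_sym[of A B] by blast
  have "inner x (A (B x)) = inner x (S (S (B x)))" by (simp flip: S(2))
  also have "\<dots> = inner (S x) (B (S x))"
    using S by (simp add: symmetric_opD[OF pos_opD(2)] commutingD[OF S(3)])
  finally show ?thesis using assms(2) by (simp add: pos_opD)
qed

text \<open>Both operators are compared with the constructed root \<open>S\<close>, with which they
  commute. For \<open>y = (B - S) x\<close> one has \<open>(B + S) y = 0\<close>, so both forms
  vanish at \<open>y\<close>; then \<open>B y = S y = 0\<close>, and \<open>|y|^2 = 0\<close> by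
  symmetry.\<close>

lemma sqrt_unique:
  fixes B :: "'a::{real_inner,banach} \<Rightarrow>\<^sub>L 'a"
  assumes B: "pos_op B" and C: "pos_op C" and eq: "B o\<^sub>L B = C o\<^sub>L C"
  shows "B = C"
proof -
  have *: "B = S" if B: "pos_op B" and S: "pos_op S" "S o\<^sub>L S = B o\<^sub>L B" "commuting B S"
    for B S :: "'a \<Rightarrow>\<^sub>L 'a"
  proof (rule blinfun_eqI)
    fix x
    define y where "y = B x - S x"
    have SB: "S (S z) = B (B z)" for z
      using arg_cong[OF S(2), of "\<lambda>Z. blinfun_apply Z z"] by simp
    have "B y + S y = 0"
      unfolding y_def using commutingD[OF S(3), of x] by (simp add: blinfun.bilinear_simps SB)
    then have "inner y (B y) + inner y (S y) = 0" by (metis inner_add_right inner_zero_right)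
    with pos_opD(1)[OF B, of y] pos_opD(1)[OF S(1), of y]
    have z: "inner y (B y) = 0" "inner y (S y) = 0" by linarith+
    have null: "A y = 0" if "pos_op A" "inner y (A y) = 0" for A
    proof -
      have "(inner (A y) (A y))\<^sup>2 \<le> inner (A y) (A (A y)) * inner y (A y)"
        using pos_op_Cauchy_Schwarz[OF that(1), of "A y" y] by simp
      with that(2) show ?thesis by simp
    qed
    have "inner y y = inner (B x) y - inner (S x) y" unfolding y_def by (simp add: inner_simps)
    also have "\<dots> = inner x (B y) - inner x (S y)"
      using B S by (simp add: symmetric_opD pos_opD)
    finally show "B x = S x" using null[OF B z(1)] null[OF S(1) z(2)] by (simp add: y_def)
  qed
  have "0 \<le> inner x (C (C x))" for x
    using inner_ge_zero[of "C x"] symmetric_opD[OF pos_opD(2)[OF C], of x "C x"] by simp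
  then have "pos_op (C o\<^sub>L C)"
    using C by (auto simp: pos_op_def symmetric_op_def)
  then obtain S where S: "pos_op S" "S o\<^sub>L S = C o\<^sub>L C"
    "\<And>D. commuting D (C o\<^sub>L C) \<Longrightarrow> commuting D S"
    using sqrt_exists by blast
  have "commuting B (B o\<^sub>L B)" "commuting C (C o\<^sub>L C)" by (simp_all add: commuting_def)
  then have "commuting B S" "commuting C S" using S(3) by (simp_all only: eq)
  then have "B = S" "C = S"
    using *[OF B S(1)] *[OF C S(1)] S(2) by (simp_all only: eq)
  then show ?thesis by simp
qed

text \<open>Multiplied by \<open>M\<close>, the recursion becomes
  \<open>R + (M^2 - R^2) / 2\<close>, the iteration for the root of \<open>M^2\<close>. Thus
  \<open>M U_n\<close> approaches \<open>|M|\<close>, while \<open>U_n\<close> plays the role of the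
  sign of \<open>M\<close> without an inverse or a kernel projection.\<close>

primrec sign_iter :: "('a::real_normed_vector \<Rightarrow>\<^sub>L 'a) \<Rightarrow> nat \<Rightarrow> ('a \<Rightarrow>\<^sub>L 'a)" where
  "sign_iter M 0 = 0"
| "sign_iter M (Suc n) = sign_iter M n
     + (1/2) *\<^sub>R (M o\<^sub>L (id_blinfun - (sign_iter M n o\<^sub>L sign_iter M n)))"

lemma sign_iter_commuting: "commuting C M \<Longrightarrow> commuting C (sign_iter M n)"
  by (induction n) (auto simp: commuting_def blinfun.bilinear_simps)

lemma sign_iter_apply:
  "sign_iter M (Suc n) x = sign_iter M n x + (1/2) *\<^sub>R (M x - M (sign_iter M n (sign_iter M n x)))"
  by (simp add: blinfun.bilinear_simps)

lemma sign_iter_commuting_self: "commuting M (sign_iter M n)"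
  by (intro sign_iter_commuting) (simp add: commuting_def)

lemma symmetric_op_sign_iter:
  assumes "symmetric_op M" shows "symmetric_op (sign_iter M n)"
proof (induction n)
  case (Suc n)
  let ?U = "sign_iter M n"
  have "inner (M (?U (?U x))) y = inner x (M (?U (?U y)))" for x y
    using Suc assms commutingD[OF sign_iter_commuting_self[of M n]] by (simp add: symmetric_op_def)
  then show ?case using Suc assms
    by (simp add: symmetric_op_def sign_iter_apply inner_simps del: sign_iter.simps)
qed (simp add: symmetric_op_def)

text \<open>Turns a norm bound into an order statement, to which products of commuting positive
  operators apply.\<close>

lemma norm_le_one_iff_symmetric:
  assumes "symmetric_op U"
  shows "norm U \<le> 1 \<longleftrightarrow> pos_op (id_blinfun - (U o\<^sub>L U))"
proof
  assume n: "norm U \<le> 1"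
  have "norm (U x) \<le> norm x" for x
    using norm_blinfun[of U x] mult_right_mono[OF n, of "norm x"] by simp
  then have "inner (U x) (U x) \<le> inner x x" for x
    by (simp flip: power2_norm_eq_inner)
  then show "pos_op (id_blinfun - (U o\<^sub>L U))"
    using assms by (auto simp: pos_op_def symmetric_op_def blinfun.bilinear_simps inner_simps)
next
  assume p: "pos_op (id_blinfun - (U o\<^sub>L U))"
  show "norm U \<le> 1"
  proof (rule norm_blinfun_bound)
    fix x
    have "0 \<le> inner x x - inner x (U (U x))"
      using pos_opD(1)[OF p, of x] by (simp add: blinfun.bilinear_simps inner_simps)
    then have "inner (U x) (U x) \<le> inner x x" using assms by (simp add: symmetric_op_def)
    then show "norm (U x) \<le> 1 * norm x" by (simp add: norm_le)
  qed simp
qed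

text \<open>With \<open>w = 1 - u\<^sup>2\<close> one has \<open>1 - (u + m w / 2)\<^sup>2 = w\<^sup>2 (1/2 - m\<^sup>2/4) + w (1 - m\<^sup>2) / 2 + w (u - m)\<^sup>2 / 2\<close>.\<close>
lemma sign_iter_norm:
  fixes M :: "'a::{real_inner,banach} \<Rightarrow>\<^sub>L 'a"
  assumes M: "symmetric_op M" and nM: "norm M \<le> 1"
  shows "norm (sign_iter M n) \<le> 1"
proof (induction n)
  case (Suc n)
  let ?U = "sign_iter M n"
  define W where "W = id_blinfun - (?U o\<^sub>L ?U)"
  define V where "V = id_blinfun - (M o\<^sub>L M)"
  have sU: "inner (?U x) y = inner x (?U y)" for x y
    using symmetric_op_sign_iter[OF M] by (simp add: symmetric_op_def)
  have sM: "inner (M x) y = inner x (M y)" for x y using M by (simp add: symmetric_op_def)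
  have W: "pos_op W" unfolding W_def
    using Suc symmetric_op_sign_iter[OF M] norm_le_one_iff_symmetric by blast
  have V: "pos_op V" unfolding V_def
    using nM M norm_le_one_iff_symmetric by blast
  have c: "M (?U x) = ?U (M x)" for x by (rule commutingD[OF sign_iter_commuting_self])
  have Wx: "W x = x - ?U (?U x)" for x by (simp add: W_def blinfun.bilinear_simps)
  have Vx: "V x = x - M (M x)" for x by (simp add: V_def blinfun.bilinear_simps)
  have cWV: "commuting W V"
    by (simp add: commuting_def Wx Vx blinfun.bilinear_simps c)
  show ?case
  proof (rule norm_blinfun_bound)
    fix x
    let ?w = "W x" and ?z = "?U x - M x"
    have a: "0 \<le> inner ?w ?w / 2 - inner (M ?w) (M ?w) / 4"
    proof -
      have "0 \<le> inner ?w (V ?w)" by (rule pos_opD[OF V])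
      then have "inner (M ?w) (M ?w) \<le> inner ?w ?w" by (simp add: Vx inner_simps sM)
      then show ?thesis using inner_ge_zero[of ?w] by linarith
    qed
    have b: "0 \<le> inner x (W (V x))" by (rule pos_op_commuting_product[OF W V cWV])
    have d: "0 \<le> inner ?z (W ?z)" by (rule pos_opD[OF W])
    have "sign_iter M (Suc n) x = ?U x + (1/2) *\<^sub>R M ?w"
      by (simp add: sign_iter_apply Wx blinfun.bilinear_simps)
    then have "inner x x - inner (sign_iter M (Suc n) x) (sign_iter M (Suc n) x)
       = (inner ?w ?w / 2 - inner (M ?w) (M ?w) / 4) + inner x (W (V x)) / 2 + inner ?z (W ?z) / 2"
      by (simp only: Wx Vx blinfun.bilinear_simps inner_simps c sU sM)
        (simp add: field_simps inner_commute c sU sM)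
    with a b d have "inner (sign_iter M (Suc n) x) (sign_iter M (Suc n) x) \<le> inner x x" by linarith
    then show "norm (sign_iter M (Suc n) x) \<le> 1 * norm x" by (simp add: norm_le)
  qed simp
qed simp

text \<open>The defect \<open>D k = S - R k\<close> obeys
  \<open>D (k+1) = D k (1 - (S + R k) / 2)\<close> and stays positive. Its form drops in each step
  by at least \<open>|D k x|^2 / 2\<close>, so these squares are summable and tend to 0.\<close>

lemma sign_iter_LIMSEQ:
  fixes M :: "'a::{real_inner,banach} \<Rightarrow>\<^sub>L 'a"
  assumes M: "symmetric_op M" and nM: "norm M \<le> 1"
    and S: "pos_op S" and SM: "S o\<^sub>L S = M o\<^sub>L M"
  shows "(\<lambda>k. M (sign_iter M k x)) \<longlonglongrightarrow> S x"
proof -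
  let ?U = "sign_iter M"
  define R where "R k = M o\<^sub>L ?U k" for k
  have Rx: "R k x = M (?U k x)" for k x by (simp add: R_def)
  have SS: "S (S x) = M (M x)" for x
    using arg_cong[OF SM, of "\<lambda>Z. blinfun_apply Z x"] by simp
  \<comment> \<open>Only the constructed root is known to commute with \<open>M\<close>; uniqueness
    identifies \<open>S\<close> with it.\<close>
  have cMS: "commuting M S"
  proof -
    have sM: "inner x (M (M y)) = inner (M x) (M y)" for x y
      using M by (simp add: symmetric_op_def)
    have "inner (M (M x)) y = inner x (M (M y))" for x y
      using M by (simp add: symmetric_op_def)
    moreover have "0 \<le> inner x (M (M x))" for x unfolding sM by simp
    ultimately have "pos_op (M o\<^sub>L M)" by (simp add: pos_op_def symmetric_op_def)
    then obtain S' where S': "pos_op S'" "S' o\<^sub>L S' = M o\<^sub>L M"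
      "\<And>C. commuting C (M o\<^sub>L M) \<Longrightarrow> commuting C S'"
      using sqrt_exists by blast
    have "commuting M (M o\<^sub>L M)" by (simp add: commuting_def)
    moreover have "S = S'" using sqrt_unique[OF S S'(1)] SM S'(2) by simp
    ultimately show ?thesis using S'(3) by simp
  qed
  have cSM: "S (M x) = M (S x)" for x using commutingD[OF cMS, of x] by simp
  have cMU: "M (?U k x) = ?U k (M x)" for k x by (rule commutingD[OF sign_iter_commuting_self])
  have cSU: "S (?U k x) = ?U k (S x)" for k x
    using sign_iter_commuting[of S M k] cMS commuting_sym[of S M] by (simp add: commuting_def)
  have sU: "inner (?U k x) y = inner x (?U k y)" for k x y
    using symmetric_op_sign_iter[OF M] by (simp add: symmetric_op_def)
  have sM: "inner (M x) y = inner x (M y)" for x y using M by (simp add: symmetric_op_def)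
  have sS: "inner (S x) y = inner x (S y)" for x y using S by (simp add: pos_op_def symmetric_op_def)
  have symR: "inner (R k x) y = inner x (R k y)" for k x y by (simp add: Rx sU sM cMU)
  have cSR: "S (R k x) = R k (S x)" for k x by (simp add: Rx cSM cSU)
  have step: "R (Suc k) x = R k x + (1/2) *\<^sub>R (S (S x) - R k (R k x))" for k x
    unfolding Rx sign_iter_apply by (simp add: blinfun.bilinear_simps SS cMU)
  have nS: "inner x (S x) \<le> inner x x" for x
  proof -
    have "inner (S x) (S x) = inner (M x) (M x)" by (simp add: sS SS sM)
    then have "norm (S x) = norm (M x)" by (simp add: norm_eq)
    also have "\<dots> \<le> norm x" using norm_blinfun[of M x] mult_right_mono[OF nM, of "norm x"] by simp
    finally have "inner x (S x) \<le> norm x * norm x"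
      using norm_cauchy_schwarz[of x "S x"] mult_left_mono[of "norm (S x)" "norm x" "norm x"] by simp
    then show ?thesis by (simp add: power2_norm_eq_inner flip: power2_eq_square)
  qed
  define D where "D k = S - R k" for k
  have Dx: "D k x = S x - R k x" for k x by (simp add: D_def blinfun.bilinear_simps)
  have pos: "pos_op (R k) \<and> pos_op (D k)" for k
  proof (induction k)
    case 0
    then show ?case using S by (simp add: R_def D_def pos_op_def symmetric_op_def blinfun.bilinear_simps)
  next
    case (Suc k)
    define P where "P = S + R k"
    define E where "E = id_blinfun - (1/2) *\<^sub>R P"
    have Px: "P x = S x + R k x" for x by (simp add: P_def blinfun.bilinear_simps)
    have Ex: "E x = x - (1/2) *\<^sub>R P x" for x by (simp add: E_def blinfun.bilinear_simps)
    have pP: "pos_op P" using S Suc by (simp add: pos_op_def symmetric_op_def Px inner_simps)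
    have pE: "pos_op E"
      unfolding pos_op_def symmetric_op_def
    proof (intro conjI allI)
      show "inner (E x) y = inner x (E y)" for x y
        using pP by (simp add: pos_op_def symmetric_op_def Ex inner_simps)
      \<comment> \<open>\<open>1 - (S + R k) / 2\<close> is the sum of \<open>1 - S\<close> and
        \<open>D k / 2\<close>, both positive.\<close>
      show "0 \<le> inner x (E x)" for x
        using nS[of x] pos_opD(1)[OF conjunct2[OF Suc.IH], of x] by (simp add: Ex Px Dx inner_simps)
    qed
    have cP: "commuting (D k) P"
      by (simp add: commuting_def Dx Px blinfun.bilinear_simps cSR)
    have "commuting (D k) E"
      using cP by (simp add: commuting_def Ex blinfun.bilinear_simps)
    with cP have "0 \<le> inner x (D k (P x))" "0 \<le> inner x (D k (E x))" for x
      using pos_op_commuting_product Suc.IH pP pE by blast+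
    moreover have "R (Suc k) x = R k x + (1/2) *\<^sub>R D k (P x)" for x
      by (simp add: step Dx Px blinfun.bilinear_simps cSR)
    moreover have "D (Suc k) x = D k (E x)" for x
    proof -
      have "(1/2) *\<^sub>R (S (S x) + R k (S x))
          = (1/2) *\<^sub>R (R k (S x) + R k (R k x)) + (1/2) *\<^sub>R (S (S x) - R k (R k x))"
        by (simp flip: scaleR_add_right)
      then show ?thesis
        by (simp only: step Dx Px Ex blinfun.bilinear_simps cSR) simp
    qed
    ultimately have "0 \<le> inner x (R (Suc k) x)" "0 \<le> inner x (D (Suc k) x)" for x
      using Suc.IH by (simp_all add: pos_op_def inner_simps)
    moreover have "inner (D (Suc k) x) y = inner x (D (Suc k) y)" for x y
      by (simp add: Dx inner_simps symR sS)
    ultimately show ?case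
      by (simp add: pos_op_def symmetric_op_def symR)
  qed
  have decr: "(norm (D k x))\<^sup>2 / 2 \<le> inner x (D k x) - inner x (D (Suc k) x)" for k
  proof -
    have "commuting (D k) (R k)"
      by (simp add: commuting_def Dx blinfun.bilinear_simps cSR)
    then have "0 \<le> inner x (D k (R k x))" using pos_op_commuting_product pos by blast
    moreover have "inner x (D (Suc k) x)
        = inner x (D k x) - inner x (D k (D k x)) / 2 - inner x (D k (R k x))"
      by (simp add: step Dx blinfun.bilinear_simps inner_simps cSR field_simps)
    moreover have "inner x (D k (D k x)) = (norm (D k x))\<^sup>2"
      using pos[of k] by (simp add: power2_norm_eq_inner pos_op_def symmetric_op_def)
    ultimately show ?thesis by linarith
  qed
  have "(\<Sum>k<n. (norm (D k x))\<^sup>2) \<le> 2 * inner x (D 0 x)" for n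
  proof -
    have "(\<Sum>k<n. (norm (D k x))\<^sup>2 / 2) \<le> (\<Sum>k<n. inner x (D k x) - inner x (D (Suc k) x))"
      by (intro sum_mono decr)
    also have "\<dots> = inner x (D 0 x) - inner x (D n x)" by (rule sum_lessThan_telescope')
    also have "\<dots> \<le> inner x (D 0 x)" using pos[of n] by (simp add: pos_op_def)
    finally show ?thesis by (simp flip: sum_divide_distrib)
  qed
  then have "summable (\<lambda>k. (norm (D k x))\<^sup>2)"
    by (intro summableI_nonneg_bounded) auto
  then have "(\<lambda>k. (norm (D k x))\<^sup>2) \<longlonglongrightarrow> 0" by (rule summable_LIMSEQ_zero)
  from tendsto_real_sqrt[OF this] have "(\<lambda>k. norm (S x - M (?U k x))) \<longlonglongrightarrow> 0" by (simp add: Dx Rx)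
  then have "(\<lambda>k. S x - M (?U k x)) \<longlonglongrightarrow> 0" by (simp add: tendsto_norm_zero_iff)
  from tendsto_diff[OF tendsto_const[of "S x"] this] show ?thesis by simp
qed

section \<open>The Hilbert space of square-summable sequences\<close>

lemma ell2_scale: "ell2 u \<Longrightarrow> ell2 (\<lambda>n. c * u n)"
  by (auto simp: ell2_def norm_mult power_mult_distrib intro: summable_mult)

lemma cmod_add_sq_le: "(cmod (a + b))\<^sup>2 \<le> 2 * (cmod a)\<^sup>2 + 2 * (cmod b)\<^sup>2"
proof -
  have "(cmod (a + b))\<^sup>2 \<le> (cmod a + cmod b)\<^sup>2"
    by (intro power_mono norm_triangle_ineq) auto
  also have "\<dots> \<le> 2 * (cmod a)\<^sup>2 + 2 * (cmod b)\<^sup>2"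
    using zero_le_power2[of "cmod a - cmod b"] by (simp add: power2_eq_square algebra_simps)
  finally show ?thesis .
qed

lemma ell2_add: "ell2 u \<Longrightarrow> ell2 v \<Longrightarrow> ell2 (\<lambda>n. u n + v n)"
  unfolding ell2_def
  by (rule summable_comparison_test'[where g = "\<lambda>n. 2 * (cmod (u n))\<^sup>2 + 2 * (cmod (v n))\<^sup>2" and N = 0])
    (auto intro!: summable_add summable_mult cmod_add_sq_le)

lemma ell2_mult_summable:
  assumes "ell2 u" "ell2 v" shows "summable (\<lambda>n. cmod (u n) * cmod (v n))"
proof (rule summable_comparison_test'[where N = 0])
  show "summable (\<lambda>n. ((cmod (u n))\<^sup>2 + (cmod (v n))\<^sup>2) / 2)"
    using assms unfolding ell2_def by (intro summable_divide summable_add)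
  show "norm (cmod (u n) * cmod (v n)) \<le> ((cmod (u n))\<^sup>2 + (cmod (v n))\<^sup>2) / 2" for n
    using sum_squares_bound[of "cmod (u n)" "cmod (v n)"] by simp
qed

lemma inprod_summable:
  assumes "ell2 u" "ell2 v" shows "summable (\<lambda>n. cnj (u n) * v n)"
  by (rule summable_norm_cancel) (use ell2_mult_summable[OF assms] in \<open>simp add: norm_mult\<close>)

text \<open>The type becomes a real Hilbert space with inner product \<open>Re cinner\<close>, so
  that the preceding theory of bounded real-linear maps applies; the complex structure is carried by
  \<open>cscale\<close> and \<open>cinner\<close>.\<close>

typedef l2 = "{u :: vec. ell2 u}" morphisms coord Abs_l2
  by (intro exI[of _ "\<lambda>_. 0"]) (simp add: ell2_def)

lemma ell2_coord [simp]: "ell2 (coord u)"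
  using coord[of u] by simp

lemma coord_Abs: "ell2 u \<Longrightarrow> coord (Abs_l2 u) = u"
  by (simp add: Abs_l2_inverse)

lemma l2_eqI: "(\<And>n. coord u n = coord v n) \<Longrightarrow> u = v"
  by (metis coord_inject ext)

definition cscale :: "complex \<Rightarrow> l2 \<Rightarrow> l2" where
  "cscale c u = Abs_l2 (\<lambda>n. c * coord u n)"

definition cinner :: "l2 \<Rightarrow> l2 \<Rightarrow> complex" where
  "cinner u v = inprod (coord u) (coord v)"

lemma coord_cscale [simp]: "coord (cscale c u) n = c * coord u n"
  by (simp add: cscale_def coord_Abs ell2_scale)

instantiation l2 :: real_vector
begin

definition "0 = Abs_l2 (\<lambda>_. 0)"
definition "u + v = Abs_l2 (\<lambda>n. coord u n + coord v n)"
definition "- u = cscale (-1) u"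
definition "u - v = u + cscale (-1) v" for u v :: l2
definition "scaleR c u = cscale (complex_of_real c) u"

lemma coord_zero [simp]: "coord 0 n = 0"
  unfolding zero_l2_def by (subst coord_Abs) (simp_all add: ell2_def)

lemma coord_add [simp]: "coord (u + v) n = coord u n + coord v n"
  by (simp add: plus_l2_def coord_Abs ell2_add)

lemma coord_uminus [simp]: "coord (- u) n = - coord u n"
  by (simp add: uminus_l2_def)

lemma coord_diff [simp]: "coord (u - v) n = coord u n - coord v n"
  by (simp add: minus_l2_def)

lemma coord_scaleR [simp]: "coord (c *\<^sub>R u) n = complex_of_real c * coord u n"
  by (simp add: scaleR_l2_def)

instance
  by standard (auto intro!: l2_eqI simp: algebra_simps)

end

lemma cinner_summable: "summable (\<lambda>n. cnj (coord u n) * coord v n)"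
  by (simp add: inprod_summable)

lemma cinner_add_left: "cinner (u + v) w = cinner u w + cinner v w"
  by (simp add: cinner_def inprod_def distrib_left distrib_right suminf_add cinner_summable)

lemma cinner_add_right: "cinner w (u + v) = cinner w u + cinner w v"
  by (simp add: cinner_def inprod_def distrib_left distrib_right suminf_add cinner_summable)

lemma cinner_scale_left: "cinner (cscale c u) w = cnj c * cinner u w"
  using suminf_mult[OF cinner_summable[of u w], of "cnj c"]
  by (simp add: cinner_def inprod_def mult.assoc)

lemma cinner_scale_right: "cinner w (cscale c u) = c * cinner w u"
  using suminf_mult[OF cinner_summable[of w u], of c]
  by (simp add: cinner_def inprod_def mult_ac)

lemma cinner_commute: "cinner u v = cnj (cinner v u)"
proof -
  have "(\<lambda>n. cnj (cnj (coord v n) * coord u n)) sums cnj (cinner v u)"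
    unfolding cinner_def inprod_def sums_cnj by (rule summable_sums[OF cinner_summable])
  then show ?thesis
    by (simp add: cinner_def inprod_def sums_iff mult.commute)
qed

lemma cinner_self_sums: "(\<lambda>n. (cmod (coord u n))\<^sup>2) sums Re (cinner u u)"
  and cinner_self_Im: "Im (cinner u u) = 0"
proof -
  have eq: "(\<lambda>n. cnj (coord u n) * coord u n) = (\<lambda>n. complex_of_real ((cmod (coord u n))\<^sup>2))"
    by (simp add: complex_norm_square mult.commute del: of_real_power)
  have *: "(\<lambda>n. complex_of_real ((cmod (coord u n))\<^sup>2)) sums cinner u u"
    unfolding cinner_def inprod_def eq[symmetric] by (rule summable_sums[OF cinner_summable])
  from sums_Re[OF *] show "(\<lambda>n. (cmod (coord u n))\<^sup>2) sums Re (cinner u u)" by simp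
  from sums_Im[OF *] show "Im (cinner u u) = 0" by (simp add: sums_iff)
qed

instantiation l2 :: real_inner
begin

definition "inner u v = Re (cinner u v)"
definition "norm u = sqrt (inner u u)" for u :: l2
definition "sgn u = u /\<^sub>R norm u" for u :: l2
definition "dist u v = norm (u - v)" for u v :: l2
definition "(uniformity :: (l2 \<times> l2) filter) = (INF e\<in>{0 <..}. principal {(x, y). dist x y < e})"
definition "open (U :: l2 set) = (\<forall>x\<in>U. \<forall>\<^sub>F (x', y) in uniformity. x' = x \<longrightarrow> y \<in> U)"

instance
proof
  fix u v w :: l2 and c :: real
  show "inner u v = inner v u"
    using cinner_commute[of u v] by (simp add: inner_l2_def)
  show "inner (u + v) w = inner u w + inner v w"
    by (simp add: inner_l2_def cinner_add_left)
  show "inner (c *\<^sub>R u) v = c * inner u v"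
    by (simp add: inner_l2_def scaleR_l2_def cinner_scale_left)
  show "0 \<le> inner u u"
    unfolding inner_l2_def using cinner_self_sums[of u]
    by (metis sums_le[OF _ sums_zero] zero_le_power2)
  show "inner u u = 0 \<longleftrightarrow> u = 0"
  proof
    assume "inner u u = 0"
    then have s: "(\<lambda>n. (cmod (coord u n))\<^sup>2) sums 0"
      using cinner_self_sums[of u] by (simp add: inner_l2_def)
    then have "(cmod (coord u n))\<^sup>2 = 0" for n
      using suminf_eq_zero_iff[of "\<lambda>n. (cmod (coord u n))\<^sup>2"] by (auto simp: sums_iff)
    then show "u = 0" by (intro l2_eqI) simp
  next
    assume "u = 0"
    then show "inner u u = 0" by (simp add: inner_l2_def cinner_def inprod_def)
  qed
qed (fact norm_l2_def sgn_l2_def dist_l2_def uniformity_l2_def open_l2_def)+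

end

lemma norm_l2_sums: "(\<lambda>n. (cmod (coord u n))\<^sup>2) sums (norm u)\<^sup>2"
  using cinner_self_sums[of u] by (simp add: power2_norm_eq_inner inner_l2_def)

lemma cinner_self: "cinner u u = complex_of_real ((norm u)\<^sup>2)"
  by (simp add: complex_eq_iff cinner_self_Im power2_norm_eq_inner inner_l2_def del: of_real_power)

lemma norm_l2_vnorm: "norm u = vnorm (coord u)"
  using norm_l2_sums[of u] unfolding vnorm_def by (simp add: sums_iff real_sqrt_unique)

lemma norm_l2_le: 
  assumes "\<And>N. (\<Sum>n<N. (cmod (coord u n))\<^sup>2) \<le> C\<^sup>2" "0 \<le> C"
  shows "norm u \<le> C"
proof -
  have "(norm u)\<^sup>2 \<le> C\<^sup>2"
    using norm_l2_sums[of u] unfolding sums_def by (rule LIMSEQ_le_const2) (use assms in auto)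
  then show ?thesis using assms(2) by (rule power2_le_imp_le)
qed

lemma sum_coord_le_norm: "(\<Sum>n<N. (cmod (coord u n))\<^sup>2) \<le> (norm u)\<^sup>2"
  using norm_l2_sums[of u] by (metis sum_le_suminf finite_lessThan sums_iff zero_le_power2)

lemma cmod_coord_le: "cmod (coord u n) \<le> norm u"
proof -
  have "(cmod (coord u n))\<^sup>2 \<le> (\<Sum>k<Suc n. (cmod (coord u k))\<^sup>2)"
    by (rule member_le_sum) auto
  also have "\<dots> \<le> (norm u)\<^sup>2" by (rule sum_coord_le_norm)
  finally show ?thesis by (rule power2_le_imp_le) simp
qed

lemma coord_bounded_linear: "bounded_linear (\<lambda>u. coord u n)"
  by (rule bounded_linear_intro[where K = 1]) (auto simp: scaleR_conv_of_real cmod_coord_le)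

lemma tendsto_coord: "(f \<longlongrightarrow> u) F \<Longrightarrow> ((\<lambda>x. coord (f x) n) \<longlongrightarrow> coord u n) F"
  by (rule bounded_linear.tendsto[OF coord_bounded_linear])

text \<open>The limit is taken coordinatewise; the Cauchy estimate passes to it on every finite
  section, with a bound independent of the length of the section.\<close>

instance l2 :: banach
proof
  fix X :: "nat \<Rightarrow> l2"
  assume X: "Cauchy X"
  have "Cauchy (\<lambda>m. coord (X m) n)" for n
    by (rule bounded_linear.Cauchy[OF coord_bounded_linear X])
  then have "\<forall>n. \<exists>l. (\<lambda>m. coord (X m) n) \<longlonglongrightarrow> l"
    using Cauchy_convergent unfolding convergent_def by blast
  from choice[OF this] obtain u where u: "\<And>n. (\<lambda>m. coord (X m) n) \<longlonglongrightarrow> u n" by blast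
  have bound: "\<exists>N. \<forall>m\<ge>N. \<forall>K. (\<Sum>n<K. (cmod (coord (X m) n - u n))\<^sup>2) \<le> e\<^sup>2" if "0 < e" for e
  proof -
    obtain N where N: "\<And>m k. m \<ge> N \<Longrightarrow> k \<ge> N \<Longrightarrow> norm (X m - X k) < e"
      using CauchyD[OF X \<open>0 < e\<close>] by blast
    have "(\<Sum>n<K. (cmod (coord (X m) n - u n))\<^sup>2) \<le> e\<^sup>2" if "m \<ge> N" for m K
    proof (rule LIMSEQ_le_const2)
      show "(\<lambda>k. \<Sum>n<K. (cmod (coord (X m) n - coord (X k) n))\<^sup>2) \<longlonglongrightarrow> (\<Sum>n<K. (cmod (coord (X m) n - u n))\<^sup>2)"
        by (intro tendsto_intros u)
      show "\<exists>M. \<forall>k\<ge>M. (\<Sum>n<K. (cmod (coord (X m) n - coord (X k) n))\<^sup>2) \<le> e\<^sup>2"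
      proof (intro exI[of _ N] allI impI)
        fix k assume "k \<ge> N"
        have "(\<Sum>n<K. (cmod (coord (X m) n - coord (X k) n))\<^sup>2) \<le> (norm (X m - X k))\<^sup>2"
          using sum_coord_le_norm[of "X m - X k" K] by simp
        also have "\<dots> \<le> e\<^sup>2" using N[OF \<open>m \<ge> N\<close> \<open>k \<ge> N\<close>] by (intro power_mono) auto
        finally show "(\<Sum>n<K. (cmod (coord (X m) n - coord (X k) n))\<^sup>2) \<le> e\<^sup>2" .
      qed
    qed
    then show ?thesis by blast
  qed
  obtain N where N: "\<And>K. (\<Sum>n<K. (cmod (coord (X N) n - u n))\<^sup>2) \<le> 1"
    using bound[OF zero_less_one] unfolding one_power2 by blast
  have "ell2 (\<lambda>n. coord (X N) n - u n)"
    unfolding ell2_def by (rule summableI_nonneg_bounded[where x = 1]) (use N in auto)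
  from ell2_add[OF ell2_scale[OF this, of "-1"] ell2_coord[of "X N"]] have "ell2 u" by simp
  then have cu: "coord (Abs_l2 u) = u" by (rule coord_Abs)
  have "X \<longlonglongrightarrow> Abs_l2 u"
    unfolding LIMSEQ_iff
  proof (intro allI impI)
    fix e :: real assume "0 < e"
    then obtain N where N: "\<forall>m\<ge>N. \<forall>K. (\<Sum>n<K. (cmod (coord (X m) n - u n))\<^sup>2) \<le> (e/2)\<^sup>2"
      using bound[of "e/2"] by auto
    have "norm (X m - Abs_l2 u) < e" if "m \<ge> N" for m
    proof -
      have "norm (X m - Abs_l2 u) \<le> e/2"
        by (rule norm_l2_le) (use N that \<open>0 < e\<close> in \<open>auto simp: cu\<close>)
      with \<open>0 < e\<close> show ?thesis by linarith
    qed
    then show "\<exists>N. \<forall>m\<ge>N. norm (X m - Abs_l2 u) < e" by blast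
  qed
  then show "convergent X" by (auto simp: convergent_def)
qed

lemma norm_cscale [simp]: "norm (cscale c u) = cmod c * norm u"
proof -
  have "(norm (cscale c u))\<^sup>2 = (cmod c * norm u)\<^sup>2"
    using norm_l2_sums[of "cscale c u"] sums_mult[OF norm_l2_sums[of u], of "(cmod c)\<^sup>2"]
    by (auto simp: norm_mult power_mult_distrib dest: sums_unique2)
  then show ?thesis by (simp add: power2_eq_iff_nonneg)
qed

lemma cscale_one [simp]: "cscale 1 u = u"
  and cscale_add: "cscale c (u + v) = cscale c u + cscale c v"
  and cscale_scaleR: "cscale c (a *\<^sub>R u) = a *\<^sub>R cscale c u"
  by (auto intro!: l2_eqI simp: algebra_simps)

lemma cinner_diff_right: "cinner w (u - v) = cinner w u - cinner w v"
  by (simp add: minus_l2_def cinner_add_right cinner_scale_right)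

lemma cinner_zero [simp]: "cinner 0 w = 0" "cinner w 0 = 0"
  by (simp_all add: cinner_def inprod_def)

lemma cmod_cinner_le: "cmod (cinner u v) \<le> norm u * norm v"
proof (cases "cinner u v = 0")
  case False
  \<comment> \<open>A phase that makes the complex inner product real and nonnegative, so that the
    real Cauchy-Schwarz inequality applies.\<close>
  define c where "c = cnj (cinner u v) / complex_of_real (cmod (cinner u v))"
  have nc: "cmod c = 1" using False by (simp add: c_def norm_divide)
  have "c * cinner u v = complex_of_real (cmod (cinner u v))"
    using False by (simp add: c_def complex_norm_square[symmetric] mult.commute power2_eq_square)
  then have "cmod (cinner u v) = inner u (cscale c v)"
    by (simp add: inner_l2_def cinner_scale_right)
  also have "\<dots> \<le> norm u * norm v" using norm_cauchy_schwarz[of u "cscale c v"] nc by simp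
  finally show ?thesis .
qed simp

lemma cinner_bounded_bilinear: "bounded_bilinear cinner"
proof
  show "\<exists>K. \<forall>a b. norm (cinner a b) \<le> norm a * norm b * K"
    using cmod_cinner_le by (intro exI[of _ 1]) auto
qed (auto simp: cinner_add_left cinner_add_right scaleR_l2_def cinner_scale_left cinner_scale_right
    scaleR_conv_of_real)

lemmas tendsto_cinner = bounded_bilinear.tendsto[OF cinner_bounded_bilinear]

definition unit_vec :: "nat \<Rightarrow> vec" where
  "unit_vec k = (\<lambda>n. if n = k then 1 else 0)"

definition trunc :: "nat \<Rightarrow> vec \<Rightarrow> vec" where
  "trunc N u = (\<lambda>n. if n < N then u n else 0)"

lemma ell2_finite: "(\<And>n. N \<le> n \<Longrightarrow> u n = 0) \<Longrightarrow> ell2 u"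
  unfolding ell2_def by (rule summable_finite[of "{..<N}"]) auto

lemma ell2_unit_vec [simp]: "ell2 (unit_vec k)"
  by (rule ell2_finite[of "Suc k"]) (simp add: unit_vec_def)

lemma ell2_trunc [simp]: "ell2 (trunc N u)"
  by (rule ell2_finite[of N]) (simp add: trunc_def)

definition ket :: "nat \<Rightarrow> l2" where "ket k = Abs_l2 (unit_vec k)"

definition ltrunc :: "nat \<Rightarrow> vec \<Rightarrow> l2" where "ltrunc N u = Abs_l2 (trunc N u)"

lemma coord_ket [simp]: "coord (ket k) = unit_vec k"
  by (simp add: ket_def coord_Abs)

lemma coord_ltrunc [simp]: "coord (ltrunc N u) = trunc N u"
  by (simp add: ltrunc_def coord_Abs)

lemma inprod_unit_vec: "inprod (unit_vec k) u = u k"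
proof -
  have "(\<lambda>n. cnj (unit_vec k n) * u n) sums (cnj (unit_vec k k) * u k)"
    using sums_finite[of "{k}" "\<lambda>n. cnj (unit_vec k n) * u n"] by (simp add: unit_vec_def)
  then show ?thesis by (simp add: inprod_def unit_vec_def sums_iff)
qed

lemma mapply_unit_vec: "mapply M (unit_vec k) = (\<lambda>i. M i k)"
proof
  fix i
  have "(\<lambda>j. M i j * unit_vec k j) sums (M i k * unit_vec k k)"
    using sums_finite[of "{k}" "\<lambda>j. M i j * unit_vec k j"] by (simp add: unit_vec_def)
  then show "mapply M (unit_vec k) i = M i k" by (simp add: mapply_def unit_vec_def sums_iff)
qed

lemma cinner_ket: "cinner (ket k) u = coord u k"
  by (simp add: cinner_def inprod_unit_vec)

lemma norm_ket [simp]: "norm (ket k) = 1"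
proof -
  have "complex_of_real ((norm (ket k))\<^sup>2) = 1"
    unfolding cinner_self[symmetric] cinner_ket by (simp add: unit_vec_def)
  then have "(norm (ket k))\<^sup>2 = 1" by (simp only: of_real_eq_1_iff)
  then show ?thesis by (simp add: power2_eq_1_iff) (metis norm_ge_zero not_one_le_zero neg_0_le_iff_le)
qed

lemma norm_ltrunc: "(norm (ltrunc N u))\<^sup>2 = (\<Sum>n<N. (cmod (u n))\<^sup>2)"
proof -
  have "(\<lambda>n. (cmod (trunc N u n))\<^sup>2) sums (\<Sum>n<N. (cmod (trunc N u n))\<^sup>2)"
    by (rule sums_finite) (auto simp: trunc_def)
  also have "(\<Sum>n<N. (cmod (trunc N u n))\<^sup>2) = (\<Sum>n<N. (cmod (u n))\<^sup>2)"
    by (intro sum.cong) (auto simp: trunc_def)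
  finally show ?thesis using norm_l2_sums[of "ltrunc N u"] by (auto dest: sums_unique2)
qed

lemma ltrunc_sum: "ltrunc N u = (\<Sum>k<N. cscale (u k) (ket k))"
proof (induction N)
  case (Suc N)
  have "ltrunc (Suc N) u = ltrunc N u + cscale (u N) (ket N)"
    by (rule l2_eqI) (auto simp: trunc_def unit_vec_def less_Suc_eq)
  then show ?case using Suc by simp
qed (auto intro!: l2_eqI simp: trunc_def)

lemma ltrunc_LIMSEQ: "(\<lambda>N. ltrunc N (coord u)) \<longlonglongrightarrow> u"
proof -
  have eq: "(norm (u - ltrunc N (coord u)))\<^sup>2 = (norm u)\<^sup>2 - (\<Sum>n<N. (cmod (coord u n))\<^sup>2)" for N
  proof -
    have "(\<lambda>n. (cmod (coord u n))\<^sup>2 - (cmod (trunc N (coord u) n))\<^sup>2)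
        sums ((norm u)\<^sup>2 - (norm (ltrunc N (coord u)))\<^sup>2)"
      using sums_diff[OF norm_l2_sums[of u] norm_l2_sums[of "ltrunc N (coord u)"]] by simp
    moreover have "(\<lambda>n. (cmod (coord u n))\<^sup>2 - (cmod (trunc N (coord u) n))\<^sup>2)
        = (\<lambda>n. (cmod (coord (u - ltrunc N (coord u)) n))\<^sup>2)"
      by (auto simp: trunc_def fun_eq_iff)
    ultimately show ?thesis
      using norm_l2_sums[of "u - ltrunc N (coord u)"] by (simp add: norm_ltrunc sums_unique2)
  qed
  have "(\<lambda>N. (norm u)\<^sup>2 - (\<Sum>n<N. (cmod (coord u n))\<^sup>2)) \<longlonglongrightarrow> (norm u)\<^sup>2 - (norm u)\<^sup>2"
    using norm_l2_sums[of u] unfolding sums_def by (intro tendsto_diff tendsto_const)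
  then have "(\<lambda>N. sqrt ((norm (u - ltrunc N (coord u)))\<^sup>2)) \<longlonglongrightarrow> sqrt 0"
    by (intro tendsto_real_sqrt) (simp add: eq)
  then have "(\<lambda>N. u - ltrunc N (coord u)) \<longlonglongrightarrow> 0" by (simp add: tendsto_norm_zero_iff)
  from tendsto_diff[OF tendsto_const[of u] this] show ?thesis by simp
qed

section \<open>Matrices as operators\<close>

text \<open>Finite sections of the sesquilinear form. Boundedness and positivity are both tested on
  them, where no series occurs and entrywise limits can be taken freely.\<close>

definition sform :: "nat \<Rightarrow> mat \<Rightarrow> vec \<Rightarrow> vec \<Rightarrow> complex" where
  "sform N M v u = (\<Sum>k<N. \<Sum>l<N. cnj (v k) * M k l * u l)"

definition sq :: "nat \<Rightarrow> vec \<Rightarrow> real" where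
  "sq N u = (\<Sum>k<N. (cmod (u k))\<^sup>2)"

text \<open>Boundedness is left out on purpose: the matrices of the Dyson series are known to be
  positive before they are known to be bounded.\<close>

definition psd :: "mat \<Rightarrow> bool" where
  "psd M \<longleftrightarrow> (\<forall>N u. Im (sform N M u u) = 0 \<and> 0 \<le> Re (sform N M u u))"

definition op_of :: "mat \<Rightarrow> l2 \<Rightarrow>\<^sub>L l2" where
  "op_of M = Blinfun (\<lambda>u. Abs_l2 (mapply M (coord u)))"

definition mat_of :: "(l2 \<Rightarrow>\<^sub>L l2) \<Rightarrow> mat" where
  "mat_of A = (\<lambda>i j. coord (A (ket j)) i)"

definition imult :: "l2 \<Rightarrow>\<^sub>L l2" where
  "imult = Blinfun (cscale \<i>)"

text \<open>Phrased as a commutation relation, so that the commutation clause for square roots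
  applies directly.\<close>

definition complex_linear :: "(l2 \<Rightarrow>\<^sub>L l2) \<Rightarrow> bool" where
  "complex_linear A \<longleftrightarrow> commuting A imult"

lemma imult_apply: "imult u = cscale \<i> u"
proof -
  have "bounded_linear (cscale \<i>)"
    by (rule bounded_linear_intro[where K = 1]) (auto simp: cscale_add cscale_scaleR)
  then show ?thesis unfolding imult_def by (simp add: bounded_linear_Blinfun_apply)
qed

lemma cscale_decompose: "cscale c u = Re c *\<^sub>R u + Im c *\<^sub>R imult u"
  by (rule l2_eqI) (simp add: imult_apply complex_eq_iff)

lemma complex_linearD: "complex_linear A \<Longrightarrow> blinfun_apply A (cscale c u) = cscale c (A u)"
  by (simp add: cscale_decompose blinfun.bilinear_simps complex_linear_def commuting_def)

lemma complex_linearI: "(\<And>c u. blinfun_apply A (cscale c u) = cscale c (A u)) \<Longrightarrow> complex_linear A"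
  by (simp add: complex_linear_def commuting_def imult_apply)

lemma coord_op_of:
  assumes "bounded_op M"
  shows "coord (op_of M u) = mapply M (coord u)"
proof -
  let ?f = "\<lambda>u. Abs_l2 (mapply M (coord u))"
  have c: "coord (?f u) = mapply M (coord u)" for u
    using assms by (simp add: coord_Abs bounded_op_def)
  have s: "summable (\<lambda>j. M i j * coord u j)" for i u
    using assms by (simp add: bounded_op_def)
  obtain C where C: "\<And>u. ell2 u \<Longrightarrow> vnorm (mapply M u) \<le> C * vnorm u"
    using assms unfolding bounded_op_def by blast
  have "bounded_linear ?f"
  proof (rule bounded_linear_intro[where K = C])
    show "?f (u + v) = ?f u + ?f v" for u v
      by (rule l2_eqI) (simp add: c, simp add: mapply_def distrib_left suminf_add s)
    show "?f (a *\<^sub>R u) = a *\<^sub>R ?f u" for a u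
      by (rule l2_eqI, simp add: c, simp add: mapply_def)
        (subst suminf_mult[OF s, symmetric], simp add: mult_ac)
    show "norm (?f u) \<le> norm u * C" for u
      using C[of "coord u"] by (simp add: norm_l2_vnorm c mult.commute)
  qed
  then show ?thesis unfolding op_of_def by (simp add: bounded_linear_Blinfun_apply c)
qed

lemma complex_linear_op_of:
  assumes "bounded_op M" shows "complex_linear (op_of M)"
proof (rule complex_linearI, rule l2_eqI)
  fix c u i
  have "summable (\<lambda>j. M i j * coord u j)"
    using assms by (simp add: bounded_op_def)
  from suminf_mult[OF this, of c]
  show "coord (op_of M (cscale c u)) i = coord (cscale c (op_of M u)) i"
    by (simp add: coord_op_of[OF assms] mapply_def mult_ac)
qed

lemma mat_of_op_of: "bounded_op M \<Longrightarrow> mat_of (op_of M) = M"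
  by (simp add: mat_of_def coord_op_of mapply_unit_vec)

lemma complex_linear_coord:
  assumes "complex_linear A"
  shows "(\<lambda>j. mat_of A i j * coord u j) sums coord (blinfun_apply A u) i"
proof -
  have "(\<lambda>N. coord (A (ltrunc N (coord u))) i) \<longlonglongrightarrow> coord (A u) i"
    by (intro tendsto_coord blinfun.tendsto tendsto_const ltrunc_LIMSEQ)
  moreover have "coord (A (ltrunc N (coord u))) i = (\<Sum>j<N. mat_of A i j * coord u j)" for N
  proof -
    have "coord (sum f {..<N}) i = (\<Sum>j<N. coord (f j) i)" for f
      by (induction N) simp_all
    then show ?thesis
      by (simp add: ltrunc_sum blinfun.sum_right complex_linearD[OF assms] mat_of_def mult.commute)
  qed
  ultimately show ?thesis by (simp add: sums_def)
qed

lemma mapply_mat_of: "complex_linear A \<Longrightarrow> mapply (mat_of A) (coord u) = coord (blinfun_apply A u)"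
  using complex_linear_coord by (auto simp: mapply_def sums_iff)

lemma bounded_op_mat_of:
  assumes A: "complex_linear A"
  shows "bounded_op (mat_of A)"
  unfolding bounded_op_def
proof (intro conjI allI impI)
  fix u assume "ell2 u"
  then have u: "coord (Abs_l2 u) = u" by (rule coord_Abs)
  show "summable (\<lambda>j. mat_of A i j * u j)" for i
    using complex_linear_coord[OF A, of i "Abs_l2 u"] u by (simp add: sums_iff)
  show "ell2 (mapply (mat_of A) u)"
    using mapply_mat_of[OF A, of "Abs_l2 u"] u ell2_coord[of "A (Abs_l2 u)"] by simp
next
  show "\<exists>C. \<forall>u. ell2 u \<longrightarrow> vnorm (mapply (mat_of A) u) \<le> C * vnorm u"
  proof (intro exI[of _ "norm A"] allI impI)
    fix u assume "ell2 u"
    then have u: "coord (Abs_l2 u) = u" by (rule coord_Abs)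
    show "vnorm (mapply (mat_of A) u) \<le> norm A * vnorm u"
      using norm_blinfun[of A "Abs_l2 u"] mapply_mat_of[OF A, of "Abs_l2 u"]
      by (simp add: norm_l2_vnorm u)
  qed
qed

lemma op_of_mat_of: "complex_linear A \<Longrightarrow> op_of (mat_of A) = A"
  by (intro blinfun_eqI l2_eqI) (simp add: coord_op_of bounded_op_mat_of mapply_mat_of)

lemma op_of_inject: "bounded_op M \<Longrightarrow> bounded_op N \<Longrightarrow> op_of M = op_of N \<Longrightarrow> M = N"
  by (metis mat_of_op_of)

lemma mmult_mat_of:
  assumes "bounded_op M" "bounded_op N"
  shows "mmult M N = mat_of (op_of M o\<^sub>L op_of N)"
  by (simp add: mmult_def mat_of_def coord_op_of[OF assms(1)] coord_op_of[OF assms(2)]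
      mapply_unit_vec mapply_def[of M])

lemma complex_linear_compose: "complex_linear A \<Longrightarrow> complex_linear B \<Longrightarrow> complex_linear (A o\<^sub>L B)"
  by (simp add: complex_linear_def commuting_def)

lemma op_of_mmult:
  assumes "bounded_op M" "bounded_op N"
  shows "op_of (mmult M N) = op_of M o\<^sub>L op_of N"
  using assms by (simp add: mmult_mat_of op_of_mat_of complex_linear_compose complex_linear_op_of)

lemma cinner_ltrunc_op_of:
  assumes "bounded_op M"
  shows "cinner (ltrunc N v) (op_of M (ltrunc N u)) = sform N M v u"
proof -
  have m: "mapply M (trunc N u) i = (\<Sum>l<N. M i l * u l)" for i
  proof -
    have "(\<lambda>j. M i j * trunc N u j) sums (\<Sum>l<N. M i l * trunc N u l)"
      by (rule sums_finite) (auto simp: trunc_def)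
    also have "(\<Sum>l<N. M i l * trunc N u l) = (\<Sum>l<N. M i l * u l)"
      by (intro sum.cong) (auto simp: trunc_def)
    finally show ?thesis by (simp add: mapply_def sums_iff)
  qed
  have "(\<lambda>n. cnj (trunc N v n) * w n) sums (\<Sum>n<N. cnj (trunc N v n) * w n)" for w
    by (rule sums_finite) (auto simp: trunc_def)
  then have "inprod (trunc N v) w = (\<Sum>n<N. cnj (trunc N v n) * w n)" for w
    by (simp add: inprod_def sums_iff)
  also have "(\<Sum>n<N. cnj (trunc N v n) * w n) = (\<Sum>n<N. cnj (v n) * w n)" for w
    by (intro sum.cong) (auto simp: trunc_def)
  finally show ?thesis
    by (simp add: cinner_def coord_op_of[OF assms] m sform_def sum_distrib_left mult.assoc)
qed

lemma sform_LIMSEQ: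
  assumes "bounded_op M"
  shows "(\<lambda>N. sform N M (coord v) (coord u)) \<longlonglongrightarrow> cinner v (op_of M u)"
  unfolding cinner_ltrunc_op_of[OF assms, symmetric]
  by (intro tendsto_cinner blinfun.tendsto tendsto_const ltrunc_LIMSEQ)

lemma sq_nonneg [simp]: "0 \<le> sq N u"
  by (simp add: sq_def sum_nonneg)

lemma norm_ltrunc_sq: "norm (ltrunc N u) = sqrt (sq N u)"
  using norm_ltrunc[of N u] by (simp add: sq_def real_sqrt_unique)

lemma bounded_op_sform_bound:
  assumes "bounded_op M"
  shows "cmod (sform N M v u) \<le> norm (op_of M) * sqrt (sq N v) * sqrt (sq N u)"
proof -
  have "cmod (sform N M v u) \<le> norm (ltrunc N v) * norm (op_of M (ltrunc N u))"
    unfolding cinner_ltrunc_op_of[OF assms, symmetric] by (rule cmod_cinner_le)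
  also have "\<dots> \<le> norm (ltrunc N v) * (norm (op_of M) * norm (ltrunc N u))"
    by (intro mult_left_mono norm_blinfun) auto
  finally show ?thesis by (simp add: norm_ltrunc_sq mult_ac)
qed

text \<open>Testing with \<open>e_i\<close> and the conjugate of row \<open>i\<close> shows that
  rows are square summable, so all products with a vector converge. Testing with a section of the
  image vector then bounds that image.\<close>

lemma bounded_opI:
  assumes bound: "\<And>N u v. cmod (sform N M v u) \<le> C * sqrt (sq N v) * sqrt (sq N u)"
  shows "bounded_op M"
proof -
  have "0 \<le> C"
  proof -
    have "0 \<le> C * sqrt (sq 1 (unit_vec 0)) * sqrt (sq 1 (unit_vec 0))"
      by (rule order_trans[OF norm_ge_zero bound])
    then show ?thesis by (simp add: sq_def unit_vec_def)
  qed
  have sq_le: "s \<le> C\<^sup>2 * t" if "0 \<le> s" "0 \<le> t" "s \<le> C * sqrt s * sqrt t" for s t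
  proof (cases "s = 0")
    case False
    with that have "sqrt s * sqrt s \<le> (C * sqrt t) * sqrt s" by (simp add: mult_ac)
    then have "sqrt s \<le> C * sqrt t"
      by (rule mult_right_le_imp_le) (use False that in auto)
    then have "(sqrt s)\<^sup>2 \<le> (C * sqrt t)\<^sup>2" using that by (intro power_mono) auto
    then show ?thesis using that by (simp add: power_mult_distrib)
  qed (use that in auto)
  have row: "ell2 (M i)" for i
    unfolding ell2_def
  proof (rule summableI_nonneg_bounded[where x = "C\<^sup>2"])
    fix N
    let ?N = "max N (Suc i)" and ?u = "\<lambda>l. cnj (M i l)"
    have "sq N (M i) \<le> sq ?N (M i)" unfolding sq_def by (intro sum_mono2) auto
    also have "sq ?N (M i) \<le> C\<^sup>2 * 1"
    proof (rule sq_le)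
      have "sform ?N M (unit_vec i) ?u = (\<Sum>l<?N. M i l * cnj (M i l))"
      proof -
        have "sform ?N M (unit_vec i) ?u = (\<Sum>k<?N. if k = i then (\<Sum>l<?N. M i l * cnj (M i l)) else 0)"
          unfolding sform_def by (intro sum.cong refl) (auto simp: unit_vec_def)
        then show ?thesis by (simp add: max_def)
      qed
      also have "\<dots> = complex_of_real (sq ?N (M i))"
        by (simp add: sq_def complex_norm_square del: of_real_power)
      finally have 1: "cmod (sform ?N M (unit_vec i) ?u) = sq ?N (M i)" by simp
      have "(\<Sum>k<?N. (cmod (unit_vec i k))\<^sup>2) = (\<Sum>k<?N. if k = i then 1 else 0)"
        by (intro sum.cong) (auto simp: unit_vec_def)
      then have "sq ?N (unit_vec i) = 1" by (simp add: sq_def max_def)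
      moreover have "sq ?N ?u = sq ?N (M i)" by (simp add: sq_def)
      ultimately show "sq ?N (M i) \<le> C * sqrt (sq ?N (M i)) * sqrt 1"
        using bound[of ?N "unit_vec i" ?u] 1 by simp
    qed auto
    finally show "(\<Sum>k<N. (cmod (M i k))\<^sup>2) \<le> C\<^sup>2" by (simp add: sq_def)
  qed auto
  have summ: "summable (\<lambda>j. M i j * u j)" if "ell2 u" for i u
  proof -
    have "ell2 (\<lambda>j. cnj (M i j))" using row by (simp add: ell2_def)
    from inprod_summable[OF this that] show ?thesis by simp
  qed
  have est: "sq K (mapply M u) \<le> C\<^sup>2 * (vnorm u)\<^sup>2" if u: "ell2 u" for K u
  proof (rule LIMSEQ_le_const2)
    let ?y = "\<lambda>N i. \<Sum>l<N. M i l * u l"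
    show "(\<lambda>N. sq K (?y N)) \<longlonglongrightarrow> sq K (mapply M u)"
      unfolding sq_def mapply_def by (intro tendsto_intros summable_LIMSEQ summ u)
    show "\<exists>N0. \<forall>N\<ge>N0. sq K (?y N) \<le> C\<^sup>2 * (vnorm u)\<^sup>2"
    proof (intro exI[of _ K] allI impI)
      fix N assume "K \<le> N"
      \<comment> \<open>Pairing the image with itself gives
        \<open>s \<le> C * sqrt s * sqrt t\<close>, which \<open>sq_le\<close> resolves; cutting at
        \<open>K \<le> N\<close> keeps the left side fixed while \<open>N\<close> grows.\<close>
      let ?v = "\<lambda>i. if i < K then ?y N i else 0"
      have sqv: "sq N ?v = sq K (?y N)"
      proof -
        have "sq N ?v = (\<Sum>i\<in>{..<N}. if i \<in> {..<K} then (cmod (?y N i))\<^sup>2 else 0)"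
          unfolding sq_def by (intro sum.cong) auto
        also have "\<dots> = sum (\<lambda>i. (cmod (?y N i))\<^sup>2) ({..<N} \<inter> {..<K})"
          by (rule sum.inter_restrict[symmetric]) simp
        finally show ?thesis using \<open>K \<le> N\<close> by (simp add: sq_def Int_absorb1 lessThan_subset_iff)
      qed
      have "sform N M ?v u = (\<Sum>i<N. cnj (?v i) * ?y N i)"
        by (simp add: sform_def sum_distrib_left mult.assoc)
      also have "\<dots> = (\<Sum>i<N. complex_of_real ((cmod (?v i))\<^sup>2))"
        by (intro sum.cong refl) (auto simp: complex_norm_square mult.commute simp del: of_real_power)
      also have "\<dots> = complex_of_real (sq N ?v)" by (simp only: sq_def of_real_sum)
      finally have "cmod (sform N M ?v u) = sq N ?v"
        by (simp only: norm_of_real abs_of_nonneg[OF sq_nonneg])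
      then have "sq K (?y N) \<le> C\<^sup>2 * sq N u"
        using bound[of N ?v u] sqv by (intro sq_le) auto
      also have "sq N u \<le> (vnorm u)\<^sup>2"
        using sum_coord_le_norm[of "Abs_l2 u" N] u by (simp add: norm_l2_vnorm coord_Abs sq_def)
      finally show "sq K (?y N) \<le> C\<^sup>2 * (vnorm u)\<^sup>2" by (simp add: mult_left_mono)
    qed
  qed
  have l2: "ell2 (mapply M u)" if "ell2 u" for u
    unfolding ell2_def
    by (rule summableI_nonneg_bounded[where x = "C\<^sup>2 * (vnorm u)\<^sup>2"]) (use est[OF that] in \<open>auto simp: sq_def\<close>)
  have "vnorm (mapply M u) \<le> C * vnorm u" if u: "ell2 u" for u
  proof -
    have "0 \<le> vnorm u" using u norm_l2_vnorm[of "Abs_l2 u"] norm_ge_zero[of "Abs_l2 u"] by (simp add: coord_Abs)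
    moreover have "norm (Abs_l2 (mapply M u)) \<le> C * vnorm u"
      using est[OF u] \<open>0 \<le> C\<close> \<open>0 \<le> vnorm u\<close>
      by (intro norm_l2_le) (auto simp: coord_Abs l2[OF u] sq_def power_mult_distrib)
    ultimately show ?thesis by (simp add: norm_l2_vnorm coord_Abs l2[OF u])
  qed
  with summ l2 show ?thesis
    unfolding bounded_op_def by (intro conjI allI impI exI[of _ C]) simp_all
qed

lemma sform_adj: "sform N (adj M) v u = cnj (sform N M u v)"
  unfolding sform_def adj_def cnj_sum by (subst sum.swap) (simp add: mult_ac)

lemma bounded_op_adj: "bounded_op M \<Longrightarrow> bounded_op (adj M)"
  by (rule bounded_opI[where C = "norm (op_of M)"])
    (use bounded_op_sform_bound[of M] in \<open>simp add: sform_adj mult_ac\<close>)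

lemma cinner_adj:
  assumes "bounded_op M"
  shows "cinner (op_of (adj M) v) u = cinner v (op_of M u)"
proof -
  have "(\<lambda>N. cnj (sform N (adj M) (coord u) (coord v))) \<longlonglongrightarrow> cnj (cinner u (op_of (adj M) v))"
    by (intro tendsto_cnj sform_LIMSEQ bounded_op_adj assms)
  moreover have "(\<lambda>N. sform N M (coord v) (coord u)) \<longlonglongrightarrow> cinner v (op_of M u)"
    by (rule sform_LIMSEQ[OF assms])
  ultimately have "cnj (cinner u (op_of (adj M) v)) = cinner v (op_of M u)"
    by (simp add: sform_adj LIMSEQ_unique)
  then show ?thesis using cinner_commute[of "op_of (adj M) v" u] by simp
qed

section \<open>Entries of positive semidefinite matrices\<close>

lemma sform_two:
  assumes "i \<noteq> j" "i < N" "j < N"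
  shows "sform N M (\<lambda>n. if n = i then x else if n = j then y else 0)
            (\<lambda>n. if n = i then x else if n = j then y else 0)
       = cnj x * M i i * x + cnj x * M i j * y + cnj y * M j i * x + cnj y * M j j * y"
proof -
  let ?u = "\<lambda>n. if n = i then x else if n = j then y else 0"
  have *: "(\<Sum>l<N. f l * ?u l) = f i * x + f j * y" for f :: "nat \<Rightarrow> complex"
  proof -
    have "(\<Sum>l<N. f l * ?u l) = (\<Sum>l\<in>{i,j}. f l * ?u l)"
      by (intro sum.mono_neutral_right) (use assms in auto)
    then show ?thesis using assms by simp
  qed
  have "sform N M ?u ?u = (\<Sum>k<N. (\<Sum>l<N. M k l * ?u l) * cnj (?u k))"
    unfolding sform_def sum_distrib_right by (intro sum.cong refl) (simp add: mult_ac)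
  also have "\<dots> = (\<Sum>k<N. (M k i * x + M k j * y) * cnj (?u k))" by (simp only: *)
  also have "\<dots> = cnj (\<Sum>k<N. cnj (M k i * x + M k j * y) * ?u k)" by simp
  also have "\<dots> = (M i i * x + M i j * y) * cnj x + (M j i * x + M j j * y) * cnj y"
    by (simp only: *) simp
  finally show ?thesis by (simp add: algebra_simps)
qed

lemma sform_one:
  assumes "i < N" shows "sform N M (\<lambda>n. if n = i then x else 0) (\<lambda>n. if n = i then x else 0) = cnj x * M i i * x"
proof -
  have "sform N M (\<lambda>n. if n = i then x else 0) (\<lambda>n. if n = i then x else 0)
      = (\<Sum>k<N. if k = i then cnj x * M i i * x else 0)"
    unfolding sform_def
  proof (intro sum.cong refl)
    fix k
    have "(\<Sum>l<N. cnj (if k = i then x else 0) * M k l * (if l = i then x else 0))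
      = (\<Sum>l<N. if l = i then (if k = i then cnj x * M i i * x else 0) else 0)"
      by (intro sum.cong) auto
    then show "(\<Sum>l<N. cnj (if k = i then x else 0) * M k l * (if l = i then x else 0))
      = (if k = i then cnj x * M i i * x else 0)" using assms by simp
  qed
  then show ?thesis using assms by simp
qed

lemma psdD: "psd M \<Longrightarrow> Im (sform N M u u) = 0" "psd M \<Longrightarrow> 0 \<le> Re (sform N M u u)"
  by (simp_all add: psd_def)

lemma psd_diag: assumes "psd M" shows "Im (M i i) = 0" "0 \<le> Re (M i i)"
  using psdD[OF assms, of "Suc i" "\<lambda>n. if n = i then 1 else 0"] by (simp_all add: sform_one)

text \<open>The form is real at \<open>e_i + e_j\<close> and at \<open>e_i + \<i> e_j\<close>; the
  two conditions fix the imaginary and the real parts.\<close>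

lemma psd_hermitian:
  assumes "psd M" shows "M j i = cnj (M i j)"
proof (cases "i = j")
  case True
  then show ?thesis using psd_diag[OF assms, of i] by (simp add: complex_eq_iff)
next
  case False
  have *: "Im (cnj x * M i i * x + cnj x * M i j * y + cnj y * M j i * x + cnj y * M j j * y) = 0" for x y
    by (subst sform_two[OF False, of "Suc (max i j)" M x y, symmetric]) (auto intro: psdD[OF assms])
  show ?thesis
    using *[of 1 1] *[of 1 \<i>] psd_diag(1)[OF assms] by (simp add: complex_eq_iff)
qed

lemma psd_entry_le:
  assumes "psd M" shows "(cmod (M i j))\<^sup>2 \<le> Re (M i i) * Re (M j j)"
proof (cases "i = j")
  case True
  then show ?thesis using psd_diag[OF assms, of i] by (simp add: cmod_eq_Re power2_eq_square)
next
  case False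
  show ?thesis
  proof (rule nonneg_quadratic_form)
    fix s t :: real
    \<comment> \<open>The phase that turns the mixed terms into \<open>s * t * cmod (M i j)\<close>;
      any unit works when the entry is 0.\<close>
    define c where "c = (if M i j = 0 then 1 else cnj (M i j) / complex_of_real (cmod (M i j)))"
    have c: "c * M i j = complex_of_real (cmod (M i j))" "c * cnj c = 1"
      unfolding c_def using complex_norm_square[of "M i j"]
      by (auto simp: field_simps power2_eq_square)
    let ?x = "complex_of_real s" and ?y = "complex_of_real t * c"
    have p: "0 \<le> Re (cnj ?x * M i i * ?x + cnj ?x * M i j * ?y + cnj ?y * M j i * ?x + cnj ?y * M j j * ?y)"
      by (subst sform_two[OF False, of "Suc (max i j)" M ?x ?y, symmetric]) (auto intro: psdD[OF assms])
    have q1: "cnj ?x * M i j * ?y = complex_of_real (s * t * cmod (M i j))"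
      using c(1) by (simp add: mult_ac)
    have q2: "cnj ?y * M j i * ?x = complex_of_real (s * t * cmod (M i j))"
      using arg_cong[OF c(1), of cnj] psd_hermitian[OF assms, of j i] by (simp add: mult_ac)
    have q3: "cnj ?y * M j j * ?y = complex_of_real (t\<^sup>2) * M j j"
    proof -
      have "cnj ?y * M j j * ?y = (c * cnj c) * (complex_of_real (t * t) * M j j)" by (simp add: mult_ac)
      then show ?thesis by (simp only: c(2)) (simp add: power2_eq_square)
    qed
    have q4: "cnj ?x * M i i * ?x = complex_of_real (s\<^sup>2) * M i i"
      by (simp add: power2_eq_square)
    show "0 \<le> s\<^sup>2 * Re (M i i) + 2 * s * t * cmod (M i j) + t\<^sup>2 * Re (M j j)"
      using p unfolding q1 q2 q3 q4 by (simp del: of_real_mult of_real_power)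
  qed
qed

lemma positive_op_iff_psd: "positive_op M \<longleftrightarrow> bounded_op M \<and> psd M"
proof (intro iffI conjI)
  assume M: "positive_op M"
  then show b: "bounded_op M" by (simp add: positive_op_def)
  show "psd M" unfolding psd_def
  proof (intro allI)
    fix N u
    have "sform N M u u = inprod (trunc N u) (mapply M (trunc N u))"
      unfolding cinner_ltrunc_op_of[OF b, symmetric] by (simp add: cinner_def coord_op_of[OF b])
    then show "Im (sform N M u u) = 0 \<and> 0 \<le> Re (sform N M u u)"
      using M by (simp add: positive_op_def)
  qed
next
  assume *: "bounded_op M \<and> psd M"
  show "positive_op M" unfolding positive_op_def
  proof (intro conjI allI impI)
    fix u assume "ell2 u"
    then have u: "coord (Abs_l2 u) = u" by (rule coord_Abs)
    have lim: "(\<lambda>N. sform N M u u) \<longlonglongrightarrow> inprod u (mapply M u)"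
      using sform_LIMSEQ[of M "Abs_l2 u" "Abs_l2 u"] * by (simp add: cinner_def coord_op_of u)
    show "Im (inprod u (mapply M u)) = 0"
      using tendsto_Im[OF lim] * by (simp add: psd_def LIMSEQ_const_iff)
    show "0 \<le> Re (inprod u (mapply M u))"
      using * by (intro LIMSEQ_le_const[OF tendsto_Re[OF lim]]) (auto simp: psd_def)
  qed (use * in simp)
qed

lemma positive_op_adj: "positive_op M \<Longrightarrow> adj M = M"
  using psd_hermitian unfolding positive_op_iff_psd adj_def by fastforce

lemma pos_op_op_of:
  assumes "positive_op M" shows "pos_op (op_of M)"
  unfolding pos_op_def symmetric_op_def
proof (intro conjI allI)
  have b: "bounded_op M" using assms by (simp add: positive_op_def)
  show "inner (op_of M x) y = inner x (op_of M y)" for x y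
    using cinner_adj[OF b, of x y] positive_op_adj[OF assms] by (simp add: inner_l2_def)
  show "0 \<le> inner x (op_of M x)" for x
    using assms by (simp add: inner_l2_def cinner_def coord_op_of[OF b] positive_op_def)
qed

text \<open>Real symmetry gives the real parts; applied to \<open>-\<i> y\<close> in place of
  \<open>y\<close> it gives the imaginary parts.\<close>

lemma symmetric_op_cinner:
  assumes "symmetric_op A" "complex_linear A"
  shows "cinner (blinfun_apply A x) y = cinner x (A y)"
proof (rule complex_eqI)
  show "Re (cinner (A x) y) = Re (cinner x (A y))"
    using symmetric_opD[OF assms(1), of x y] by (simp add: inner_l2_def)
  have "Re (cinner (A x) (cscale (-\<i>) y)) = Re (cinner x (cscale (-\<i>) (A y)))"
    using symmetric_opD[OF assms(1), of x "cscale (-\<i>) y"]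
    by (simp add: inner_l2_def complex_linearD[OF assms(2)])
  then show "Im (cinner (A x) y) = Im (cinner x (A y))"
    by (simp add: cinner_scale_right)
qed

lemma positive_op_mat_of:
  assumes "pos_op A" "complex_linear A" shows "positive_op (mat_of A)"
  unfolding positive_op_def
proof (intro conjI allI impI)
  show "bounded_op (mat_of A)" using assms(2) by (rule bounded_op_mat_of)
  fix u assume "ell2 u"
  then have u: "coord (Abs_l2 u) = u" by (rule coord_Abs)
  have eq: "inprod u (mapply (mat_of A) u) = cinner (Abs_l2 u) (A (Abs_l2 u))"
    using mapply_mat_of[OF assms(2), of "Abs_l2 u"] by (simp add: cinner_def u)
  show "0 \<le> Re (inprod u (mapply (mat_of A) u))"
    using pos_opD(1)[OF assms(1), of "Abs_l2 u"] by (simp add: eq inner_l2_def)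
  have "cinner (Abs_l2 u) (A (Abs_l2 u)) = cnj (cinner (Abs_l2 u) (A (Abs_l2 u)))"
    using symmetric_op_cinner[OF pos_opD(2)[OF assms(1)] assms(2), of "Abs_l2 u" "Abs_l2 u"]
      cinner_commute[of "Abs_l2 u" "A (Abs_l2 u)"] by simp
  from arg_cong[OF this, of Im] show "Im (inprod u (mapply (mat_of A) u)) = 0"
    unfolding eq by simp
qed

lemma opabs_eqI:
  assumes "positive_op B" "mmult B B = mmult (adj M) M"
  shows "opabs M = B"
  unfolding opabs_def
proof (rule the_equality)
  fix B' assume B': "positive_op B' \<and> mmult B' B' = mmult (adj M) M"
  have b: "bounded_op B" "bounded_op B'" using assms(1) B' by (auto simp: positive_op_def)
  have eq: "op_of B' o\<^sub>L op_of B' = op_of B o\<^sub>L op_of B"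
    using B' assms(2) b by (simp flip: op_of_mmult)
  have "op_of B' = op_of B"
    by (rule sqrt_unique[OF pos_op_op_of pos_op_op_of eq]) (use B' assms(1) in auto)
  then show "B' = B" using b by (intro op_of_inject) auto
qed (use assms in auto)

lemma opabs_positive: "positive_op M \<Longrightarrow> opabs M = M"
  by (rule opabs_eqI) (simp_all add: positive_op_adj)

text \<open>The product of the adjoint with \<open>M\<close> commutes with \<open>imult\<close>,
  hence so does its root, which therefore is given by a matrix and qualifies for the
  \<open>THE\<close> in \<open>opabs\<close>.\<close>

lemma opabs_props:
  assumes M: "bounded_op M"
  shows "positive_op (opabs M)" "mmult (opabs M) (opabs M) = mmult (adj M) M"
proof -
  let ?X = "op_of (adj M) o\<^sub>L op_of M"
  have M': "bounded_op (adj M)" by (rule bounded_op_adj[OF M])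
  have adjr: "cinner (op_of M x) y = cinner x (op_of (adj M) y)" for x y
    using cinner_adj[OF M, of y x] cinner_commute by metis
  have "inner (?X x) y = inner x (?X y)" for x y
    by (simp add: inner_l2_def cinner_adj[OF M] flip: adjr)
  moreover have "0 \<le> inner x (?X x)" for x
    using inner_ge_zero[of "op_of M x"] by (simp add: inner_l2_def adjr)
  ultimately have "pos_op ?X" by (simp add: pos_op_def symmetric_op_def)
  then obtain S where S: "pos_op S" "S o\<^sub>L S = ?X" "\<And>C. commuting C ?X \<Longrightarrow> commuting C S"
    using sqrt_exists by blast
  have "complex_linear ?X" using M M' by (intro complex_linear_compose complex_linear_op_of)
  then have cS: "complex_linear S"
    using S(3)[of imult] unfolding complex_linear_def by (simp add: commuting_sym)
  have pS: "positive_op (mat_of S)" using S(1) cS by (rule positive_op_mat_of)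
  have "mmult (mat_of S) (mat_of S) = mmult (adj M) M"
    using M M' cS by (simp add: mmult_mat_of bounded_op_mat_of op_of_mat_of S(2))
  with opabs_eqI[OF pS this] pS show "positive_op (opabs M)"
    "mmult (opabs M) (opabs M) = mmult (adj M) M" by simp_all
qed

lemma trace_class_positive: "positive_op M \<Longrightarrow> trace_class M \<longleftrightarrow> summable (\<lambda>n. Re (M n n))"
  by (simp add: trace_class_def opabs_positive positive_op_def)

section \<open>Traces and positive functionals\<close>

text \<open>Unordered summability over pairs makes the exchange of the two sums a mere
  reindexing.\<close>

definition double_abs_summable :: "(nat \<Rightarrow> nat \<Rightarrow> 'a::real_normed_vector) \<Rightarrow> bool" where
  "double_abs_summable a \<longleftrightarrow> (\<lambda>p. norm (a (fst p) (snd p))) summable_on UNIV \<times> UNIV"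

lemma double_abs_summable_iff:
  fixes a :: "nat \<Rightarrow> nat \<Rightarrow> 'a::banach"
  shows "double_abs_summable a \<longleftrightarrow>
     (\<forall>i. summable (\<lambda>m. norm (a i m))) \<and> summable (\<lambda>i. \<Sum>m. norm (a i m))"
proof -
  have eq: "infsum (\<lambda>m. norm (a i m)) UNIV = (\<Sum>m. norm (a i m))"
    if "summable (\<lambda>m. norm (a i m))" for i
  proof -
    have "(\<lambda>m. norm (a i m)) summable_on UNIV"
      using that by (simp add: summable_on_UNIV_nonneg_real_iff)
    from has_sum_infsum[OF this, THEN has_sum_imp_sums] show ?thesis by (simp add: sums_iff)
  qed
  have "double_abs_summable a \<longleftrightarrow> (\<forall>i. (\<lambda>m. norm (a i m)) summable_on UNIV)
      \<and> (\<lambda>i. norm (infsum (\<lambda>m. norm (a i m)) UNIV)) summable_on UNIV"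
    unfolding double_abs_summable_def
    using Infinite_Sum.abs_summable_on_Sigma_iff[of "\<lambda>p. a (fst p) (snd p)" UNIV "\<lambda>_. UNIV"] by simp
  also have "\<dots> \<longleftrightarrow> (\<forall>i. summable (\<lambda>m. norm (a i m)))
      \<and> summable (\<lambda>i. norm (infsum (\<lambda>m. norm (a i m)) UNIV))"
    by (simp add: summable_on_UNIV_nonneg_real_iff)
  also have "\<dots> \<longleftrightarrow> (\<forall>i. summable (\<lambda>m. norm (a i m))) \<and> summable (\<lambda>i. \<Sum>m. norm (a i m))"
    by (auto simp: eq suminf_nonneg)
  finally show ?thesis .
qed

lemma double_abs_summable_swap:
  "double_abs_summable (\<lambda>m i. a i m) \<longleftrightarrow> double_abs_summable a"
proof -
  have "bij_betw prod.swap (UNIV \<times> UNIV) (UNIV \<times> UNIV :: (nat \<times> nat) set)"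
    by (simp add: bij_betw_def)
  from summable_on_reindex_bij_betw[OF this, of "\<lambda>p. norm (a (fst p) (snd p))"]
  show ?thesis by (simp add: double_abs_summable_def)
qed

lemma double_series_swap:
  fixes a :: "nat \<Rightarrow> nat \<Rightarrow> 'a::banach"
  assumes "double_abs_summable a"
  shows "(\<lambda>m. \<Sum>i. a i m) sums (\<Sum>i. \<Sum>m. a i m)" "summable (\<lambda>i. \<Sum>m. a i m)"
proof -
  have *: "(\<lambda>i. \<Sum>m. b i m) sums infsum (\<lambda>p. b (fst p) (snd p)) (UNIV \<times> UNIV)"
    if b: "double_abs_summable b" for b :: "nat \<Rightarrow> nat \<Rightarrow> 'a"
  proof -
    have "(\<lambda>m. norm (b i m)) summable_on UNIV" for i
      using b by (simp add: double_abs_summable_iff summable_on_UNIV_nonneg_real_iff)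
    then have r: "(b i has_sum infsum (b i) UNIV) UNIV" for i
      by (rule has_sum_infsum[OF abs_summable_summable])
    have "(\<lambda>p. b (fst p) (snd p)) summable_on UNIV \<times> UNIV"
      using b unfolding double_abs_summable_def by (rule abs_summable_summable)
    from has_sum_SigmaD[OF has_sum_infsum[OF this], of "\<lambda>i. infsum (b i) UNIV"] r
    have "((\<lambda>i. infsum (b i) UNIV) has_sum infsum (\<lambda>p. b (fst p) (snd p)) (UNIV \<times> UNIV)) UNIV"
      by simp
    from has_sum_imp_sums[OF this] show ?thesis
      using has_sum_imp_sums[OF r] by (simp add: sums_iff)
  qed
  have "bij_betw prod.swap (UNIV \<times> UNIV) (UNIV \<times> UNIV :: (nat \<times> nat) set)"
    by (simp add: bij_betw_def)
  from infsum_reindex_bij_betw[OF this, of "\<lambda>p. a (fst p) (snd p)"]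
  show "(\<lambda>m. \<Sum>i. a i m) sums (\<Sum>i. \<Sum>m. a i m)"
    using *[OF double_abs_summable_swap[THEN iffD2, OF assms]] *[OF assms] by (simp add: sums_iff)
  show "summable (\<lambda>i. \<Sum>m. a i m)"
    using *[OF assms] by (simp add: sums_iff)
qed

lemma positive_op_root:
  assumes "positive_op M"
  shows "\<exists>R. pos_op R \<and> complex_linear R \<and> R o\<^sub>L R = op_of M \<and> (\<forall>n. (norm (R (ket n)))\<^sup>2 = Re (M n n))"
proof -
  have b: "bounded_op M" using assms by (simp add: positive_op_def)
  obtain R where R: "pos_op R" "R o\<^sub>L R = op_of M" "\<And>C. commuting C (op_of M) \<Longrightarrow> commuting C R"
    using sqrt_exists[OF pos_op_op_of[OF assms]] by blast
  have "complex_linear R"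
    using R(3)[of imult] complex_linear_op_of[OF b] by (simp add: complex_linear_def commuting_sym)
  moreover have "(norm (R (ket n)))\<^sup>2 = Re (M n n)" for n
  proof -
    have "(norm (R (ket n)))\<^sup>2 = inner (ket n) ((R o\<^sub>L R) (ket n))"
      using symmetric_opD[OF pos_opD(2)[OF R(1)]] by (simp add: power2_norm_eq_inner)
    then show ?thesis
      by (simp add: R(2) inner_l2_def cinner_ket coord_op_of[OF b] mapply_unit_vec)
  qed
  ultimately show ?thesis using R by blast
qed

text \<open>This representation turns \<open>y \<mapsto> tr (\<eta> y)\<close> into a manifestly positive functional.\<close>
lemma tr_mmult_root:
  assumes \<eta>: "positive_op \<eta>" and sm: "summable (\<lambda>n. Re (\<eta> n n))" and y: "bounded_op y"
    and R: "pos_op R" "complex_linear R" "R o\<^sub>L R = op_of \<eta>" "\<And>n. (norm (R (ket n)))\<^sup>2 = Re (\<eta> n n)"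
  shows "(\<lambda>m. cinner (R (ket m)) (op_of y (R (ket m)))) sums tr (mmult \<eta> y)"
    and "summable (\<lambda>i. mmult \<eta> y i i)"
proof -
  have b\<eta>: "bounded_op \<eta>" using \<eta> by (simp add: positive_op_def)
  have Rs: "cinner (R u) v = cinner u (R v)" for u v
    using symmetric_op_cinner pos_opD(2) R by blast
  let ?Y = "op_of y" and ?Y' = "op_of (adj y)"
  define p where "p i m = coord (R (ket i)) m" for i m
  define q where "q i m = coord (R (?Y (ket i))) m" for i m
  have p': "p i m = cnj (coord (R (ket m)) i)" for i m
    using Rs[of "ket m" "ket i"] cinner_commute[of "R (ket m)" "ket i"] by (simp add: p_def cinner_ket)
  have q': "q i m = cnj (coord (?Y' (R (ket m))) i)" for i m
  proof -
    have "q i m = cinner (?Y' (R (ket m))) (ket i)"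
      by (simp add: q_def cinner_adj[OF y] Rs flip: cinner_ket)
    then show ?thesis using cinner_commute[of "?Y' (R (ket m))" "ket i"] by (simp add: cinner_ket)
  qed
  have sp: "double_abs_summable (\<lambda>i m. (cmod (p i m))\<^sup>2)"
  unfolding double_abs_summable_iff
  proof (intro conjI allI)
    show "summable (\<lambda>m. norm ((cmod (p i m))\<^sup>2))" for i
      using norm_l2_sums[of "R (ket i)"] by (simp add: p_def sums_iff)
    have "(\<Sum>m. norm ((cmod (p i m))\<^sup>2)) = Re (\<eta> i i)" for i
      using norm_l2_sums[of "R (ket i)"] by (simp add: p_def sums_iff R(4))
    then show "summable (\<lambda>i. \<Sum>m. norm ((cmod (p i m))\<^sup>2))" using sm by simp
  qed
  \<comment> \<open>This family is summed over \<open>i\<close> first: for fixed \<open>m\<close> it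
    lists the coordinates of the adjoint of \<open>y\<close> applied to \<open>R (ket m)\<close>, so
    a bounded factor leaves the Hilbert-Schmidt sum finite.\<close>
  have "double_abs_summable (\<lambda>m i. (cmod (q i m))\<^sup>2)"
  unfolding double_abs_summable_iff
  proof (intro conjI allI)
    show "summable (\<lambda>i. norm ((cmod (q i m))\<^sup>2))" for m
      using norm_l2_sums[of "?Y' (R (ket m))"] by (simp add: q' sums_iff)
    show "summable (\<lambda>m. \<Sum>i. norm ((cmod (q i m))\<^sup>2))"
    proof (rule summable_comparison_test'[where N = 0])
      show "summable (\<lambda>m. (norm ?Y')\<^sup>2 * Re (\<eta> m m))" by (intro summable_mult sm)
      fix m
      have "norm (\<Sum>i. norm ((cmod (q i m))\<^sup>2)) = (norm (?Y' (R (ket m))))\<^sup>2"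
        using norm_l2_sums[of "?Y' (R (ket m))"] by (simp add: q' sums_iff)
      also have "\<dots> \<le> (norm ?Y' * norm (R (ket m)))\<^sup>2"
        by (intro power_mono norm_blinfun) auto
      finally show "norm (\<Sum>i. norm ((cmod (q i m))\<^sup>2)) \<le> (norm ?Y')\<^sup>2 * Re (\<eta> m m)"
        by (simp only: power_mult_distrib R(4))
    qed
  qed
  then have sq: "double_abs_summable (\<lambda>i m. (cmod (q i m))\<^sup>2)"
    by (rule double_abs_summable_swap[THEN iffD1])
  have "double_abs_summable (\<lambda>i m. cnj (p i m) * q i m)"
    unfolding double_abs_summable_def
  proof (rule Infinite_Sum.abs_summable_on_comparison_test)
    show "(\<lambda>x. norm ((cmod (p (fst x) (snd x)))\<^sup>2 + (cmod (q (fst x) (snd x)))\<^sup>2)) summable_on UNIV \<times> UNIV"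
      using summable_on_add[OF sp[unfolded double_abs_summable_def] sq[unfolded double_abs_summable_def]] by simp
    fix x :: "nat \<times> nat"
    have "2 * (cmod (p i m) * cmod (q i m)) \<le> (cmod (p i m))\<^sup>2 + (cmod (q i m))\<^sup>2" for i m
      using sum_squares_bound[of "cmod (p i m)" "cmod (q i m)"] by simp
    moreover have "0 \<le> cmod (p i m) * cmod (q i m)" for i m by simp
    ultimately have "cmod (p i m) * cmod (q i m) \<le> (cmod (p i m))\<^sup>2 + (cmod (q i m))\<^sup>2" for i m
      by (smt (verit))
    then show "norm (cnj (p (fst x) (snd x)) * q (fst x) (snd x))
        \<le> norm ((cmod (p (fst x) (snd x)))\<^sup>2 + (cmod (q (fst x) (snd x)))\<^sup>2)"
      by (simp add: norm_mult)
  qed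
  note sw = double_series_swap[OF this]
  have row: "(\<Sum>m. cnj (p i m) * q i m) = mmult \<eta> y i i" for i
  proof -
    have "mmult \<eta> y i i = cinner (ket i) (op_of \<eta> (?Y (ket i)))"
      by (simp add: mmult_mat_of[OF b\<eta> y] mat_of_def cinner_ket)
    also have "\<dots> = cinner (R (ket i)) (R (?Y (ket i)))"
      by (simp add: Rs flip: R(3))
    finally show ?thesis by (simp add: cinner_def inprod_def p_def q_def)
  qed
  have col: "(\<Sum>i. cnj (p i m) * q i m) = cinner (R (ket m)) (?Y (R (ket m)))" for m
  proof -
    have "cinner (R (ket m)) (?Y (R (ket m))) = cinner (?Y' (R (ket m))) (R (ket m))"
      by (simp add: cinner_adj[OF y])
    then show ?thesis by (simp add: cinner_def inprod_def p' q' mult.commute)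
  qed
  show "(\<lambda>m. cinner (R (ket m)) (?Y (R (ket m)))) sums tr (mmult \<eta> y)"
    using sw(1) by (simp add: row col tr_def)
  show "summable (\<lambda>i. mmult \<eta> y i i)" using sw(2) by (simp add: row)
qed

section \<open>Positive functionals on bounded operators\<close>

lemma sform_lincomb:
  "sform N (\<lambda>i j. a * x i j + b * y i j) v u = a * sform N x v u + b * sform N y v u"
  by (simp add: sform_def sum_distrib_left sum.distrib algebra_simps)

lemma sform_diff: "sform N (x - y) v u = sform N x v u - sform N y v u"
  using sform_lincomb[of N 1 x "-1" y v u] by (simp add: fun_diff_def)

lemma bounded_op_lincomb:
  assumes "bounded_op x" "bounded_op y"
  shows "bounded_op (\<lambda>i j. a * x i j + b * y i j)"
proof (rule bounded_opI)
  fix N u v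
  let ?s = "sqrt (sq N v) * sqrt (sq N u)"
  have "cmod (a * sform N x v u + b * sform N y v u) \<le> cmod (a * sform N x v u) + cmod (b * sform N y v u)"
    by (rule norm_triangle_ineq)
  also have "\<dots> \<le> cmod a * (norm (op_of x) * ?s) + cmod b * (norm (op_of y) * ?s)"
    unfolding norm_mult
    using bounded_op_sform_bound[OF assms(1), of N v u] bounded_op_sform_bound[OF assms(2), of N v u]
    by (intro add_mono mult_left_mono) (simp_all add: mult_ac)
  finally show "cmod (sform N (\<lambda>i j. a * x i j + b * y i j) v u)
      \<le> (cmod a * norm (op_of x) + cmod b * norm (op_of y)) * sqrt (sq N v) * sqrt (sq N u)"
    by (simp add: sform_lincomb algebra_simps)
qed

lemma bounded_op_diff: "bounded_op x \<Longrightarrow> bounded_op y \<Longrightarrow> bounded_op (x - y)"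
  using bounded_op_lincomb[of x y 1 "-1"] by (simp add: fun_diff_def)

lemma bounded_op_smult: "bounded_op x \<Longrightarrow> bounded_op (\<lambda>i j. a * x i j)"
  using bounded_op_lincomb[of x x a 0] by simp

lemma coord_op_of_entry: "bounded_op M \<Longrightarrow> coord (op_of M (ket j)) i = M i j"
  by (simp add: coord_op_of mapply_unit_vec)

lemma op_of_lincomb:
  assumes "bounded_op x" "bounded_op y"
  shows "op_of (\<lambda>i j. a * x i j + b * y i j) u = cscale a (op_of x u) + cscale b (op_of y u)"
proof (rule l2_eqI)
  fix n
  have s: "summable (\<lambda>j. x n j * coord u j)" "summable (\<lambda>j. y n j * coord u j)"
    using assms by (simp_all add: bounded_op_def)
  show "coord (op_of (\<lambda>i j. a * x i j + b * y i j) u) n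
      = coord (cscale a (op_of x u) + cscale b (op_of y u)) n"
    using suminf_add[OF summable_mult[OF s(1), of a] summable_mult[OF s(2), of b]]
      suminf_mult[OF s(1), of a] suminf_mult[OF s(2), of b]
    by (simp add: coord_op_of bounded_op_lincomb assms mapply_def algebra_simps)
qed

text \<open>A common frame for the trace against a state, its composition with \<open>T t\<close>,
  and the forms \<open>sform N (\<Phi> y) u u\<close> of a positive map.\<close>

definition pos_functional :: "(mat \<Rightarrow> complex) \<Rightarrow> bool" where
  "pos_functional f \<longleftrightarrow>
     (\<forall>x y a b. bounded_op x \<longrightarrow> bounded_op y \<longrightarrow>
        f (\<lambda>i j. a * x i j + b * y i j) = a * f x + b * f y) \<and>
     (\<forall>x. positive_op x \<longrightarrow> Im (f x) = 0 \<and> 0 \<le> Re (f x))"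

lemma pos_functionalD:
  assumes "pos_functional f"
  shows "bounded_op x \<Longrightarrow> bounded_op y \<Longrightarrow> f (\<lambda>i j. a * x i j + b * y i j) = a * f x + b * f y"
    and "positive_op x \<Longrightarrow> Im (f x) = 0" and "positive_op x \<Longrightarrow> 0 \<le> Re (f x)"
  using assms by (simp_all add: pos_functional_def)

lemma pos_functional_smult:
  "pos_functional f \<Longrightarrow> bounded_op x \<Longrightarrow> f (\<lambda>i j. a * x i j) = a * f x"
  using pos_functionalD(1)[of f x x a 0] by simp

lemma pos_functional_diff:
  "pos_functional f \<Longrightarrow> bounded_op x \<Longrightarrow> bounded_op y \<Longrightarrow> f (x - y) = f x - f y"
  using pos_functionalD(1)[of f x y 1 "-1"] by (simp add: fun_diff_def)

lemma pos_functional_tr: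
  assumes \<eta>: "positive_op \<eta>" and sm: "summable (\<lambda>n. Re (\<eta> n n))"
  shows "pos_functional (\<lambda>y. tr (mmult \<eta> y))"
proof -
  obtain R where R: "pos_op R" "complex_linear R" "R o\<^sub>L R = op_of \<eta>" "\<And>n. (norm (R (ket n)))\<^sup>2 = Re (\<eta> n n)"
    using positive_op_root[OF \<eta>] by blast
  note sums = tr_mmult_root(1)[OF \<eta> sm _ R]
  show ?thesis
    unfolding pos_functional_def
  proof (intro conjI allI impI)
    fix x y a b assume x: "bounded_op x" and y: "bounded_op y"
    have "(\<lambda>m. a * cinner (R (ket m)) (op_of x (R (ket m))) + b * cinner (R (ket m)) (op_of y (R (ket m))))
       sums (a * tr (mmult \<eta> x) + b * tr (mmult \<eta> y))"
      by (intro sums_add sums_mult sums x y)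
    with sums[OF bounded_op_lincomb[OF x y, of a b]]
    show "tr (mmult \<eta> (\<lambda>i j. a * x i j + b * y i j)) = a * tr (mmult \<eta> x) + b * tr (mmult \<eta> y)"
      by (simp add: op_of_lincomb[OF x y] cinner_add_right cinner_scale_right sums_unique2)
  next
    fix x assume x: "positive_op x"
    then have b: "bounded_op x" by (simp add: positive_op_def)
    have *: "Im (cinner u (op_of x u)) = 0" "0 \<le> Re (cinner u (op_of x u))" for u
      using x by (simp_all add: cinner_def coord_op_of[OF b] positive_op_def)
    show "Im (tr (mmult \<eta> x)) = 0" using sums_Im[OF sums[OF b]] by (simp add: * sums_iff)
    show "0 \<le> Re (tr (mmult \<eta> x))"
      by (rule sums_le[OF _ sums_zero sums_Re[OF sums[OF b]]]) (simp add: *)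
  qed
qed

text \<open>If a hermitian \<open>h\<close> satisfies \<open>-z \<le> h \<le> z\<close>, then
  \<open>|f h| \<le> f z\<close>. The factor 2 comes from the two hermitian parts of
  \<open>y\<close>, obtained with \<open>c = 1/2\<close> and \<open>c = -\<i>/2\<close>.\<close>

lemma pos_functional_bound:
  assumes f: "pos_functional f" and y: "bounded_op y" and z: "bounded_op z"
    and le: "\<And>N u. cmod (sform N y u u) \<le> Re (sform N z u u)"
    and im: "\<And>N u. Im (sform N z u u) = 0"
  shows "cmod (f y) \<le> 2 * Re (f z)"
proof -
  have y': "bounded_op (adj y)" by (rule bounded_op_adj[OF y])
  have key: "cmod (f h) \<le> Re (f z)" if h: "h = (\<lambda>i j. c * y i j + cnj c * adj y i j)" "cmod c = 1/2" for c h
  proof -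
    have bh: "bounded_op h" unfolding h(1) by (intro bounded_op_lincomb y y')
    have sh: "sform N h u u = complex_of_real (2 * Re (c * sform N y u u))" for N u
      unfolding h(1) sform_lincomb sform_adj using complex_add_cnj[of "c * sform N y u u"] by simp
    have ab: "\<bar>2 * Re (c * sform N y u u)\<bar> \<le> Re (sform N z u u)" for N u
    proof -
      have "\<bar>2 * Re (c * sform N y u u)\<bar> \<le> 2 * cmod (c * sform N y u u)"
        using abs_Re_le_cmod[of "c * sform N y u u"] by linarith
      also have "\<dots> = cmod (sform N y u u)" by (simp add: norm_mult h(2))
      finally show ?thesis using le[of N u] by linarith
    qed
    have pos: "positive_op (\<lambda>i j. 1 * z i j + e * h i j)" if "e = 1 \<or> e = -1" for e
      unfolding positive_op_iff_psd psd_def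
    proof (intro conjI allI bounded_op_lincomb z bh)
      fix N u
      show "Im (sform N (\<lambda>i j. 1 * z i j + e * h i j) u u) = 0"
        using that im[of N u] unfolding sform_lincomb sh by auto
      show "0 \<le> Re (sform N (\<lambda>i j. 1 * z i j + e * h i j) u u)"
        using that ab[of N u] unfolding sform_lincomb sh by auto
    qed
    have *: "Im (f z + e * f h) = 0 \<and> 0 \<le> Re (f z + e * f h)" if "e = 1 \<or> e = -1" for e
      using pos_functionalD(1)[OF f z bh, of 1 e] pos_functionalD(2,3)[OF f pos[OF that]] by simp
    from *[of 1] *[of "-1"] show ?thesis by (simp add: cmod_eq_Re abs_le_iff)
  qed
  let ?h1 = "\<lambda>i j. (1/2) * y i j + cnj (1/2) * adj y i j"
  let ?h2 = "\<lambda>i j. (- \<i>/2) * y i j + cnj (- \<i>/2) * adj y i j"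
  have b: "bounded_op ?h1" "bounded_op ?h2" by (intro bounded_op_lincomb y y')+
  have "y = (\<lambda>i j. 1 * ?h1 i j + \<i> * ?h2 i j)"
    by (auto simp: fun_eq_iff algebra_simps)
  then have "f y = 1 * f ?h1 + \<i> * f ?h2" using pos_functionalD(1)[OF f b, of 1 \<i>] by simp
  then have "cmod (f y) \<le> cmod (f ?h1) + cmod (f ?h2)"
    using norm_triangle_ineq[of "f ?h1" "\<i> * f ?h2"] by (simp add: norm_mult)
  moreover have "cmod (f ?h1) \<le> Re (f z)" by (rule key[of _ "1/2"]) auto
  moreover have "cmod (f ?h2) \<le> Re (f z)" by (rule key[of _ "-\<i>/2"]) (auto simp: norm_divide)
  ultimately show ?thesis by linarith
qed

section \<open>Diagonal matrices, matrix units and corners\<close>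

definition diag :: "(nat \<Rightarrow> real) \<Rightarrow> mat" where
  "diag d = (\<lambda>i j. if i = j then complex_of_real (d i) else 0)"

abbreviation idm :: mat where "idm \<equiv> diag (\<lambda>_. 1)"

definition proj :: "nat \<Rightarrow> mat" where "proj M = diag (\<lambda>i. if i < M then 1 else 0)"

definition munit :: "nat \<Rightarrow> nat \<Rightarrow> mat" where
  "munit i j = (\<lambda>k l. if k = i \<and> l = j then 1 else 0)"

definition compress :: "nat \<Rightarrow> mat \<Rightarrow> mat" where
  "compress M x = (\<lambda>i j. if i < M \<and> j < M then x i j else 0)"

lemma sform_diag: "sform N (diag d) v u = (\<Sum>k<N. d k * cnj (v k) * u k)"
proof -
  have "(\<Sum>l<N. cnj (v k) * diag d k l * u l) = (\<Sum>l<N. if k = l then d k * cnj (v k) * u k else 0)" for k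
    by (intro sum.cong) (auto simp: diag_def)
  then show ?thesis by (auto simp: sform_def intro!: sum.cong)
qed

lemma sform_diag_self: "sform N (diag d) u u = complex_of_real (\<Sum>k<N. d k * (cmod (u k))\<^sup>2)"
  unfolding sform_diag of_real_sum
  by (intro sum.cong refl) (simp add: complex_norm_square mult_ac del: of_real_power)

lemma sform_idm: "sform N idm u u = complex_of_real (sq N u)"
  by (simp add: sform_diag_self sq_def)

lemma bounded_op_diag:
  assumes "\<And>k. \<bar>d k\<bar> \<le> C" shows "bounded_op (diag d)"
proof (rule bounded_opI)
  fix N v u
  have "cmod (sform N (diag d) v u) \<le> (\<Sum>k<N. C * (cmod (v k) * cmod (u k)))"
    unfolding sform_diag
    by (rule sum_norm_le) (simp add: norm_mult mult_right_mono assms mult.assoc)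
  also have "\<dots> = C * (\<Sum>k<N. cmod (v k) * cmod (u k))" by (simp add: sum_distrib_left)
  also have "\<dots> \<le> C * (sqrt (sq N v) * sqrt (sq N u))"
  proof (rule mult_left_mono)
    show "(\<Sum>k<N. cmod (v k) * cmod (u k)) \<le> sqrt (sq N v) * sqrt (sq N u)"
      using L2_set_mult_ineq[of "\<lambda>k. cmod (v k)" "\<lambda>k. cmod (u k)" "{..<N}"]
      by (simp add: L2_set_def sq_def)
    show "0 \<le> C" using assms[of 0] by linarith
  qed
  finally show "cmod (sform N (diag d) v u) \<le> C * sqrt (sq N v) * sqrt (sq N u)" by simp
qed

lemma positive_op_diag:
  assumes "\<And>k. 0 \<le> d k" "\<And>k. d k \<le> C" shows "positive_op (diag d)"
  unfolding positive_op_iff_psd psd_def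
  using assms by (auto simp: sform_diag_self intro!: sum_nonneg bounded_op_diag[where C = C])

lemma bounded_op_idm [simp]: "bounded_op idm" by (rule bounded_op_diag[where C = 1]) simp

lemma positive_op_proj: "positive_op (proj M)"
  unfolding proj_def by (rule positive_op_diag[where C = 1]) auto

lemma bounded_op_proj [simp]: "bounded_op (proj M)"
  using positive_op_proj by (simp add: positive_op_def)

text \<open>The entries are dominated by the rank-one matrix with entries
  \<open>?r k * ?r l\<close>, whose norm is at most the trace.\<close>

lemma psd_summable_bounded_op:
  assumes psd: "psd M" and bd: "\<And>N. (\<Sum>n<N. Re (M n n)) \<le> C"
  shows "bounded_op M"
proof (rule bounded_opI)
  fix N v u
  let ?r = "\<lambda>k. sqrt (Re (M k k))"
  have C: "0 \<le> C" using bd[of 0] by simp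
  have ent: "cmod (M k l) \<le> ?r k * ?r l" for k l
    using real_sqrt_le_mono[OF psd_entry_le[OF psd, of k l]] by (simp add: real_sqrt_mult)
  have CS: "(\<Sum>k<N. ?r k * cmod (w k)) \<le> sqrt C * sqrt (sq N w)" for w
  proof -
    have "(\<Sum>k<N. ?r k * cmod (w k)) \<le> sqrt (\<Sum>k<N. Re (M k k)) * sqrt (sq N w)"
      using L2_set_mult_ineq[of ?r "\<lambda>k. cmod (w k)" "{..<N}"] psd_diag(2)[OF psd]
      by (simp add: L2_set_def sq_def)
    also have "\<dots> \<le> sqrt C * sqrt (sq N w)" by (intro mult_right_mono) (simp_all add: bd)
    finally show ?thesis .
  qed
  have "cmod (sform N M v u) \<le> (\<Sum>k<N. \<Sum>l<N. (?r k * cmod (v k)) * (?r l * cmod (u l)))"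
    unfolding sform_def
  proof (intro sum_norm_le)
    fix k l
    have "cmod (v k) * cmod (M k l) * cmod (u l) \<le> cmod (v k) * (?r k * ?r l) * cmod (u l)"
      by (intro mult_right_mono mult_left_mono ent) auto
    then show "norm (cnj (v k) * M k l * u l) \<le> (?r k * cmod (v k)) * (?r l * cmod (u l))"
      by (simp add: norm_mult mult_ac)
  qed
  also have "\<dots> = (\<Sum>k<N. ?r k * cmod (v k)) * (\<Sum>l<N. ?r l * cmod (u l))"
    by (simp add: sum_product)
  also have "\<dots> \<le> (sqrt C * sqrt (sq N v)) * (sqrt C * sqrt (sq N u))"
    using psd_diag(2)[OF psd] C by (intro mult_mono CS sum_nonneg) auto
  also have "\<dots> = C * sqrt (sq N v) * sqrt (sq N u)"
    using C by (simp add: mult_ac)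
  finally show "cmod (sform N M v u) \<le> C * sqrt (sq N v) * sqrt (sq N u)" .
qed

lemma cmod_le_sqrt_sq: "k < N \<Longrightarrow> cmod (v k) \<le> sqrt (sq N v)"
proof -
  assume "k < N"
  then have "(cmod (v k))\<^sup>2 \<le> sq N v" unfolding sq_def by (intro member_le_sum) auto
  then show ?thesis using real_le_rsqrt by blast
qed

lemma bounded_op_munit [simp]: "bounded_op (munit i j)"
proof (rule bounded_opI[where C = 1])
  fix N v u
  have eq: "cnj (v k) * munit i j k l * u l
     = (if l = j then (if k = i then cnj (v i) * u j else 0) else 0)" for k l
    by (auto simp: munit_def)
  have "sform N (munit i j) v u = (if i < N \<and> j < N then cnj (v i) * u j else 0)"
    unfolding sform_def eq by (cases "j < N") simp_all
  then show "cmod (sform N (munit i j) v u) \<le> 1 * sqrt (sq N v) * sqrt (sq N u)"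
    by (auto simp: norm_mult intro!: mult_mono cmod_le_sqrt_sq)
qed

lemma bounded_op_zero [simp]: "bounded_op (\<lambda>_ _. 0)"
  by (rule bounded_opI[where C = 0]) (simp add: sform_def)

lemma pos_functional_sum:
  assumes f: "pos_functional f" and "finite S" "\<And>k. k \<in> S \<Longrightarrow> bounded_op (X k)"
  shows "bounded_op (\<lambda>i j. \<Sum>k\<in>S. c k * X k i j) \<and>
    f (\<lambda>i j. \<Sum>k\<in>S. c k * X k i j) = (\<Sum>k\<in>S. c k * f (X k))"
  using assms(2,3)
proof (induction S rule: finite_induct)
  case empty
  show ?case using pos_functional_smult[OF f bounded_op_zero, of 0] by simp
next
  case (insert k S)
  have k: "bounded_op (X k)" using insert.prems by simp
  have S: "bounded_op (\<lambda>i j. \<Sum>k\<in>S. c k * X k i j)"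
    "f (\<lambda>i j. \<Sum>k\<in>S. c k * X k i j) = (\<Sum>k\<in>S. c k * f (X k))"
    using insert by simp_all
  have "bounded_op (\<lambda>i j. c k * X k i j + 1 * (\<Sum>k\<in>S. c k * X k i j))"
    by (rule bounded_op_lincomb[OF k S(1)])
  moreover have "f (\<lambda>i j. c k * X k i j + 1 * (\<Sum>k\<in>S. c k * X k i j))
      = c k * f (X k) + 1 * f (\<lambda>i j. \<Sum>k\<in>S. c k * X k i j)"
    by (rule pos_functionalD(1)[OF f k S(1)])
  ultimately show ?case using insert.hyps S(2) by simp
qed

lemma finite_matrix_decompose:
  assumes "\<And>i j. \<not> (i < M \<and> j < M) \<Longrightarrow> w i j = 0"
  shows "w = (\<lambda>i j. \<Sum>p\<in>{..<M} \<times> {..<M}. w (fst p) (snd p) * munit (fst p) (snd p) i j)"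
proof (intro ext)
  fix i j
  have "(\<Sum>p\<in>{..<M} \<times> {..<M}. w (fst p) (snd p) * munit (fst p) (snd p) i j)
    = (\<Sum>p\<in>{..<M} \<times> {..<M}. if p = (i, j) then w i j else 0)"
    by (intro sum.cong) (auto simp: munit_def)
  also have "\<dots> = w i j" using assms[of i j] by (simp del: mem_Sigma_iff) auto
  finally show "w i j = (\<Sum>p\<in>{..<M} \<times> {..<M}. w (fst p) (snd p) * munit (fst p) (snd p) i j)" by simp
qed

lemma finite_matrix_functional:
  assumes f: "pos_functional f" and w: "\<And>i j. \<not> (i < M \<and> j < M) \<Longrightarrow> w i j = 0"
  shows "bounded_op w" "f w = (\<Sum>i<M. \<Sum>j<M. w i j * f (munit i j))"
proof -
  have *: "w = (\<lambda>i j. \<Sum>p\<in>{..<M} \<times> {..<M}. w (fst p) (snd p) * munit (fst p) (snd p) i j)"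
    by (rule finite_matrix_decompose) (rule w)
  note s = pos_functional_sum[OF f, of "{..<M} \<times> {..<M}" "\<lambda>p. munit (fst p) (snd p)" "\<lambda>p. w (fst p) (snd p)"]
  show "bounded_op w" by (subst *) (use s in simp)
  have "f w = (\<Sum>p\<in>{..<M} \<times> {..<M}. w (fst p) (snd p) * f (munit (fst p) (snd p)))"
    by (subst *) (use s in simp)
  then show "f w = (\<Sum>i<M. \<Sum>j<M. w i j * f (munit i j))"
    by (simp add: sum.cartesian_product case_prod_unfold)
qed

section \<open>Convergence in trace norm\<close>

text \<open>For arguments with a cutoff \<open>n\<close>: the limit along \<open>F\<close> is taken
  first at fixed \<open>n\<close>, and the cutoff is removed afterwards.\<close>

lemma tendsto_zero_by_bounds:
  fixes g :: "'a \<Rightarrow> real"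
  assumes nonneg: "\<And>x. 0 \<le> g x" and le: "\<And>n. \<forall>\<^sub>F x in F. g x \<le> b n x"
    and b: "\<And>n. (b n \<longlongrightarrow> L n) F" and L: "L \<longlonglongrightarrow> 0"
  shows "(g \<longlongrightarrow> 0) F"
proof (rule tendstoI)
  fix e :: real assume "0 < e"
  with L have "\<forall>\<^sub>F n in sequentially. L n < e" by (simp add: order_tendsto_iff)
  then obtain n where "L n < e" by (auto simp: eventually_sequentially)
  with b have "\<forall>\<^sub>F x in F. b n x < e" by (simp add: order_tendsto_iff)
  with le[of n] show "\<forall>\<^sub>F x in F. dist (g x) 0 < e"
    by eventually_elim (use nonneg in auto)
qed

lemma sform_add_left: "sform N x (\<lambda>n. v n + w n) u = sform N x v u + sform N x w u"
  and sform_add_right: "sform N x u (\<lambda>n. v n + w n) = sform N x u v + sform N x u w"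
  by (simp_all add: sform_def sum.distrib algebra_simps)

lemma sform_compress: "sform N (compress M x) v u = sform N x (trunc M v) (trunc M u)"
  unfolding sform_def by (intro sum.cong refl) (simp add: compress_def trunc_def)

text \<open>Only terms with a component \<open>q\<close> outside the corner survive, so the form of
  the difference is at most \<open>C * (2 * sqrt a * sqrt b + b)\<close> with \<open>b\<close> the
  mass outside. Young's inequality with parameter \<open>\<delta>\<close> dominates this by a
  diagonal form, and \<open>pos_functional_bound\<close> transfers it to \<open>f\<close>.\<close>

lemma compress_error:
  assumes f: "pos_functional f" and x: "bounded_op x" and \<delta>: "0 < \<delta>"
  shows "cmod (f x - f (compress M x))
    \<le> 2 * (norm (op_of x) * (\<delta> * Re (f idm) + (1 + 1 / \<delta>) * (Re (f idm) - Re (f (proj M)))))"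
proof -
  define C where "C = norm (op_of x)"
  have C: "0 \<le> C" by (simp add: C_def)
  define d where "d k = C * (\<delta> + (1 + 1 / \<delta>) * (if k < M then 0 else 1))" for k :: nat
  have bc: "bounded_op (compress M x)"
    by (rule finite_matrix_functional(1)[OF f, of M]) (auto simp: compress_def)
  have "\<bar>d k\<bar> \<le> C * (\<delta> + (1 + 1 / \<delta>))" for k
    using C \<delta> by (auto simp: d_def abs_mult intro!: mult_left_mono)
  then have bd: "bounded_op (diag d)" by (rule bounded_op_diag)
  have "cmod (f (x - compress M x)) \<le> 2 * Re (f (diag d))"
  proof (rule pos_functional_bound[OF f bounded_op_diff[OF x bc] bd])
    fix N u
    show "Im (sform N (diag d) u u) = 0" by (simp only: sform_diag_self Im_complex_of_real)
    let ?p = "trunc M u"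
    define q where "q = (\<lambda>n. u n - trunc M u n)"
    have u: "u = (\<lambda>n. ?p n + q n)" by (simp add: q_def)
    have "sform N x u u = sform N x ?p ?p + sform N x ?p q + (sform N x q ?p + sform N x q q)"
      by (subst (1 2) u) (simp only: sform_add_left sform_add_right)
    then have eq: "sform N (x - compress M x) u u = sform N x ?p q + sform N x q ?p + sform N x q q"
      by (simp add: sform_diff sform_compress)
    define a b where "a = sq N ?p" and "b = sq N q"
    have ab: "0 \<le> a" "0 \<le> b" by (simp_all add: a_def b_def)
    have bound: "cmod (sform N x v w) \<le> C * (sqrt (sq N v) * sqrt (sq N w))" for v w
      using bounded_op_sform_bound[OF x, of N v w] by (simp add: C_def mult.assoc)
    have "cmod (sform N (x - compress M x) u u)
        \<le> C * (sqrt a * sqrt b) + C * (sqrt b * sqrt a) + C * (sqrt b * sqrt b)"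
      unfolding eq a_def b_def by (intro order_trans[OF norm_triangle_ineq] add_mono bound)
    also have "\<dots> = C * (2 * sqrt a * sqrt b + b)" using ab by (simp add: algebra_simps)
    also have "\<dots> \<le> C * (\<delta> * (a + b) + (1 + 1 / \<delta>) * b)"
    proof (rule mult_left_mono[OF _ C])
      have "2 * (sqrt (\<delta> * a)) * sqrt (b / \<delta>) \<le> (sqrt (\<delta> * a))\<^sup>2 + (sqrt (b / \<delta>))\<^sup>2"
        by (rule sum_squares_bound)
      also have "sqrt (\<delta> * a) * sqrt (b / \<delta>) = sqrt a * sqrt b"
        using \<delta> by (simp flip: real_sqrt_mult)
      then have "2 * sqrt (\<delta> * a) * sqrt (b / \<delta>) = 2 * sqrt a * sqrt b" by simp
      finally have "2 * sqrt a * sqrt b \<le> \<delta> * a + b / \<delta>" using ab \<delta> by simp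
      moreover have "0 \<le> \<delta> * b" using ab \<delta> by simp
      ultimately show "2 * sqrt a * sqrt b + b \<le> \<delta> * (a + b) + (1 + 1 / \<delta>) * b"
        by (simp add: algebra_simps)
    qed
    also have "\<dots> = Re (sform N (diag d) u u)"
    proof -
      have "C * (\<delta> * (a + b) + (1 + 1 / \<delta>) * b) = (\<Sum>k<N. C * (\<delta> * ((cmod (?p k))\<^sup>2 + (cmod (q k))\<^sup>2)
          + (1 + 1 / \<delta>) * (cmod (q k))\<^sup>2))"
        by (simp only: a_def b_def sq_def sum_distrib_left sum.distrib[symmetric])
      also have "\<dots> = (\<Sum>k<N. d k * (cmod (u k))\<^sup>2)"
        by (intro sum.cong refl) (auto simp: d_def q_def trunc_def algebra_simps)
      finally show ?thesis by (simp only: sform_diag_self Re_complex_of_real)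
    qed
    finally show "cmod (sform N (x - compress M x) u u) \<le> Re (sform N (diag d) u u)" .
  qed
  moreover have "f (x - compress M x) = f x - f (compress M x)"
    by (rule pos_functional_diff[OF f x bc])
  moreover have "f (diag d) = complex_of_real (C * (\<delta> + (1 + 1 / \<delta>))) * f idm
      + complex_of_real (- C * (1 + 1 / \<delta>)) * f (proj M)"
  proof -
    have "diag d = (\<lambda>i j. complex_of_real (C * (\<delta> + (1 + 1 / \<delta>))) * idm i j
      + complex_of_real (- C * (1 + 1 / \<delta>)) * proj M i j)"
      by (auto simp: diag_def proj_def d_def fun_eq_iff algebra_simps)
    then show ?thesis by (simp only: pos_functionalD(1)[OF f bounded_op_idm bounded_op_proj])
  qed
  ultimately show ?thesis by (simp add: C_def[symmetric] algebra_simps)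
qed

text \<open>Continuity along the projections extends to every bounded operator: \<open>M\<close>
  grows at fixed \<open>\<delta> = 1 / (n + 1)\<close>, and then \<open>\<delta>\<close> tends to
  0.\<close>

lemma compress_LIMSEQ:
  assumes f: "pos_functional f" and x: "bounded_op x"
    and lim: "(\<lambda>M. f (proj M)) \<longlonglongrightarrow> f idm"
  shows "(\<lambda>M. f (compress M x)) \<longlonglongrightarrow> f x"
proof -
  define C where "C = norm (op_of x)"
  have "(\<lambda>M. cmod (f x - f (compress M x))) \<longlonglongrightarrow> 0"
  proof (rule tendsto_zero_by_bounds)
    fix n
    let ?\<delta> = "inverse (real (Suc n))"
    show "\<forall>\<^sub>F M in sequentially. cmod (f x - f (compress M x))
        \<le> 2 * (C * (?\<delta> * Re (f idm) + (1 + 1 / ?\<delta>) * (Re (f idm) - Re (f (proj M)))))"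
      unfolding C_def by (intro always_eventually allI compress_error[OF f x]) simp
    show "(\<lambda>M. 2 * (C * (?\<delta> * Re (f idm) + (1 + 1 / ?\<delta>) * (Re (f idm) - Re (f (proj M))))))
        \<longlonglongrightarrow> 2 * (C * (?\<delta> * Re (f idm) + (1 + 1 / ?\<delta>) * (Re (f idm) - Re (f idm))))"
      by (intro tendsto_intros lim)
  next
    have "(\<lambda>n. 2 * (C * (inverse (real (Suc n)) * Re (f idm)))) \<longlonglongrightarrow> 2 * (C * (0 * Re (f idm)))"
      by (intro tendsto_intros LIMSEQ_inverse_real_of_nat)
    then show "(\<lambda>n. 2 * (C * (inverse (real (Suc n)) * Re (f idm) + (1 + 1 / inverse (real (Suc n))) *
       (Re (f idm) - Re (f idm))))) \<longlonglongrightarrow> 0" by simp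
  qed auto
  then have "(\<lambda>M. f x - f (compress M x)) \<longlonglongrightarrow> 0" by (simp only: tendsto_norm_zero_iff)
  from tendsto_diff[OF tendsto_const[of "f x"] this] show ?thesis by simp
qed

section \<open>Normal functionals and the predual\<close>

lemma tr_mmult_munit: "tr (mmult \<sigma> (munit i j)) = \<sigma> j i"
proof -
  have "(\<lambda>c. \<sigma> a c * munit i j c b) sums (if b = j then \<sigma> a i else 0)" for a b
    using sums_finite[of "{i}" "\<lambda>c. \<sigma> a c * munit i j c b"]
    by (cases "b = j") (simp_all add: munit_def)
  then have m: "mmult \<sigma> (munit i j) a b = (if b = j then \<sigma> a i else 0)" for a b
    by (simp add: mmult_def sums_iff)
  have "(\<lambda>a. mmult \<sigma> (munit i j) a a) sums \<sigma> j i"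
    using sums_finite[of "{j}" "\<lambda>a. mmult \<sigma> (munit i j) a a"] by (simp add: m)
  then show ?thesis by (simp add: tr_def sums_iff)
qed

lemma mmult_idm: "mmult \<sigma> idm = \<sigma>"
proof (intro ext)
  fix a b
  have "(\<lambda>c. \<sigma> a c * idm c b) sums \<sigma> a b"
    using sums_finite[of "{b}" "\<lambda>c. \<sigma> a c * idm c b"] by (simp add: diag_def)
  then show "mmult \<sigma> idm a b = \<sigma> a b" by (simp add: mmult_def sums_iff)
qed

lemma pos_functional_proj:
  assumes "pos_functional f" shows "f (proj M) = (\<Sum>i<M. f (munit i i))"
proof -
  have "f (proj M) = (\<Sum>i<M. \<Sum>j<M. proj M i j * f (munit i j))"
    by (rule finite_matrix_functional(2)[OF assms]) (auto simp: proj_def diag_def)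
  also have "\<dots> = (\<Sum>i<M. \<Sum>j<M. if i = j then f (munit i i) else 0)"
    by (intro sum.cong) (auto simp: proj_def diag_def)
  finally show ?thesis by simp
qed

lemma density_sums:
  assumes "density \<eta>"
  shows "positive_op \<eta>" "summable (\<lambda>n. Re (\<eta> n n))" "(\<lambda>n. \<eta> n n) sums 1" "(\<lambda>n. Re (\<eta> n n)) sums 1"
proof -
  show p: "positive_op \<eta>" and s: "summable (\<lambda>n. Re (\<eta> n n))"
    using assms trace_class_positive by (auto simp: density_def)
  have "\<eta> n n = complex_of_real (Re (\<eta> n n))" for n
    using p psd_diag(1)[of \<eta> n] by (simp add: positive_op_iff_psd complex_eq_iff)
  then have eq: "(\<lambda>n. \<eta> n n) = (\<lambda>n. complex_of_real (Re (\<eta> n n)))" by auto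
  have "summable (\<lambda>n. \<eta> n n)" by (subst eq) (use s in \<open>simp add: summable_complex_of_real\<close>)
  then show t: "(\<lambda>n. \<eta> n n) sums 1"
    using assms by (simp add: density_def tr_def sums_iff)
  from sums_Re[OF t] show "(\<lambda>n. Re (\<eta> n n)) sums 1" by simp
qed

lemma densityI:
  assumes "positive_op \<eta>" "(\<lambda>n. \<eta> n n) sums 1"
  shows "density \<eta>"
  using assms sums_Re[OF assms(2)]
  by (simp add: density_def trace_class_positive tr_def sums_iff)

text \<open>Both functionals agree on matrix units, hence on corners, hence in the limit on all
  bounded operators. The indices of \<open>\<sigma>\<close> are swapped because a trace against
  \<open>munit i j\<close> reads off entry \<open>(j, i)\<close>.\<close>

lemma normal_functional_density:
  assumes f: "pos_functional f" and one: "f idm = 1" and lim: "(\<lambda>M. f (proj M)) \<longlonglongrightarrow> 1"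
  defines "\<sigma> \<equiv> (\<lambda>i j. f (munit j i))"
  shows "density \<sigma>" "\<And>x. bounded_op x \<Longrightarrow> tr (mmult \<sigma> x) = f x"
proof -
  have psd: "psd \<sigma>" unfolding psd_def
  proof (intro allI)
    fix N u
    \<comment> \<open>The rank-one operator of the truncated vector; \<open>f W\<close> is exactly
      the form of \<open>\<sigma>\<close> at \<open>u\<close>.\<close>
    define W where "W = (\<lambda>a b. trunc N u a * cnj (trunc N u b))"
    have W0: "\<And>i j. \<not> (i < N \<and> j < N) \<Longrightarrow> W i j = 0" by (auto simp: W_def trunc_def)
    have "sform N' W v v = complex_of_real ((cmod (\<Sum>a<N'. cnj (v a) * trunc N u a))\<^sup>2)" for N' v
    proof -
      have "sform N' W v v = (\<Sum>a<N'. cnj (v a) * trunc N u a) * (\<Sum>b<N'. cnj (trunc N u b) * v b)"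
        unfolding sform_def W_def sum_product by (intro sum.cong refl) (simp add: mult_ac)
      also have "(\<Sum>b<N'. cnj (trunc N u b) * v b) = cnj (\<Sum>a<N'. cnj (v a) * trunc N u a)"
        by (simp add: mult.commute)
      finally show ?thesis by (simp add: complex_norm_square del: of_real_power)
    qed
    then have pW: "positive_op W"
      unfolding positive_op_iff_psd psd_def using finite_matrix_functional(1)[OF f W0] by simp
    have "f W = sform N \<sigma> u u"
    proof -
      have "f W = (\<Sum>i<N. \<Sum>j<N. W i j * f (munit i j))"
        by (rule finite_matrix_functional(2)[OF f W0])
      also have "\<dots> = sform N \<sigma> u u"
        unfolding sform_def by (subst sum.swap, intro sum.cong refl) (simp add: W_def \<sigma>_def trunc_def mult_ac)
      finally show ?thesis .
    qed
    then show "Im (sform N \<sigma> u u) = 0 \<and> 0 \<le> Re (sform N \<sigma> u u)"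
      using pos_functionalD(2,3)[OF f pW] by simp
  qed
  have part: "(\<Sum>n<N. \<sigma> n n) = f (proj N)" for N
    using pos_functional_proj[OF f] by (simp add: \<sigma>_def)
  have "(\<Sum>n<N. Re (\<sigma> n n)) \<le> 1" for N
  proof -
    have "positive_op (diag (\<lambda>k. if k < N then 0 else 1))"
      by (rule positive_op_diag[where C = 1]) auto
    moreover have "diag (\<lambda>k. if k < N then 0 else 1) = idm - proj N"
      by (auto simp: diag_def proj_def fun_eq_iff)
    ultimately have "0 \<le> Re (f (idm - proj N))" using pos_functionalD(3)[OF f] by simp
    then have "Re (f (proj N)) \<le> 1" by (simp add: pos_functional_diff[OF f] one)
    then show ?thesis by (simp add: part flip: Re_sum)
  qed
  then have b: "bounded_op \<sigma>" by (rule psd_summable_bounded_op[OF psd])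
  then have pos: "positive_op \<sigma>" using psd by (simp add: positive_op_iff_psd)
  have "(\<lambda>n. \<sigma> n n) sums 1" using lim by (simp add: sums_def part)
  with pos show d: "density \<sigma>" by (rule densityI)
  fix x assume x: "bounded_op x"
  define g where "g y = tr (mmult \<sigma> y)" for y
  have g: "pos_functional g"
    unfolding g_def using density_sums[OF d] by (intro pos_functional_tr)
  have gm: "g (munit i j) = f (munit i j)" for i j
    by (simp add: g_def tr_mmult_munit \<sigma>_def)
  have "g idm = 1" using d by (simp add: g_def mmult_idm density_def)
  moreover have "g (proj M) = f (proj M)" for M
    by (simp add: pos_functional_proj[OF f] pos_functional_proj[OF g] gm)
  ultimately have "(\<lambda>M. g (compress M x)) \<longlonglongrightarrow> g x"
    using lim by (intro compress_LIMSEQ[OF g x]) simp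
  moreover have "g (compress M x) = f (compress M x)" for M
  proof -
    have c0: "\<And>i j. \<not> (i < M \<and> j < M) \<Longrightarrow> compress M x i j = 0" by (auto simp: compress_def)
    show ?thesis
      using finite_matrix_functional(2)[OF f c0] finite_matrix_functional(2)[OF g c0] by (simp only: gm)
  qed
  moreover have "(\<lambda>M. f (compress M x)) \<longlonglongrightarrow> f x"
    using lim one by (intro compress_LIMSEQ[OF f x]) simp
  ultimately show "tr (mmult \<sigma> x) = f x" unfolding g_def[symmetric] using LIMSEQ_unique by simp
qed

text \<open>Testing on \<open>munit j i\<close> determines entry \<open>(i, j)\<close>, so the
  description in \<open>predual\<close> has at most one solution.\<close>

lemma predual_eqI:
  assumes "trace_class \<sigma>" "\<And>x. bounded_op x \<Longrightarrow> tr (mmult \<sigma> x) = tr (mmult \<eta> (T t x))"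
  shows "predual T t \<eta> = \<sigma>"
  unfolding predual_def
proof (rule the_equality)
  fix \<sigma>' assume *: "trace_class \<sigma>' \<and> (\<forall>x. bounded_op x \<longrightarrow> tr (mmult \<sigma>' x) = tr (mmult \<eta> (T t x)))"
  show "\<sigma>' = \<sigma>"
  proof (intro ext)
    fix i j
    have "tr (mmult \<sigma>' (munit j i)) = tr (mmult \<sigma> (munit j i))" using * assms(2) by simp
    then show "\<sigma>' i j = \<sigma> i j" by (simp add: tr_mmult_munit)
  qed
qed (use assms in auto)

text \<open>The Hilbert-Schmidt norm of \<open>R U\<close> equals that of its adjoint
  \<open>U R\<close>, where the contraction acts last and can only shrink each
  \<open>R e_m\<close>.\<close>

lemma sum_norm_root_contraction_le:
  assumes R: "pos_op R" "complex_linear R" "(\<lambda>n. (norm (R (ket n)))\<^sup>2) sums 1"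
    and U: "symmetric_op U" "complex_linear U" "norm U \<le> 1"
  shows "(\<Sum>n<K. (norm (R (U (ket n))))\<^sup>2) \<le> 1"
proof -
  have eq: "coord (R (U (ket n))) m = cnj (coord (U (R (ket m))) n)" for n m
  proof -
    have "coord (R (U (ket n))) m = cinner (U (R (ket m))) (ket n)"
      using symmetric_op_cinner[OF pos_opD(2)[OF R(1)] R(2)] symmetric_op_cinner[OF U(1,2)]
      by (simp flip: cinner_ket)
    then show ?thesis using cinner_commute[of "U (R (ket m))" "ket n"] by (simp add: cinner_ket)
  qed
  have sm: "(\<lambda>m. \<Sum>n<K. (cmod (coord (R (U (ket n))) m))\<^sup>2) sums (\<Sum>n<K. (norm (R (U (ket n))))\<^sup>2)"
    by (intro sums_sum norm_l2_sums)
  have "(\<Sum>n<K. (cmod (coord (R (U (ket n))) m))\<^sup>2) \<le> (norm (R (ket m)))\<^sup>2" for m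
  proof -
    have "(\<Sum>n<K. (cmod (coord (R (U (ket n))) m))\<^sup>2) \<le> (norm (U (R (ket m))))\<^sup>2"
      unfolding eq using sum_coord_le_norm[of "U (R (ket m))" K] by simp
    also have "\<dots> \<le> (norm (R (ket m)))\<^sup>2"
      using norm_blinfun[of U "R (ket m)"] mult_right_mono[OF U(3), of "norm (R (ket m))"]
      by (intro power_mono) auto
    finally show ?thesis .
  qed
  from sums_le[OF this sm R(3)] show ?thesis .
qed

text \<open>With a root \<open>R\<close> of \<open>\<sigma>\<close> each term is the inner product
  of \<open>R e_n\<close> and \<open>R U e_n\<close>. Cauchy-Schwarz over \<open>n\<close> leaves
  the root of the trace tail times a Hilbert-Schmidt norm of at most 1.\<close>

lemma density_off_corner_sum_le:
  assumes d: "density \<sigma>"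
    and U: "symmetric_op U" "complex_linear U" "norm U \<le> 1" and NK: "N \<le> K"
  shows "(\<Sum>n\<in>{N..<K}. cmod (cinner (ket n) (op_of \<sigma> (U (ket n))))) \<le> sqrt (1 - (\<Sum>n<N. Re (\<sigma> n n)))"
proof -
  note ds = density_sums[OF d]
  obtain R where R: "pos_op R" "complex_linear R" "R o\<^sub>L R = op_of \<sigma>" "\<And>n. (norm (R (ket n)))\<^sup>2 = Re (\<sigma> n n)"
    using positive_op_root[OF ds(1)] by blast
  have s: "(\<lambda>n. (norm (R (ket n)))\<^sup>2) sums 1" using ds(4) by (simp add: R(4))
  have le: "cmod (cinner (ket n) (op_of \<sigma> (U (ket n)))) \<le> \<bar>norm (R (ket n))\<bar> * \<bar>norm (R (U (ket n)))\<bar>" for n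
    using cmod_cinner_le[of "R (ket n)" "R (U (ket n))"]
    by (simp add: symmetric_op_cinner[OF pos_opD(2)[OF R(1)] R(2)] flip: R(3))
  have tail: "(\<Sum>n\<in>{N..<K}. (norm (R (ket n)))\<^sup>2) \<le> 1 - (\<Sum>n<N. Re (\<sigma> n n))"
  proof -
    have "(\<Sum>n<K. (norm (R (ket n)))\<^sup>2) \<le> 1"
      using sum_le_suminf[of "\<lambda>n. (norm (R (ket n)))\<^sup>2" "{..<K}"] s by (simp add: sums_iff)
    moreover have "(\<Sum>n<K. (norm (R (ket n)))\<^sup>2)
        = (\<Sum>n<N. (norm (R (ket n)))\<^sup>2) + (\<Sum>n\<in>{N..<K}. (norm (R (ket n)))\<^sup>2)"
      using NK sum.atLeastLessThan_concat[of 0 N K "\<lambda>n. (norm (R (ket n)))\<^sup>2"]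
      by (simp add: lessThan_atLeast0)
    ultimately show ?thesis by (simp add: R(4))
  qed
  have "(\<Sum>n\<in>{N..<K}. cmod (cinner (ket n) (op_of \<sigma> (U (ket n)))))
     \<le> (\<Sum>n\<in>{N..<K}. \<bar>norm (R (ket n))\<bar> * \<bar>norm (R (U (ket n)))\<bar>)"
    by (intro sum_mono le)
  also have "\<dots> \<le> L2_set (\<lambda>n. norm (R (ket n))) {N..<K} * L2_set (\<lambda>n. norm (R (U (ket n)))) {N..<K}"
    by (rule L2_set_mult_ineq)
  also have "\<dots> \<le> sqrt (1 - (\<Sum>n<N. Re (\<sigma> n n))) * 1"
  proof (intro mult_mono)
    show "L2_set (\<lambda>n. norm (R (ket n))) {N..<K} \<le> sqrt (1 - (\<Sum>n<N. Re (\<sigma> n n)))"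
      using tail by (simp add: L2_set_def)
    have "(\<Sum>n\<in>{N..<K}. (norm (R (U (ket n))))\<^sup>2) \<le> (\<Sum>n<K. (norm (R (U (ket n))))\<^sup>2)"
      by (intro sum_mono2) auto
    also have "\<dots> \<le> 1" by (rule sum_norm_root_contraction_le[OF R(1,2) s U])
    finally show "L2_set (\<lambda>n. norm (R (U (ket n)))) {N..<K} \<le> 1" by (simp add: L2_set_def)
    have "0 \<le> (\<Sum>n\<in>{N..<K}. (norm (R (ket n)))\<^sup>2)" by (intro sum_nonneg) auto
    with tail show "0 \<le> sqrt (1 - (\<Sum>n<N. Re (\<sigma> n n)))" by simp
  qed (simp add: L2_set_nonneg)
  finally show ?thesis by simp
qed

lemma op_of_diff:
  assumes "bounded_op x" "bounded_op y" shows "op_of (x - y) u = op_of x u - op_of y u"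
proof -
  have "x - y = (\<lambda>i j. 1 * x i j + (-1) * y i j)" by (simp add: fun_eq_iff)
  then show ?thesis by (simp only: op_of_lincomb[OF assms]) (simp add: minus_l2_def)
qed

text \<open>The sum over \<open>n \<ge> N\<close> is controlled through \<open>|M| = lim M U\<^sub>k\<close> with contractions \<open>U\<^sub>k\<close>,
  because \<open>\<Sum>\<^sub>n \<parallel>\<sigma>\<^sup>1\<^sup>/\<^sup>2 U\<^sub>k e\<^sub>n\<parallel>\<^sup>2 \<le> tr \<sigma>\<close>.\<close>
lemma trace_norm_density_diff_le:
  assumes \<sigma>: "density \<sigma>" and \<rho>: "density \<rho>"
  shows "trace_norm (\<sigma> - \<rho>) \<le> (\<Sum>n<N. norm (op_of (\<sigma> - \<rho>) (ket n)))
     + (sqrt (1 - (\<Sum>n<N. Re (\<sigma> n n))) + sqrt (1 - (\<Sum>n<N. Re (\<rho> n n))))"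
    and "0 \<le> trace_norm (\<sigma> - \<rho>)"
proof -
  have b: "bounded_op \<sigma>" "bounded_op \<rho>"
    using \<sigma> \<rho> by (simp_all add: density_def positive_op_def)
  let ?M = "\<sigma> - \<rho>"
  have bM: "bounded_op ?M" by (intro bounded_op_diff b)
  define A where "A = op_of ?M"
  define S where "S = op_of (opabs ?M)"
  have cA: "complex_linear A" unfolding A_def by (rule complex_linear_op_of[OF bM])
  have Ax: "A u = op_of \<sigma> u - op_of \<rho> u" for u unfolding A_def by (rule op_of_diff[OF b])
  have symA: "symmetric_op A"
    using pos_opD(2)[OF pos_op_op_of] \<sigma> \<rho> by (simp add: density_def symmetric_op_def Ax inner_simps)
  have adjM: "adj ?M = ?M"
    using positive_op_adj[of \<sigma>] positive_op_adj[of \<rho>] \<sigma> \<rho>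
    by (auto simp: density_def adj_def fun_eq_iff)
  have pS: "positive_op (opabs ?M)" by (rule opabs_props[OF bM])
  then have bS: "bounded_op (opabs ?M)" by (simp add: positive_op_def)
  have S: "pos_op S" unfolding S_def by (rule pos_op_op_of[OF pS])
  have SA: "S o\<^sub>L S = A o\<^sub>L A"
    using opabs_props(2)[OF bM]
    by (simp only: S_def A_def adjM op_of_mmult[OF bS bS, symmetric] op_of_mmult[OF bM bM, symmetric])
  have Sd: "Re (opabs ?M n n) = inner (ket n) (S (ket n))" for n
    by (simp add: S_def inner_l2_def cinner_ket coord_op_of_entry[OF bS])
  have nn: "0 \<le> Re (opabs ?M n n)" for n unfolding Sd by (rule pos_opD[OF S])
  \<comment> \<open>Rescaling into the unit ball, where the sign iteration lives; the summand 1
    covers \<open>A = 0\<close>.\<close>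
  define c where "c = norm A + 1"
  have c: "0 < c" by (simp add: c_def add_nonneg_pos)
  define A' where "A' = inverse c *\<^sub>R A"
  define S' where "S' = inverse c *\<^sub>R S"
  define U where "U = sign_iter A'"
  have sA': "symmetric_op A'" using symA by (simp add: symmetric_op_def A'_def blinfun.bilinear_simps)
  have nA': "norm A' \<le> 1" using c by (simp add: A'_def c_def field_simps)
  have "pos_op S'" using S c by (simp add: pos_op_def symmetric_op_def S'_def blinfun.bilinear_simps)
  moreover have "S' o\<^sub>L S' = A' o\<^sub>L A'"
  proof (rule blinfun_eqI)
    fix u
    have "S (S u) = A (A u)" using arg_cong[OF SA, of "\<lambda>Z. blinfun_apply Z u"] by simp
    then show "(S' o\<^sub>L S') u = (A' o\<^sub>L A') u" by (simp add: S'_def A'_def blinfun.bilinear_simps)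
  qed
  ultimately have lim': "(\<lambda>k. A' (U k u)) \<longlonglongrightarrow> S' u" for u
    unfolding U_def by (rule sign_iter_LIMSEQ[OF sA' nA'])
  have lim: "(\<lambda>k. A (U k u)) \<longlonglongrightarrow> S u" for u
    using tendsto_scaleR[OF tendsto_const[of c] lim'[of u]] c by (simp add: A'_def S'_def blinfun.bilinear_simps)
  have U: "symmetric_op (U k)" "complex_linear (U k)" "norm (U k) \<le> 1" for k
  proof -
    show "symmetric_op (U k)" unfolding U_def by (rule symmetric_op_sign_iter[OF sA'])
    show "norm (U k) \<le> 1" unfolding U_def by (rule sign_iter_norm[OF sA' nA'])
    have "commuting imult A'"
      using cA by (simp add: complex_linear_def commuting_def A'_def blinfun.bilinear_simps)
    then show "complex_linear (U k)"
      unfolding U_def complex_linear_def by (subst commuting_sym) (rule sign_iter_commuting)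
  qed
  let ?tail = "sqrt (1 - (\<Sum>n<N. Re (\<sigma> n n))) + sqrt (1 - (\<Sum>n<N. Re (\<rho> n n)))"
  have tail: "(\<Sum>n\<in>{N..<K}. inner (ket n) (S (ket n))) \<le> ?tail" if "N \<le> K" for K
  proof (rule LIMSEQ_le_const2)
    show "(\<lambda>k. \<Sum>n\<in>{N..<K}. inner (ket n) (A (U k (ket n)))) \<longlonglongrightarrow> (\<Sum>n\<in>{N..<K}. inner (ket n) (S (ket n)))"
      by (intro tendsto_intros lim)
    have "(\<Sum>n\<in>{N..<K}. inner (ket n) (A (U k (ket n)))) \<le> ?tail" for k
    proof -
      have "inner (ket n) (A (U k (ket n))) \<le> cmod (cinner (ket n) (op_of \<sigma> (U k (ket n))))
          + cmod (cinner (ket n) (op_of \<rho> (U k (ket n))))" for n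
        using complex_Re_le_cmod[of "cinner (ket n) (A (U k (ket n)))"]
          norm_triangle_ineq4[of "cinner (ket n) (op_of \<sigma> (U k (ket n)))" "cinner (ket n) (op_of \<rho> (U k (ket n)))"]
        by (simp add: inner_l2_def Ax cinner_diff_right)
      then have "(\<Sum>n\<in>{N..<K}. inner (ket n) (A (U k (ket n))))
        \<le> (\<Sum>n\<in>{N..<K}. cmod (cinner (ket n) (op_of \<sigma> (U k (ket n)))))
          + (\<Sum>n\<in>{N..<K}. cmod (cinner (ket n) (op_of \<rho> (U k (ket n)))))"
        unfolding sum.distrib[symmetric] by (intro sum_mono)
      also have "\<dots> \<le> ?tail"
        by (intro add_mono density_off_corner_sum_le \<sigma> \<rho> U that)
      finally show ?thesis .
    qed
    then show "\<exists>k0. \<forall>k\<ge>k0. (\<Sum>n\<in>{N..<K}. inner (ket n) (A (U k (ket n)))) \<le> ?tail" by blast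
  qed
  \<comment> \<open>\<open>S\<close> and \<open>A\<close> have equal squares and are symmetric, so
    they have equal norms on each basis vector.\<close>
  have head: "inner (ket n) (S (ket n)) \<le> norm (A (ket n))" for n
  proof -
    have "inner (S (ket n)) (S (ket n)) = inner (A (ket n)) (A (ket n))"
      using arg_cong[OF SA, of "\<lambda>Z. inner (ket n) (blinfun_apply Z (ket n))"]
        symmetric_opD[OF symA] symmetric_opD[OF pos_opD(2)[OF S]] by simp
    then have "norm (S (ket n)) = norm (A (ket n))" by (simp add: norm_eq)
    then show ?thesis using norm_cauchy_schwarz[of "ket n" "S (ket n)"] by simp
  qed
  let ?B = "(\<Sum>n<N. norm (A (ket n))) + ?tail"
  have partial: "(\<Sum>n<K. Re (opabs ?M n n)) \<le> ?B" for K
  proof -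
    have "(\<Sum>n<K. Re (opabs ?M n n)) \<le> (\<Sum>n<max K N. Re (opabs ?M n n))"
      using nn by (intro sum_mono2) auto
    also have "\<dots> = (\<Sum>n<N. Re (opabs ?M n n)) + (\<Sum>n\<in>{N..<max K N}. Re (opabs ?M n n))"
      using sum.atLeastLessThan_concat[of 0 N "max K N" "\<lambda>n. Re (opabs ?M n n)"]
      by (simp add: lessThan_atLeast0)
    also have "\<dots> \<le> ?B"
      unfolding Sd by (intro add_mono sum_mono head tail) auto
    finally show ?thesis .
  qed
  have s: "summable (\<lambda>n. Re (opabs ?M n n))"
    by (rule summableI_nonneg_bounded[OF nn partial])
  show "trace_norm ?M \<le> (\<Sum>n<N. norm (op_of ?M (ket n))) + ?tail"
    unfolding trace_norm_def A_def[symmetric] by (rule suminf_le_const[OF s partial])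
  show "0 \<le> trace_norm ?M"
    unfolding trace_norm_def by (rule suminf_nonneg[OF s nn])
qed

text \<open>No mass escapes to infinity: all traces are 1, so a tail is 1 minus finitely many
  diagonal entries and converges to the tail of \<open>\<rho>\<close>. This controls the columns of
  the difference as well as the remainder outside a corner.\<close>

lemma trace_norm_tendsto_zero:
  assumes \<rho>: "density \<rho>" and \<sigma>: "\<forall>\<^sub>F t in F. density (\<sigma> t)"
    and ent: "\<And>i j. ((\<lambda>t. \<sigma> t i j) \<longlongrightarrow> \<rho> i j) F"
  shows "((\<lambda>t. trace_norm (\<sigma> t - \<rho>)) \<longlongrightarrow> 0) F"
proof -
  note r = density_sums[OF \<rho>]
  have reent: "((\<lambda>t. Re (\<sigma> t i j)) \<longlongrightarrow> Re (\<rho> i j)) F" for i j by (intro tendsto_intros ent)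
  have partial_lim: "(\<lambda>K. 1 - (\<Sum>m<K. Re (\<rho> m m))) \<longlonglongrightarrow> 0"
    using tendsto_diff[OF tendsto_const[of 1] r(4)[unfolded sums_def]] by simp
  have ev: "\<forall>\<^sub>F t in F. P t" if "\<And>t. density (\<sigma> t) \<Longrightarrow> P t" for P
    using \<sigma> by eventually_elim (rule that)
  have col_le: "(norm (op_of (\<sigma> t - \<rho>) (ket n)))\<^sup>2 \<le> (\<Sum>m<K. (cmod (\<sigma> t m n - \<rho> m n))\<^sup>2)
      + (2 * (1 - (\<Sum>m<K. Re (\<sigma> t m m))) + 2 * (1 - (\<Sum>m<K. Re (\<rho> m m))))" if d: "density (\<sigma> t)" for t n K
  proof -
    note s = density_sums[OF d]
    have b: "bounded_op (\<sigma> t - \<rho>)"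
      using s(1) r(1) by (intro bounded_op_diff) (simp_all add: positive_op_def)
    \<comment> \<open>The minor inequality with one diagonal entry bounded by the trace 1; it makes
      column tails smaller than trace tails.\<close>
    have ent_le: "(cmod (\<eta> m n))\<^sup>2 \<le> Re (\<eta> m m)" if "density \<eta>" for \<eta> m
    proof -
      note e = density_sums[OF that]
      have p: "psd \<eta>" using e(1) by (simp add: positive_op_iff_psd)
      have "Re (\<eta> n n) \<le> (\<Sum>k<Suc n. Re (\<eta> k k))"
        using psd_diag(2)[OF p] by (intro member_le_sum) auto
      also have "\<dots> \<le> 1"
        using sum_le_suminf[OF e(2), of "{..<Suc n}"] e(4) psd_diag(2)[OF p] by (simp add: sums_iff)
      finally have "Re (\<eta> m m) * Re (\<eta> n n) \<le> Re (\<eta> m m) * 1"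
        using psd_diag(2)[OF p] by (intro mult_left_mono) auto
      with psd_entry_le[OF p, of m n] show ?thesis by simp
    qed
    define a where "a m = (cmod (\<sigma> t m n - \<rho> m n))\<^sup>2" for m
    have a: "a sums (norm (op_of (\<sigma> t - \<rho>) (ket n)))\<^sup>2"
      using norm_l2_sums[of "op_of (\<sigma> t - \<rho>) (ket n)"] by (simp add: coord_op_of_entry[OF b] a_def[abs_def])
    have s1: "(\<lambda>m. a (m + K)) sums ((norm (op_of (\<sigma> t - \<rho>) (ket n)))\<^sup>2 - (\<Sum>m<K. a m))"
      by (rule sums_split_initial_segment[OF a])
    have s2: "(\<lambda>m. 2 * Re (\<sigma> t (m + K) (m + K)) + 2 * Re (\<rho> (m + K) (m + K)))
        sums (2 * (1 - (\<Sum>m<K. Re (\<sigma> t m m))) + 2 * (1 - (\<Sum>m<K. Re (\<rho> m m))))"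
      by (intro sums_add sums_mult sums_split_initial_segment s(4) r(4))
    have "a (m + K) \<le> 2 * Re (\<sigma> t (m + K) (m + K)) + 2 * Re (\<rho> (m + K) (m + K))" for m
      unfolding a_def using cmod_add_sq_le[of "\<sigma> t (m + K) n" "- \<rho> (m + K) n"]
        ent_le[OF d, of "m + K"] ent_le[OF \<rho>, of "m + K"] by simp
    from sums_le[OF this s1 s2] show ?thesis by (simp add: a_def)
  qed
  have col: "((\<lambda>t. norm (op_of (\<sigma> t - \<rho>) (ket n))) \<longlongrightarrow> 0) F" for n
  proof -
    have "((\<lambda>t. (norm (op_of (\<sigma> t - \<rho>) (ket n)))\<^sup>2) \<longlongrightarrow> 0) F"
    proof (rule tendsto_zero_by_bounds)
      fix K
      show "\<forall>\<^sub>F t in F. (norm (op_of (\<sigma> t - \<rho>) (ket n)))\<^sup>2 \<le> (\<Sum>m<K. (cmod (\<sigma> t m n - \<rho> m n))\<^sup>2)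
        + (2 * (1 - (\<Sum>m<K. Re (\<sigma> t m m))) + 2 * (1 - (\<Sum>m<K. Re (\<rho> m m))))"
        by (rule ev) (rule col_le)
      show "((\<lambda>t. (\<Sum>m<K. (cmod (\<sigma> t m n - \<rho> m n))\<^sup>2)
          + (2 * (1 - (\<Sum>m<K. Re (\<sigma> t m m))) + 2 * (1 - (\<Sum>m<K. Re (\<rho> m m)))))
        \<longlongrightarrow> (\<Sum>m<K. (cmod (\<rho> m n - \<rho> m n))\<^sup>2)
          + (2 * (1 - (\<Sum>m<K. Re (\<rho> m m))) + 2 * (1 - (\<Sum>m<K. Re (\<rho> m m))))) F"
        by (intro tendsto_intros ent)
    next
      show "(\<lambda>K. (\<Sum>m<K. (cmod (\<rho> m n - \<rho> m n))\<^sup>2)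
          + (2 * (1 - (\<Sum>m<K. Re (\<rho> m m))) + 2 * (1 - (\<Sum>m<K. Re (\<rho> m m))))) \<longlonglongrightarrow> 0"
        using tendsto_mult[OF tendsto_const[of 4] partial_lim] by simp
    qed simp
    from tendsto_real_sqrt[OF this] show ?thesis by simp
  qed
  have "((\<lambda>t. \<bar>trace_norm (\<sigma> t - \<rho>)\<bar>) \<longlongrightarrow> 0) F"
  proof (rule tendsto_zero_by_bounds)
    fix N
    let ?b = "\<lambda>t. (\<Sum>n<N. norm (op_of (\<sigma> t - \<rho>) (ket n)))
     + (sqrt (1 - (\<Sum>n<N. Re (\<sigma> t n n))) + sqrt (1 - (\<Sum>n<N. Re (\<rho> n n))))"
    show "\<forall>\<^sub>F t in F. \<bar>trace_norm (\<sigma> t - \<rho>)\<bar> \<le> ?b t"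
    proof (rule ev)
      fix t assume "density (\<sigma> t)"
      from trace_norm_density_diff_le(1)[OF this \<rho>, of N] trace_norm_density_diff_le(2)[OF this \<rho>] show "\<bar>trace_norm (\<sigma> t - \<rho>)\<bar> \<le> ?b t" by simp
    qed
    show "(?b \<longlongrightarrow> (\<Sum>n<N. 0) + (sqrt (1 - (\<Sum>n<N. Re (\<rho> n n))) + sqrt (1 - (\<Sum>n<N. Re (\<rho> n n))))) F"
      by (intro tendsto_intros col ent)
  next
    have "(\<lambda>N. (sqrt (1 - (\<Sum>n<N. Re (\<rho> n n))) + sqrt (1 - (\<Sum>n<N. Re (\<rho> n n))))) \<longlonglongrightarrow> sqrt 0 + sqrt 0"
      by (intro tendsto_add tendsto_real_sqrt partial_lim)
    then show "(\<lambda>N. (\<Sum>n<N. 0) + (sqrt (1 - (\<Sum>n<N. Re (\<rho> n n))) + sqrt (1 - (\<Sum>n<N. Re (\<rho> n n))))) \<longlonglongrightarrow> 0"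
      by simp
  qed simp
  then show ?thesis by (simp only: tendsto_rabs_zero_iff)
qed

section \<open>The Dyson series\<close>

text \<open>Polarization bounds the form by \<open>K\<close> times the sum of the squared norms;
  normalizing both vectors gives the factor 2. It is needed because positivity controls only the
  quadratic form.\<close>

lemma sform_bound_quadratic:
  assumes q: "\<And>N u. cmod (sform N y u u) \<le> K * sq N u"
  shows "cmod (sform N y v u) \<le> 2 * K * sqrt (sq N v) * sqrt (sq N u)"
proof -
  have K: "0 \<le> K"
    using order_trans[OF norm_ge_zero q[of 1 "unit_vec 0"]] by (simp add: sq_def unit_vec_def)
  have scale_r: "sform N y w (\<lambda>n. c * w' n) = c * sform N y w w'" 
    and scale_l: "sform N y (\<lambda>n. c * w n) w' = cnj c * sform N y w w'" for c w w'
    by (simp_all add: sform_def sum_distrib_left mult_ac)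
  have pol: "4 * sform N y v u = (sform N y (\<lambda>n. v n + u n) (\<lambda>n. v n + u n)
      - sform N y (\<lambda>n. v n + (-1) * u n) (\<lambda>n. v n + (-1) * u n))
      + (- \<i>) * (sform N y (\<lambda>n. v n + \<i> * u n) (\<lambda>n. v n + \<i> * u n)
      - sform N y (\<lambda>n. v n + (-\<i>) * u n) (\<lambda>n. v n + (-\<i>) * u n))" for v u
    unfolding sform_add_left sform_add_right scale_r scale_l by (simp add: algebra_simps)
  have par: "sq N (\<lambda>n. v n + c * u n) + sq N (\<lambda>n. v n + (-c) * u n) = 2 * sq N v + 2 * (cmod c)\<^sup>2 * sq N u" for v u c
  proof -
    have "(cmod (a + b))\<^sup>2 + (cmod (a + (-b)))\<^sup>2 = 2 * (cmod a)\<^sup>2 + 2 * (cmod b)\<^sup>2" for a b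
      unfolding cmod_power2 by (simp add: power2_eq_square algebra_simps)
    from this[of "v n" "c * u n" for n] show ?thesis
      by (simp add: sq_def sum_distrib_left norm_mult power_mult_distrib mult_ac flip: sum.distrib)
  qed
  have base: "cmod (sform N y v u) \<le> K * (sq N v + sq N u)" for v u
  proof -
    have "4 * cmod (sform N y v u) = cmod (4 * sform N y v u)" by (simp add: norm_mult)
    also have "\<dots> \<le> K * sq N (\<lambda>n. v n + u n) + K * sq N (\<lambda>n. v n + (-1) * u n)
       + (K * sq N (\<lambda>n. v n + \<i> * u n) + K * sq N (\<lambda>n. v n + (-\<i>) * u n))"
      unfolding pol
      by (intro order_trans[OF norm_triangle_ineq] add_mono order_trans[OF norm_triangle_ineq4] q)
        (simp add: norm_mult, intro order_trans[OF norm_triangle_ineq4] add_mono q)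
    also have "\<dots> = K * (sq N (\<lambda>n. v n + 1 * u n) + sq N (\<lambda>n. v n + (-1) * u n))
       + K * (sq N (\<lambda>n. v n + \<i> * u n) + sq N (\<lambda>n. v n + (-\<i>) * u n))"
      by (simp add: algebra_simps)
    also have "\<dots> = 4 * (K * (sq N v + sq N u))"
      unfolding par by (simp add: algebra_simps)
    finally show ?thesis by simp
  qed
  define a b where "a = sqrt (sq N v)" and "b = sqrt (sq N u)"
  show ?thesis
  proof (cases "a = 0 \<or> b = 0")
    case True
    have "w k = 0" if "sq N w = 0" "k < N" for w k
      using that by (simp add: sq_def sum_nonneg_eq_0_iff)
    then have "sform N y v u = 0" using True unfolding sform_def a_def b_def
      by (intro sum.neutral ballI) auto
    then show ?thesis using K by simp
  next
    case False
    then have ab: "0 < a" "0 < b" by (simp_all add: a_def b_def less_le)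
    have sqs: "sq N (\<lambda>n. complex_of_real c * w n) = c\<^sup>2 * sq N w" for c w
      by (simp add: sq_def norm_mult power_mult_distrib sum_distrib_left)
    have "cmod (sform N y (\<lambda>n. complex_of_real (1/a) * v n) (\<lambda>n. complex_of_real (1/b) * u n)) \<le> K * (1 + 1)"
    proof (rule order_trans[OF base])
      have "a\<^sup>2 = sq N v" "b\<^sup>2 = sq N u" by (simp_all add: a_def b_def)
      then show "K * (sq N (\<lambda>n. complex_of_real (1/a) * v n) + sq N (\<lambda>n. complex_of_real (1/b) * u n)) \<le> K * (1 + 1)"
        unfolding sqs using ab K by (simp add: power_divide)
    qed
    then have "cmod (sform N y v u) / (a * b) \<le> 2 * K"
      unfolding scale_r scale_l using ab by (simp add: norm_mult norm_divide mult_ac)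
    then show ?thesis using ab by (simp add: field_simps a_def[symmetric] b_def[symmetric])
  qed
qed

lemma bounded_opI_quadratic:
  assumes "\<And>N u. cmod (sform N y u u) \<le> K * sq N u"
  shows "bounded_op y"
  using sform_bound_quadratic[OF assms] by (rule bounded_opI)

text \<open>A positive map with image of the identity at most the identity. The values need only be
  \<open>psd\<close>, as for entrywise limits; their boundedness follows.\<close>

definition pos_contraction :: "(mat \<Rightarrow> mat) \<Rightarrow> bool" where
  "pos_contraction \<Phi> \<longleftrightarrow>
    (\<forall>x y a b. bounded_op x \<longrightarrow> bounded_op y \<longrightarrow>
         \<Phi> (\<lambda>i j. a * x i j + b * y i j) = (\<lambda>i j. a * \<Phi> x i j + b * \<Phi> y i j)) \<and>
    (\<forall>x. positive_op x \<longrightarrow> psd (\<Phi> x)) \<and> psd (idm - \<Phi> idm)"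

text \<open>At a fixed vector the form of \<open>\<Phi> y\<close> is a positive functional of
  \<open>y\<close> whose value at \<open>idm\<close> is at most \<open>sq N u\<close>.\<close>

lemma pos_contraction_sform_bound:
  assumes \<Phi>: "pos_contraction \<Phi>" and x: "bounded_op x"
  shows "cmod (sform N (\<Phi> x) u u) \<le> 2 * norm (op_of x) * sq N u"
proof -
  define C where "C = norm (op_of x)"
  define f where "f y = sform N (\<Phi> y) u u" for y
  have f: "pos_functional f"
    using \<Phi> unfolding pos_functional_def pos_contraction_def f_def by (simp add: sform_lincomb psdD)
  have z: "bounded_op (\<lambda>i j. complex_of_real C * idm i j)" by (intro bounded_op_smult) simp
  have sz: "sform N (\<lambda>i j. complex_of_real C * idm i j) u u = complex_of_real (C * sq N u)" for N u
    using sform_lincomb[of N "complex_of_real C" idm 0 "\<lambda>_ _. 0" u u] by (simp add: sform_idm)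
  have "cmod (f x) \<le> 2 * Re (f (\<lambda>i j. complex_of_real C * idm i j))"
  proof (rule pos_functional_bound[OF f x z])
    fix N u
    have "cmod (sform N x u u) \<le> C * (sqrt (sq N u) * sqrt (sq N u))"
      using bounded_op_sform_bound[OF x, of N u u] by (simp add: C_def mult.assoc)
    then show "cmod (sform N x u u) \<le> Re (sform N (\<lambda>i j. complex_of_real C * idm i j) u u)"
      unfolding sz by simp
    show "Im (sform N (\<lambda>i j. complex_of_real C * idm i j) u u) = 0" unfolding sz by simp
  qed
  also have "f (\<lambda>i j. complex_of_real C * idm i j) = complex_of_real C * f idm"
    by (rule pos_functional_smult[OF f]) simp
  also have "2 * Re (complex_of_real C * f idm) \<le> 2 * (C * sq N u)"
  proof -
    have "psd (idm - \<Phi> idm)" using \<Phi> by (simp add: pos_contraction_def)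
    from psdD(2)[OF this, of N u] have "Re (f idm) \<le> sq N u"
      by (simp add: sform_diff sform_idm f_def)
    then show ?thesis by (simp add: C_def mult_left_mono)
  qed
  finally show ?thesis by (simp add: f_def C_def)
qed

lemma bounded_op_entry_le: "bounded_op x \<Longrightarrow> cmod (x i j) \<le> norm (op_of x)"
  using cmod_coord_le[of "op_of x (ket j)" i] norm_blinfun[of "op_of x" "ket j"]
  by (simp add: coord_op_of_entry)

text \<open>Variation of constants for \<open>f' = g f + F\<close>, \<open>f 0 = c\<close>. With
  \<open>exp (t g)\<close> outside the integral, regularity follows from that of an indefinite
  integral.\<close>

definition duhamel :: "'a::{real_normed_field,banach} \<Rightarrow> 'a \<Rightarrow> (real \<Rightarrow> 'a) \<Rightarrow> real \<Rightarrow> 'a" where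
  "duhamel g c F t = exp (t *\<^sub>R g) * (c + integral {0..t} (\<lambda>s. exp (- (s *\<^sub>R g)) * F s))"

lemma continuous_on_exp_scaleR:
  fixes g :: "'a::{real_normed_field,banach}"
  shows "continuous_on S (\<lambda>s. exp (s *\<^sub>R g))" "continuous_on S (\<lambda>s. exp (- (s *\<^sub>R g)))"
  by (intro continuous_intros)+

lemma duhamel_integrable:
  fixes F :: "real \<Rightarrow> 'a::{real_normed_field,banach}"
  assumes "continuous_on {0..t} F"
  shows "(\<lambda>s. exp (- (s *\<^sub>R g)) * F s) integrable_on {0..t}"
  by (intro integrable_continuous_interval continuous_on_mult continuous_on_exp_scaleR assms)

lemma continuous_on_duhamel:
  fixes F :: "real \<Rightarrow> 'a::{real_normed_field,banach}"
  assumes "(\<lambda>s. exp (- (s *\<^sub>R g)) * F s) integrable_on {0..b}"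
  shows "continuous_on {0..b} (duhamel g c F)"
  unfolding duhamel_def
  by (intro continuous_on_mult continuous_on_add continuous_on_const continuous_on_exp_scaleR
      indefinite_integral_continuous_1 assms)

lemma duhamel_lincomb:
  fixes F :: "real \<Rightarrow> 'a::{real_normed_field,banach}"
  assumes "continuous_on {0..t} F" "continuous_on {0..t} G"
  shows "duhamel g (a * c + b * d) (\<lambda>s. a * F s + b * G s) t = a * duhamel g c F t + b * duhamel g d G t"
proof -
  have i: "(\<lambda>s. exp (- (s *\<^sub>R g)) * F s) integrable_on {0..t}"
    "(\<lambda>s. exp (- (s *\<^sub>R g)) * G s) integrable_on {0..t}"
    using assms by (simp_all add: duhamel_integrable)
  have "(\<lambda>s. exp (- (s *\<^sub>R g)) * (a * F s + b * G s))
      = (\<lambda>s. a * (exp (- (s *\<^sub>R g)) * F s) + b * (exp (- (s *\<^sub>R g)) * G s))"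
    by (simp add: algebra_simps)
  moreover have "integral {0..t} (\<lambda>s. a * (exp (- (s *\<^sub>R g)) * F s) + b * (exp (- (s *\<^sub>R g)) * G s))
      = a * integral {0..t} (\<lambda>s. exp (- (s *\<^sub>R g)) * F s) + b * integral {0..t} (\<lambda>s. exp (- (s *\<^sub>R g)) * G s)"
    using i by (subst integral_add) (auto intro: integrable_on_mult_right simp: integral_mult_right)
  ultimately show ?thesis unfolding duhamel_def by (simp add: algebra_simps)
qed

lemma duhamel_mono:
  fixes F G :: "real \<Rightarrow> real"
  assumes "continuous_on {0..t} F" "continuous_on {0..t} G" "c \<le> d" "\<And>s. s \<in> {0..t} \<Longrightarrow> F s \<le> G s"
  shows "duhamel g c F t \<le> duhamel g d G t"
  unfolding duhamel_def using assms
  by (intro mult_left_mono add_mono integral_le duhamel_integrable) auto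

lemma norm_duhamel_le:
  fixes g :: complex
  assumes "continuous_on {0..t} F" "continuous_on {0..t} G" "cmod c \<le> d"
    "\<And>s. s \<in> {0..t} \<Longrightarrow> cmod (F s) \<le> G s"
  shows "cmod (duhamel g c F t) \<le> duhamel (Re g) d G t"
proof -
  have "cmod (integral {0..t} (\<lambda>s. exp (- (s *\<^sub>R g)) * F s)) \<le> integral {0..t} (\<lambda>s. exp (- (s *\<^sub>R Re g)) * G s)"
    using assms by (intro integral_norm_bound_integral duhamel_integrable) (auto simp: norm_mult)
  then have "cmod (c + integral {0..t} (\<lambda>s. exp (- (s *\<^sub>R g)) * F s))
      \<le> d + integral {0..t} (\<lambda>s. exp (- (s *\<^sub>R Re g)) * G s)"
    using assms(3) by (intro order_trans[OF norm_triangle_ineq] add_mono)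
  then show ?thesis unfolding duhamel_def by (simp add: norm_mult mult_left_mono)
qed

text \<open>The constant 1 solves \<open>f' = -\<kappa> f + \<kappa>\<close> with initial value
  1.\<close>

lemma duhamel_balanced:
  assumes "0 \<le> t" shows "duhamel (- \<kappa>) 1 (\<lambda>_. \<kappa>) t = (1 :: real)"
proof -
  have "((\<lambda>s. exp (s * \<kappa>) * \<kappa>) has_integral exp (t * \<kappa>) - exp (0 * \<kappa>)) {0..t}"
    using assms by (intro fundamental_theorem_of_calculus)
      (auto intro!: derivative_eq_intros simp flip: has_real_derivative_iff_has_vector_derivative)
  then have "integral {0..t} (\<lambda>s. exp (s * \<kappa>) * \<kappa>) = exp (t * \<kappa>) - exp (0 * \<kappa>)"
    by (rule integral_unique)
  then show ?thesis by (simp add: duhamel_def flip: exp_add)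
qed

section \<open>The entrywise equation and its Picard iterates\<close>

locale qds_parameters =
  fixes r lam mu zp zm :: real
  assumes r_pos: "0 < r" and lam_pos: "0 < lam" and lam_less_mu: "lam < mu"
begin

lemma mu_pos: "0 < mu" using lam_pos lam_less_mu by simp

lemma omega_0 [simp]: "omega r 0 = 0" by (simp add: omega_def)

lemma omega_Suc_pos: "0 < omega r (Suc n)"
  using r_pos by (simp add: omega_def add_nonneg_pos)

lemma omega_nonneg [simp]: "0 \<le> omega r n"
  by (cases n) (use omega_Suc_pos less_imp_le in auto)

definition rate :: "nat \<Rightarrow> nat \<Rightarrow> complex" where
  "rate k l = cnj (geig r lam mu zp zm k) + geig r lam mu zp zm l"

text \<open>Arithmetic means of \<open>omega\<close> at the two indices, against the geometric means
  in \<open>down\<close> and \<open>up\<close>; hence loss dominates gain.\<close>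

definition loss :: "nat \<Rightarrow> nat \<Rightarrow> real" where
  "loss k l = lam\<^sup>2 * ((omega r (Suc k) + omega r (Suc l)) / 2) + mu\<^sup>2 * ((omega r k + omega r l) / 2)"

definition down :: "nat \<Rightarrow> nat \<Rightarrow> real" where
  "down k l = mu\<^sup>2 * (sqrt (omega r k) * sqrt (omega r l))"

definition up :: "nat \<Rightarrow> nat \<Rightarrow> real" where
  "up k l = lam\<^sup>2 * (sqrt (omega r (Suc k)) * sqrt (omega r (Suc l)))"

text \<open>The truncated subtraction is harmless: \<^term>\<open>down\<close> vanishes when an index is \<open>0\<close>.\<close>
definition gain :: "(nat \<Rightarrow> nat \<Rightarrow> 'a::real_vector) \<Rightarrow> nat \<Rightarrow> nat \<Rightarrow> 'a" where
  "gain X k l = down k l *\<^sub>R X (k - 1) (l - 1) + up k l *\<^sub>R X (Suc k) (Suc l)"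

lemma Re_rate: "Re (rate k l) = - loss k l"
  by (simp add: rate_def loss_def geig_def field_simps)

lemma sqrt_omega_mult_le: "sqrt (omega r k) * sqrt (omega r l) \<le> (omega r k + omega r l) / 2"
  using sum_squares_bound[of "sqrt (omega r k)" "sqrt (omega r l)"] by simp

lemma down_nonneg [simp]: "0 \<le> down k l" and up_nonneg [simp]: "0 \<le> up k l"
  by (simp_all add: down_def up_def)

lemma down_0 [simp]: "down 0 l = 0" "down k 0 = 0"
  by (simp_all add: down_def)

lemma down_up_le_loss: "down k l + up k l \<le> loss k l"
  unfolding down_def up_def loss_def
  using mult_left_mono[OF sqrt_omega_mult_le[of k l], of "mu\<^sup>2"]
    mult_left_mono[OF sqrt_omega_mult_le[of "Suc k" "Suc l"], of "lam\<^sup>2"] by simp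

lemma gain_mono:
  fixes X Y :: "nat \<Rightarrow> nat \<Rightarrow> real"
  assumes "\<And>k l. X k l \<le> Y k l" shows "gain X k l \<le> gain Y k l"
  unfolding gain_def by (intro add_mono scaleR_left_mono assms) auto

lemma gain_continuous:
  assumes "\<And>k l. continuous_on S (\<lambda>s. X s k l)"
  shows "continuous_on S (\<lambda>s. gain (X s) k l :: 'a::real_normed_vector)"
  unfolding gain_def by (intro continuous_on_add continuous_on_scaleR continuous_on_const assms)

lemma norm_gain_le:
  assumes "\<And>k l. norm (X k l) \<le> Y k l" shows "norm (gain X k l) \<le> gain Y k l"
  unfolding gain_def
  by (intro order_trans[OF norm_triangle_ineq] add_mono) (auto intro!: mult_left_mono assms)

text \<open>Picard iterates: the n-th is the Dyson series restricted to histories with fewer than n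
  jumps. The scalar iterates \<open>majorant\<close> follow the same recursion with data 1 and the
  real parts of the rates.\<close>

primrec dyson :: "nat \<Rightarrow> mat \<Rightarrow> real \<Rightarrow> nat \<Rightarrow> nat \<Rightarrow> complex" where
  "dyson 0 x = (\<lambda>t k l. 0)"
| "dyson (Suc n) x = (\<lambda>t k l. duhamel (rate k l) (x k l) (\<lambda>s. gain (dyson n x s) k l) t)"

primrec majorant :: "nat \<Rightarrow> real \<Rightarrow> nat \<Rightarrow> nat \<Rightarrow> real" where
  "majorant 0 = (\<lambda>t k l. 0)"
| "majorant (Suc n) = (\<lambda>t k l. duhamel (- loss k l) 1 (\<lambda>s. gain (majorant n s) k l) t)"

lemma dyson_continuous: "continuous_on {0..b} (\<lambda>t. dyson n x t k l)"
proof (induction n arbitrary: k l)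
  case (Suc n)
  have "continuous_on {0..b} (duhamel (rate k l) (x k l) (\<lambda>s. gain (dyson n x s) k l))"
    by (intro continuous_on_duhamel duhamel_integrable gain_continuous Suc.IH)
  then show ?case by simp
qed simp

lemma majorant_continuous: "continuous_on {0..b} (\<lambda>t. majorant n t k l)"
proof (induction n arbitrary: k l)
  case (Suc n)
  have "continuous_on {0..b} (duhamel (- loss k l) 1 (\<lambda>s. gain (majorant n s) k l))"
    by (intro continuous_on_duhamel duhamel_integrable gain_continuous Suc.IH)
  then show ?case by simp
qed simp

lemma majorant_mono: "0 \<le> t \<Longrightarrow> majorant n t k l \<le> majorant (Suc n) t k l"
proof (induction n arbitrary: t k l)
  case 0
  have "duhamel (- loss k l) 0 (\<lambda>_. 0) t \<le> duhamel (- loss k l) 1 (\<lambda>_. gain (\<lambda>_ _. 0) k l) t"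
    by (rule duhamel_mono) (auto simp: gain_def)
  then show ?case by (simp add: duhamel_def)
next
  case (Suc n)
  have "duhamel (- loss k l) 1 (\<lambda>s. gain (majorant n s) k l) t
      \<le> duhamel (- loss k l) 1 (\<lambda>s. gain (majorant (Suc n) s) k l) t"
    by (intro duhamel_mono gain_continuous majorant_continuous gain_mono Suc.IH) auto
  then show ?case by (simp del: majorant.simps(2) add: majorant.simps(2)[of n] majorant.simps(2)[of "Suc n"])
qed

lemma majorant_nonneg: "0 \<le> t \<Longrightarrow> 0 \<le> majorant n t k l"
proof (induction n)
  case (Suc n)
  then show ?case using majorant_mono[of t n k l] by linarith
qed simp

text \<open>Since \<open>down + up \<le> loss\<close>, the constant 1 is a supersolution;
  \<open>duhamel_balanced\<close> evaluates the case with \<open>loss\<close> itself as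
  source.\<close>

lemma majorant_le_1: "0 \<le> t \<Longrightarrow> majorant n t k l \<le> 1"
proof (induction n arbitrary: t k l)
  case (Suc n)
  have "gain (majorant n s) k l \<le> loss k l" if "0 \<le> s" for s
  proof -
    have "gain (majorant n s) k l \<le> gain (\<lambda>_ _. 1) k l" by (intro gain_mono Suc.IH that)
    also have "\<dots> \<le> loss k l" using down_up_le_loss by (simp add: gain_def)
    finally show ?thesis .
  qed
  then have "duhamel (- loss k l) 1 (\<lambda>s. gain (majorant n s) k l) t \<le> duhamel (- loss k l) 1 (\<lambda>_. loss k l) t"
    by (intro duhamel_mono gain_continuous majorant_continuous) auto
  then show ?case by (simp add: duhamel_balanced[OF Suc.prems])
qed simp

lemma gain_diff: "gain (\<lambda>k l. X k l - Y k l) k l = gain X k l - gain Y k l"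
  by (simp add: gain_def algebra_simps)

lemma gain_lincomb:
  "gain (\<lambda>k l. a * X k l + b * Y k l) k l = a * gain X k l + b * (gain Y k l :: 'a::real_field)"
  by (simp add: gain_def algebra_simps scaleR_conv_of_real)

text \<open>The phases of \<open>rate\<close> drop out of the modulus and the coefficients of
  \<open>gain\<close> are nonnegative. Dominating increments rather than iterates gives absolute
  convergence once the majorant converges.\<close>

lemma dyson_diff_le:
  assumes x: "\<And>k l. cmod (x k l) \<le> c"
  shows "0 \<le> t \<Longrightarrow> cmod (dyson (Suc n) x t k l - dyson n x t k l)
      \<le> c * (majorant (Suc n) t k l - majorant n t k l)"
proof (induction n arbitrary: t k l)
  case 0
  have "cmod (duhamel (rate k l) (x k l) (\<lambda>_. gain (\<lambda>_ _. 0) k l) t)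
    \<le> duhamel (Re (rate k l)) c (\<lambda>_. 0) t"
    by (rule norm_duhamel_le) (auto simp: x gain_def)
  then show ?case by (simp add: duhamel_def Re_rate gain_def mult.commute)
next
  case (Suc n)
  let ?F = "\<lambda>n s. gain (dyson n x s) k l" and ?G = "\<lambda>n s. gain (majorant n s) k l"
  have cF: "continuous_on {0..t} (?F n)" for n by (intro gain_continuous dyson_continuous)
  have cG: "continuous_on {0..t} (?G n)" for n by (intro gain_continuous majorant_continuous)
  have "dyson (Suc (Suc n)) x t k l - dyson (Suc n) x t k l
      = 1 * duhamel (rate k l) (x k l) (?F (Suc n)) t + (-1) * duhamel (rate k l) (x k l) (?F n) t"
    by (simp del: dyson.simps(2) add: dyson.simps(2)[of n] dyson.simps(2)[of "Suc n"])
  also have "\<dots> = duhamel (rate k l) (1 * x k l + (-1) * x k l) (\<lambda>s. 1 * ?F (Suc n) s + (-1) * ?F n s) t"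
    by (rule duhamel_lincomb[OF cF cF, symmetric])
  finally have 1: "dyson (Suc (Suc n)) x t k l - dyson (Suc n) x t k l
     = duhamel (rate k l) 0 (\<lambda>s. ?F (Suc n) s - ?F n s) t" by simp
  have "c * (majorant (Suc (Suc n)) t k l - majorant (Suc n) t k l)
      = c * duhamel (- loss k l) 1 (?G (Suc n)) t + (-c) * duhamel (- loss k l) 1 (?G n) t"
    by (simp del: majorant.simps(2) add: majorant.simps(2)[of n] majorant.simps(2)[of "Suc n"] algebra_simps)
  also have "\<dots> = duhamel (- loss k l) (c * 1 + (-c) * 1) (\<lambda>s. c * ?G (Suc n) s + (-c) * ?G n s) t"
    by (rule duhamel_lincomb[OF cG cG, symmetric])
  finally have 2: "c * (majorant (Suc (Suc n)) t k l - majorant (Suc n) t k l)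
      = duhamel (- loss k l) 0 (\<lambda>s. c * ?G (Suc n) s + (-c) * ?G n s) t" by simp
  have "cmod (duhamel (rate k l) 0 (\<lambda>s. ?F (Suc n) s - ?F n s) t)
      \<le> duhamel (Re (rate k l)) 0 (\<lambda>s. c * ?G (Suc n) s + (-c) * ?G n s) t"
  proof (rule norm_duhamel_le)
    fix s assume "s \<in> {0..t}"
    then have "cmod (gain (\<lambda>k l. dyson (Suc n) x s k l - dyson n x s k l) k l)
        \<le> gain (\<lambda>k l. c * majorant (Suc n) s k l + (-c) * majorant n s k l) k l"
      using Suc.IH[of s] by (intro norm_gain_le) (simp add: algebra_simps del: dyson.simps majorant.simps)
    then show "cmod (?F (Suc n) s - ?F n s) \<le> c * ?G (Suc n) s + (-c) * ?G n s"
      unfolding gain_diff gain_lincomb .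
  qed (intro continuous_intros cF cG | simp)+
  then show ?case unfolding 1 2 Re_rate .
qed

definition semigroup_sol :: "real \<Rightarrow> mat \<Rightarrow> mat" where
  "semigroup_sol t x = (\<lambda>k l. lim (\<lambda>n. dyson n x t k l))"

lemma dyson_le:
  assumes x: "\<And>k l. cmod (x k l) \<le> c" and t: "0 \<le> t"
  shows "cmod (dyson n x t k l) \<le> c * majorant n t k l"
proof (induction n)
  case (Suc n)
  have "cmod (dyson (Suc n) x t k l) \<le> cmod (dyson (Suc n) x t k l - dyson n x t k l) + cmod (dyson n x t k l)"
    using norm_triangle_ineq[of "dyson (Suc n) x t k l - dyson n x t k l" "dyson n x t k l"] by simp
  with Suc dyson_diff_le[of x c t n k l, OF x t] show ?case by (simp add: algebra_simps del: dyson.simps majorant.simps)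
qed simp

lemma dyson_LIMSEQ:
  assumes x: "\<And>k l. cmod (x k l) \<le> c" and t: "0 \<le> t"
  shows "(\<lambda>n. dyson n x t k l) \<longlonglongrightarrow> semigroup_sol t x k l"
proof -
  have "summable (\<lambda>n. dyson (Suc n) x t k l - dyson n x t k l)"
  proof (rule summable_comparison_test')
    have "incseq (\<lambda>n. majorant n t k l)"
      by (rule incseq_SucI) (rule majorant_mono[OF t])
    moreover have "Bseq (\<lambda>n. majorant n t k l)"
      using majorant_nonneg[OF t] majorant_le_1[OF t] by (intro BseqI'[where K = 1]) simp
    ultimately have "convergent (\<lambda>n. majorant n t k l)"
      by (intro Bseq_mono_convergent) (auto simp: incseq_def)
    then have "summable (\<lambda>n. majorant (Suc n) t k l - majorant n t k l)"
      unfolding convergent_def using telescope_summable by blast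
    then show "summable (\<lambda>n. c * (majorant (Suc n) t k l - majorant n t k l))" by (rule summable_mult)
    show "norm (dyson (Suc n) x t k l - dyson n x t k l) \<le> c * (majorant (Suc n) t k l - majorant n t k l)" for n
      by (rule dyson_diff_le[OF x t])
  qed
  then have "convergent (\<lambda>n. \<Sum>k'<n. dyson (Suc k') x t k l - dyson k' x t k l)"
    by (simp only: summable_iff_convergent)
  then have "convergent (\<lambda>n. dyson n x t k l)" by (subst (asm) sum_lessThan_telescope) simp
  then show ?thesis by (simp add: semigroup_sol_def convergent_LIMSEQ_iff)
qed

lemma semigroup_sol_le:
  assumes x: "\<And>k l. cmod (x k l) \<le> c" and t: "0 \<le> t"
  shows "cmod (semigroup_sol t x k l) \<le> c"
proof (rule Lim_bounded[OF tendsto_norm[OF dyson_LIMSEQ[OF x t]]])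
  have c: "0 \<le> c" using order_trans[OF norm_ge_zero x] .
  show "\<forall>n\<ge>0. cmod (dyson n x t k l) \<le> c"
  proof (intro allI impI)
    fix n
    show "cmod (dyson n x t k l) \<le> c"
    using dyson_le[of x c, OF x t, of n k l] mult_left_mono[OF majorant_le_1[OF t] c, of n k l] by linarith
  qed
qed

text \<open>Dominated convergence in the recursion; the bound \<open>c\<close> on all iterates makes
  \<open>?h\<close> an integrable majorant.\<close>

lemma semigroup_sol_eq:
  assumes x: "\<And>k l. cmod (x k l) \<le> c" and t: "0 \<le> t"
  shows "semigroup_sol t x k l = duhamel (rate k l) (x k l) (\<lambda>s. gain (semigroup_sol s x) k l) t"
    and "(\<lambda>s. exp (- (s *\<^sub>R rate k l)) * gain (semigroup_sol s x) k l) integrable_on {0..t}"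
proof -
  let ?f = "\<lambda>n s. exp (- (s *\<^sub>R rate k l)) * gain (dyson n x s) k l"
  let ?g = "\<lambda>s. exp (- (s *\<^sub>R rate k l)) * gain (semigroup_sol s x) k l"
  let ?h = "\<lambda>s. exp (s *\<^sub>R loss k l) * gain (\<lambda>_ _. c) k l"
  have c: "0 \<le> c" using order_trans[OF norm_ge_zero x] .
  have 1: "?f n integrable_on {0..t}" for n
    by (intro duhamel_integrable gain_continuous dyson_continuous)
  have 2: "?h integrable_on {0..t}"
    by (intro integrable_continuous_interval continuous_intros)
  have 3: "norm (?f n s) \<le> ?h s" if "s \<in> {0..t}" for n s
  proof -
    have "cmod (dyson n x s k l) \<le> c" for k l
      using dyson_le[of x c s n k l, OF x] mult_left_mono[OF majorant_le_1 c, of s n k l] that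
      by simp
    then have "cmod (gain (dyson n x s) k l) \<le> gain (\<lambda>_ _. c) k l" by (intro norm_gain_le)
    then show ?thesis by (simp add: norm_mult Re_rate mult_left_mono)
  qed
  have 4: "(\<lambda>n. ?f n s) \<longlonglongrightarrow> ?g s" if "s \<in> {0..t}" for s
    unfolding gain_def using that by (intro tendsto_intros dyson_LIMSEQ[OF x]) auto
  show "?g integrable_on {0..t}" by (rule dominated_convergence(1)[OF 1 2 3 4])
  have "(\<lambda>n. dyson (Suc n) x t k l) \<longlonglongrightarrow> duhamel (rate k l) (x k l) (\<lambda>s. gain (semigroup_sol s x) k l) t"
    unfolding dyson.simps duhamel_def
    by (intro tendsto_intros dominated_convergence(2)[OF 1 2 3 4])
  moreover have "(\<lambda>n. dyson (Suc n) x t k l) \<longlonglongrightarrow> semigroup_sol t x k l"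
    by (rule LIMSEQ_Suc[OF dyson_LIMSEQ[OF x t]])
  ultimately show "semigroup_sol t x k l = duhamel (rate k l) (x k l) (\<lambda>s. gain (semigroup_sol s x) k l) t"
    using LIMSEQ_unique by blast
qed

lemma semigroup_sol_continuous:
  assumes x: "\<And>k l. cmod (x k l) \<le> c"
  shows "continuous_on {0..b} (\<lambda>t. semigroup_sol t x k l)"
proof (cases "0 \<le> b")
  case True
  have "continuous_on {0..b} (duhamel (rate k l) (x k l) (\<lambda>s. gain (semigroup_sol s x) k l))"
    by (rule continuous_on_duhamel[OF semigroup_sol_eq(2)[OF x True]])
  then show ?thesis
    by (rule continuous_on_eq) (rule semigroup_sol_eq(1)[OF x, symmetric], simp)
qed simp

lemma dyson_lincomb: "dyson n (\<lambda>i j. a * x i j + b * y i j) t k l = a * dyson n x t k l + b * dyson n y t k l"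
proof (induction n arbitrary: t k l)
  case (Suc n)
  have "duhamel (rate k l) (a * x k l + b * y k l) (\<lambda>s. a * gain (dyson n x s) k l + b * gain (dyson n y s) k l) t
     = a * duhamel (rate k l) (x k l) (\<lambda>s. gain (dyson n x s) k l) t
       + b * duhamel (rate k l) (y k l) (\<lambda>s. gain (dyson n y s) k l) t"
    by (intro duhamel_lincomb gain_continuous dyson_continuous)
  moreover have "gain (dyson n (\<lambda>i j. a * x i j + b * y i j) s) k l
     = a * gain (dyson n x s) k l + b * gain (dyson n y s) k l" for s
    unfolding gain_lincomb[symmetric] Suc.IH ..
  ultimately show ?case by simp
qed simp

text \<open>\<open>gain X\<close> is the matrix of the jump part, the sum over both \<open>L\<close>
  of the adjoint of \<open>L\<close> times \<open>X\<close> times \<open>L\<close>. Lowering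
  shortens a section of length \<open>N + 1\<close> to \<open>N\<close>, raising extends it to
  \<open>N + 2\<close>.\<close>

lemma sform_gain:
  "sform (Suc N) (gain X) v u = sform N X (L1 r mu v) (L1 r mu u)
     + sform (Suc (Suc N)) X (L2 r lam v) (L2 r lam u)"
proof -
  have "sform (Suc N) (gain X) v u
      = (\<Sum>k<Suc N. \<Sum>l<Suc N. cnj (v k) * (down k l *\<^sub>R X (k - 1) (l - 1)) * u l)
      + (\<Sum>k<Suc N. \<Sum>l<Suc N. cnj (v k) * (up k l *\<^sub>R X (Suc k) (Suc l)) * u l)"
    unfolding sform_def gain_def sum.distrib[symmetric] by (intro sum.cong refl) (simp add: algebra_simps)
  moreover have "(\<Sum>k<Suc N. \<Sum>l<Suc N. cnj (v k) * (down k l *\<^sub>R X (k - 1) (l - 1)) * u l)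
      = sform N X (L1 r mu v) (L1 r mu u)"
    unfolding sum.lessThan_Suc_shift sform_def
    by (simp add: L1_def Bop_def down_def scaleR_conv_of_real power2_eq_square mult_ac)
  moreover have "(\<Sum>k<Suc N. \<Sum>l<Suc N. cnj (v k) * (up k l *\<^sub>R X (Suc k) (Suc l)) * u l)
      = sform (Suc (Suc N)) X (L2 r lam v) (L2 r lam u)"
    unfolding sform_def sum.lessThan_Suc_shift[of _ "Suc N"]
    by (simp add: L2_def Bplus_def up_def scaleR_conv_of_real power2_eq_square mult_ac)
  ultimately show ?thesis by simp
qed

lemma psd_gain: assumes "psd X" shows "psd (gain X)"
  unfolding psd_def
proof (intro allI)
  fix N u
  show "Im (sform N (gain X) u u) = 0 \<and> 0 \<le> Re (sform N (gain X) u u)"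
  proof (cases N)
    case 0
    then show ?thesis by (simp add: sform_def)
  next
    case (Suc N')
    show ?thesis unfolding Suc sform_gain using psdD[OF assms] by simp
  qed
qed

abbreviation P where "P \<equiv> Pt r lam mu zp zm"

text \<open>\<open>exp (t *\<^sub>R rate k l)\<close> is the product of the conjugate eigenvalue of
  \<open>P t\<close> at \<open>k\<close> and the eigenvalue at \<open>l\<close>, so the entry
  formula is a component of the operator equation. In this form positivity of the integrand is
  visible.\<close>

lemma sform_duhamel:
  assumes eq: "\<And>k l. X k l = duhamel (rate k l) (x k l) (\<lambda>s. gain (Y s) k l) t"
    and Y: "\<And>k l. continuous_on {0..t} (\<lambda>s. Y s k l)"
  shows "sform N X v u = sform N x (P t v) (P t u)
    + integral {0..t} (\<lambda>s. sform N (gain (Y s)) (P (t - s) v) (P (t - s) u))"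
    and "(\<lambda>s. sform N (gain (Y s)) (P (t - s) v) (P (t - s) u)) integrable_on {0..t}"
proof -
  let ?w = "\<lambda>k l s. cnj (P (t - s) v k) * gain (Y s) k l * P (t - s) u l"
  have cont: "continuous_on {0..t} (?w k l)" for k l
    unfolding Pt_def by (intro continuous_intros gain_continuous Y)
  then have int: "?w k l integrable_on {0..t}" for k l by (rule integrable_continuous_interval)
  have rt: "(t *\<^sub>R rate k l) = cnj (complex_of_real t * geig r lam mu zp zm k) + complex_of_real t * geig r lam mu zp zm l" for t k l
    by (simp add: rate_def scaleR_conv_of_real algebra_simps)
  have entry: "cnj (v k) * X k l * u l = cnj (P t v k) * x k l * P t u l + integral {0..t} (?w k l)" for k l
  proof -
    have w: "?w k l = (\<lambda>s. (cnj (v k) * exp (t *\<^sub>R rate k l) * u l) * (exp (- (s *\<^sub>R rate k l)) * gain (Y s) k l))"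
    proof
      fix s
      have "cnj (exp (complex_of_real (t - s) * geig r lam mu zp zm k)) * exp (complex_of_real (t - s) * geig r lam mu zp zm l)
         = exp (t *\<^sub>R rate k l) * exp (- (s *\<^sub>R rate k l))"
        unfolding rt exp_cnj exp_add[symmetric] by (simp add: algebra_simps)
      then have "cnj (v k) * u l * gain (Y s) k l * (cnj (exp (complex_of_real (t - s) * geig r lam mu zp zm k)) * exp (complex_of_real (t - s) * geig r lam mu zp zm l))
        = cnj (v k) * u l * gain (Y s) k l * (exp (t *\<^sub>R rate k l) * exp (- (s *\<^sub>R rate k l)))" by simp
      then show "?w k l s = (cnj (v k) * exp (t *\<^sub>R rate k l) * u l) * (exp (- (s *\<^sub>R rate k l)) * gain (Y s) k l)"
        by (simp only: Pt_def complex_cnj_mult mult_ac)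
    qed
    have w0: "cnj (P t v k) * x k l * P t u l = (cnj (v k) * exp (t *\<^sub>R rate k l) * u l) * x k l"
      unfolding rt exp_add Pt_def by (simp add: exp_cnj mult_ac)
    show ?thesis
      unfolding w w0 eq duhamel_def integral_mult_right by (simp add: distrib_left mult_ac)
  qed
  have "sform N X v u = (\<Sum>k<N. \<Sum>l<N. cnj (P t v k) * x k l * P t u l) + (\<Sum>k<N. \<Sum>l<N. integral {0..t} (?w k l))"
    unfolding sform_def entry by (simp add: sum.distrib)
  also have "(\<Sum>k<N. \<Sum>l<N. integral {0..t} (?w k l)) = integral {0..t} (\<lambda>s. \<Sum>k<N. \<Sum>l<N. ?w k l s)"
    using int by (simp add: integral_sum integrable_sum)
  finally show "sform N X v u = sform N x (P t v) (P t u)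
    + integral {0..t} (\<lambda>s. sform N (gain (Y s)) (P (t - s) v) (P (t - s) u))"
    by (simp add: sform_def)
  show "(\<lambda>s. sform N (gain (Y s)) (P (t - s) v) (P (t - s) u)) integrable_on {0..t}"
    unfolding sform_def using int by (intro integrable_sum) auto
qed

lemma psd_dyson: "psd x \<Longrightarrow> 0 \<le> t \<Longrightarrow> psd (dyson n x t)"
proof (induction n arbitrary: t)
  case 0
  then show ?case by (simp add: psd_def sform_def)
next
  case (Suc n)
  show ?case unfolding psd_def
  proof (intro allI)
    fix N u
    let ?F = "\<lambda>s. sform N (gain (dyson n x s)) (P (t - s) u) (P (t - s) u)"
    have "dyson (Suc n) x t k l = duhamel (rate k l) (x k l) (\<lambda>s. gain (dyson n x s) k l) t" for k l
      by simp
    note d = sform_duhamel[of "dyson (Suc n) x t", OF this dyson_continuous, of N u u]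
    have nn: "Im (?F s) = 0" "0 \<le> Re (?F s)" if "s \<in> {0..t}" for s
      using psdD[OF psd_gain[OF Suc.IH[OF Suc.prems(1)]]] that by auto
    have "integral {0..t} (\<lambda>s. Re (?F s)) = Re (integral {0..t} ?F)"
      "integral {0..t} (\<lambda>s. Im (?F s)) = Im (integral {0..t} ?F)"
      using integral_linear[OF d(2) bounded_linear_Re] integral_linear[OF d(2) bounded_linear_Im]
      by (simp_all add: o_def)
    moreover have "0 \<le> integral {0..t} (\<lambda>s. Re (?F s))"
      using integrable_linear[OF d(2) bounded_linear_Re] nn(2) by (intro integral_nonneg) (auto simp: o_def)
    moreover have "integral {0..t} (\<lambda>s. Im (?F s)) = integral {0..t} (\<lambda>s. 0)"
      using nn(1) by (intro integral_cong) auto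
    ultimately show "Im (sform N (dyson (Suc n) x t) u u) = 0 \<and> 0 \<le> Re (sform N (dyson (Suc n) x t) u u)"
      unfolding d(1) using psdD[OF Suc.prems(1)] by simp
  qed
qed

lemma psd_semigroup_sol:
  assumes x: "\<And>k l. cmod (x k l) \<le> c" and psd: "psd x" and t: "0 \<le> t"
  shows "psd (semigroup_sol t x)"
  unfolding psd_def
proof (intro allI conjI)
  fix N u
  have lim: "(\<lambda>n. sform N (dyson n x t) u u) \<longlonglongrightarrow> sform N (semigroup_sol t x) u u"
    unfolding sform_def by (intro tendsto_intros dyson_LIMSEQ[OF x t])
  note p = psdD[OF psd_dyson[OF psd t]]
  show "Im (sform N (semigroup_sol t x) u u) = 0"
    using tendsto_Im[OF lim] by (simp add: p LIMSEQ_const_iff)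
  show "0 \<le> Re (sform N (semigroup_sol t x) u u)"
    by (rule LIMSEQ_le_const[OF tendsto_Re[OF lim]]) (simp add: p)
qed

text \<open>Entries couple only along their own diagonal, so the image of the identity stays
  diagonal and can be compared with the identity entry by entry. An index 0 is treated apart because
  \<open>k - 1\<close> and \<open>l - 1\<close> may then coincide.\<close>

lemma dyson_idm_off_diag: "k \<noteq> l \<Longrightarrow> dyson n idm t k l = 0"
proof (induction n arbitrary: t k l)
  case (Suc n)
  have "down k l *\<^sub>R dyson n idm s (k - 1) (l - 1) = 0" for s
  proof (cases "k = 0 \<or> l = 0")
    case False
    with Suc.prems have "k - 1 \<noteq> l - 1" by auto
    then show ?thesis by (simp add: Suc.IH)
  qed auto
  then have "gain (dyson n idm s) k l = 0" for s using Suc by (simp add: gain_def)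
  then show ?case using Suc.prems by (simp add: duhamel_def diag_def)
qed simp

lemma pos_contraction_semigroup_sol:
  assumes t: "0 \<le> t" shows "pos_contraction (semigroup_sol t)"
  unfolding pos_contraction_def
proof (intro conjI allI impI)
  fix x y a b assume x: "bounded_op x" and y: "bounded_op y"
  note bx = bounded_op_entry_le[OF x] and b'y = bounded_op_entry_le[OF y]
    and bxy = bounded_op_entry_le[OF bounded_op_lincomb[OF x y, of a b]]
  show "semigroup_sol t (\<lambda>i j. a * x i j + b * y i j)
      = (\<lambda>i j. a * semigroup_sol t x i j + b * semigroup_sol t y i j)"
  proof (intro ext)
    fix k l
    have "(\<lambda>n. dyson n (\<lambda>i j. a * x i j + b * y i j) t k l)
        \<longlonglongrightarrow> a * semigroup_sol t x k l + b * semigroup_sol t y k l"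
      unfolding dyson_lincomb by (intro tendsto_intros dyson_LIMSEQ[OF bx t] dyson_LIMSEQ[OF b'y t])
    with dyson_LIMSEQ[OF bxy t]
    show "semigroup_sol t (\<lambda>i j. a * x i j + b * y i j) k l
        = a * semigroup_sol t x k l + b * semigroup_sol t y k l"
      by (rule LIMSEQ_unique)
  qed
next
  fix x assume "positive_op x"
  then have "bounded_op x" "psd x" by (simp_all add: positive_op_iff_psd)
  from psd_semigroup_sol[OF bounded_op_entry_le[OF this(1)] this(2) t] show "psd (semigroup_sol t x)" .
next
  have b1: "cmod (idm k l) \<le> 1" for k l by (simp add: diag_def)
  have "psd idm" using positive_op_diag[of "\<lambda>_. 1" 1] by (simp add: positive_op_iff_psd)
  note p = psd_semigroup_sol[OF b1 this t]
  define d where "d k = 1 - Re (semigroup_sol t idm k k)" for k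
  have "idm - semigroup_sol t idm = diag d"
  proof (intro ext)
    fix k l
    have "k \<noteq> l \<Longrightarrow> semigroup_sol t idm k l = 0"
      using dyson_idm_off_diag by (simp add: semigroup_sol_def)
    then show "(idm - semigroup_sol t idm) k l = diag d k l"
      using psd_diag(1)[OF p, of k] by (auto simp: diag_def d_def complex_eq_iff)
  qed
  moreover have "0 \<le> d k" for k
    using semigroup_sol_le[of idm 1 t k k, OF b1 t] complex_Re_le_cmod[of "semigroup_sol t idm k k"] by (simp add: d_def)
  moreover have "d k \<le> 1" for k using psd_diag(2)[OF p, of k] by (simp add: d_def)
  ultimately show "psd (idm - semigroup_sol t idm)"
    using positive_op_diag[of d 1] by (simp add: positive_op_iff_psd)
qed

lemma bounded_op_semigroup_sol: "bounded_op x \<Longrightarrow> 0 \<le> t \<Longrightarrow> bounded_op (semigroup_sol t x)"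
  by (rule bounded_opI_quadratic[OF pos_contraction_sform_bound[OF pos_contraction_semigroup_sol]])

lemma positive_map_semigroup_sol:
  assumes "0 \<le> t" shows "positive_map (semigroup_sol t)"
  using pos_contraction_semigroup_sol[OF assms] bounded_op_semigroup_sol[OF _ assms]
  unfolding positive_map_def pos_contraction_def positive_op_iff_psd by simp

end

section \<open>The integral equation\<close>

lemma sform_LIMSEQ_inprod:
  assumes "bounded_op M" "ell2 v" "ell2 u"
  shows "(\<lambda>N. sform N M v u) \<longlonglongrightarrow> inprod v (mapply M u)"
  using sform_LIMSEQ[OF assms(1), of "Abs_l2 v" "Abs_l2 u"] assms
  by (simp add: coord_Abs cinner_def coord_op_of)

lemma sq_le_vnorm:
  assumes "ell2 a" shows "sq N a \<le> (vnorm a)\<^sup>2"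
  using sum_coord_le_norm[of "Abs_l2 a" N] assms by (simp add: sq_def norm_l2_vnorm coord_Abs)

lemma vnorm_nonneg: "ell2 a \<Longrightarrow> 0 \<le> vnorm a"
  using norm_ge_zero[of "Abs_l2 a"] by (simp add: norm_l2_vnorm coord_Abs)

lemma ell2_mono: "ell2 a \<Longrightarrow> (\<And>k. cmod (b k) \<le> cmod (a k)) \<Longrightarrow> ell2 b"
  unfolding ell2_def by (rule summable_comparison_test'[where N = 0]) (auto intro: power_mono)

lemma sq_mono: "(\<And>k. cmod (b k) \<le> cmod (a k)) \<Longrightarrow> sq N b \<le> sq N a"
  unfolding sq_def by (intro sum_mono power_mono) auto

lemma domG_unit_vec: "domG (unit_vec k)"
  unfolding domG_def by (rule summable_finite[of "{k}"]) (auto simp: unit_vec_def)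

lemma ell2_domG: "domG u \<Longrightarrow> ell2 u"
  unfolding domG_def ell2_def
proof (erule summable_comparison_test'[where N = 1])
  fix n :: nat assume "1 \<le> n"
  then have "1 \<le> (real n)^4" by (simp add: one_le_power)
  then show "norm ((cmod (u n))\<^sup>2) \<le> (real n)^4 * (cmod (u n))\<^sup>2"
    using mult_right_mono[of 1 "(real n)^4" "(cmod (u n))\<^sup>2"] by simp
qed

lemma inprod_scaled_unit_vec:
  "inprod (\<lambda>n. c * unit_vec i n) (mapply M (\<lambda>n. d * unit_vec j n)) = cnj c * d * M i j"
proof -
  have "(\<lambda>n. M a n * (d * unit_vec j n)) sums (d * M a j)" for a
    using sums_finite[of "{j}" "\<lambda>n. M a n * (d * unit_vec j n)"] by (simp add: unit_vec_def mult.commute)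
  then have m: "mapply M (\<lambda>n. d * unit_vec j n) a = d * M a j" for a by (simp add: mapply_def sums_iff)
  have "(\<lambda>n. cnj (c * unit_vec i n) * w n) sums (cnj c * w i)" for w
    using sums_finite[of "{i}" "\<lambda>n. cnj (c * unit_vec i n) * w n"] by (simp add: unit_vec_def)
  then show ?thesis by (simp add: inprod_def m sums_iff mult.assoc)
qed

lemma duhamel_has_vector_derivative:
  fixes F :: "real \<Rightarrow> complex"
  assumes F: "\<And>b. continuous_on {0..b} F" and t: "0 \<le> t"
  shows "(duhamel g c F has_vector_derivative (g * duhamel g c F t + F t)) (at t within {0..})"
proof -
  let ?E = "\<lambda>t. exp (t *\<^sub>R g)" and ?H = "\<lambda>s. exp (- (s *\<^sub>R g)) * F s"
  let ?I = "\<lambda>t. c + integral {0..t} ?H"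
  have "continuous_on {0..t+1} ?H"
    by (intro continuous_on_mult continuous_on_exp_scaleR F)
  then have "((\<lambda>u. integral {0..u} ?H) has_vector_derivative ?H t) (at t within {0..t+1})"
    by (rule integral_has_vector_derivative) (use t in auto)
  then have 1: "(?I has_vector_derivative ?H t) (at t within {0..t+1})"
    using has_vector_derivative_add[OF has_vector_derivative_const[of c]] by fastforce
  have "(?E has_vector_derivative ?E t * g) (at t within {0..t+1})"
    by (rule exp_scaleR_has_vector_derivative_right)
  from has_vector_derivative_mult[OF this 1]
  have "(duhamel g c F has_vector_derivative (?E t * ?H t + ?E t * g * ?I t)) (at t within {0..t+1})"
    unfolding duhamel_def[abs_def] .
  moreover have "?E t * ?H t + ?E t * g * ?I t = g * duhamel g c F t + F t"
    by (simp add: duhamel_def mult.assoc[symmetric] flip: exp_add)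
  moreover have "at t within {0..t+1} = at t within {0..}"
    by (rule at_within_nhd[of _ "{..<t+1}"]) auto
  ultimately show ?thesis by simp
qed

context qds_parameters
begin

lemma omega_le: "1 \<le> n \<Longrightarrow> omega r n \<le> (1 + r) * (real n)\<^sup>2"
proof -
  assume "1 \<le> n"
  then have "r \<le> r * real n" using r_pos by simp
  then have "real n + r - 1 \<le> (1 + r) * real n" by (simp add: algebra_simps)
  then have "real n * (real n + r - 1) \<le> real n * ((1 + r) * real n)" by (intro mult_left_mono) auto
  then show ?thesis by (simp add: omega_def power2_eq_square mult_ac)
qed

text \<open>\<open>omega\<close> grows quadratically, so the weight \<open>n^4\<close> of
  \<open>domG\<close> controls it.\<close>

lemma ell2_L1:
  assumes "domG u" shows "ell2 (L1 r mu u)"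
  unfolding ell2_def
proof (rule summable_comparison_test'[where N = 0])
  have "summable (\<lambda>n. (real (Suc n))^4 * (cmod (u (Suc n)))\<^sup>2)"
    using assms unfolding domG_def by (subst summable_Suc_iff)
  then show "summable (\<lambda>n. mu\<^sup>2 * (1 + r) * ((real (Suc n))^4 * (cmod (u (Suc n)))\<^sup>2))"
    by (rule summable_mult)
  fix n
  have "omega r (Suc n) \<le> (1 + r) * (real (Suc n))^4"
  proof (rule order_trans[OF omega_le])
    show "(1 + r) * (real (Suc n))\<^sup>2 \<le> (1 + r) * (real (Suc n))^4"
      using r_pos by (intro mult_left_mono power_increasing) auto
  qed simp
  then have "mu\<^sup>2 * (cmod (u (Suc n)))\<^sup>2 * omega r (Suc n) \<le> mu\<^sup>2 * (cmod (u (Suc n)))\<^sup>2 * ((1 + r) * (real (Suc n))^4)"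
    by (intro mult_left_mono) auto
  then show "norm ((cmod (L1 r mu u n))\<^sup>2) \<le> mu\<^sup>2 * (1 + r) * ((real (Suc n))^4 * (cmod (u (Suc n)))\<^sup>2)"
    by (simp add: L1_def Bop_def norm_mult power_mult_distrib mult_ac del: of_nat_Suc)
qed

lemma ell2_L2:
  assumes "domG u" shows "ell2 (L2 r lam u)"
proof -
  have "summable (\<lambda>n. (cmod (L2 r lam u (Suc n)))\<^sup>2)"
  proof (rule summable_comparison_test'[where N = 1])
    show "summable (\<lambda>n. (1 + r) * (4 * (lam\<^sup>2 * ((real n)^4 * (cmod (u n))\<^sup>2))))"
      using assms unfolding domG_def by (intro summable_mult)
    fix n :: nat assume n: "1 \<le> n"
    have "omega r (Suc n) \<le> (1 + r) * (real (Suc n))\<^sup>2" by (rule omega_le) simp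
    also have "\<dots> \<le> (1 + r) * (4 * (real n)^4)"
    proof (rule mult_left_mono)
      have "(real (Suc n))\<^sup>2 \<le> (2 * real n)\<^sup>2" using n by (intro power_mono) auto
      also have "\<dots> \<le> 4 * (real n)^4" using n power_increasing[of 2 4 "real n"] by (simp add: power_mult_distrib)
      finally show "(real (Suc n))\<^sup>2 \<le> 4 * (real n)^4" .
    qed (use r_pos in simp)
    finally have "lam\<^sup>2 * (cmod (u n))\<^sup>2 * omega r (Suc n) \<le> lam\<^sup>2 * (cmod (u n))\<^sup>2 * ((1 + r) * (4 * (real n)^4))"
      by (intro mult_left_mono) auto
    then show "norm ((cmod (L2 r lam u (Suc n)))\<^sup>2) \<le> (1 + r) * (4 * (lam\<^sup>2 * ((real n)^4 * (cmod (u n))\<^sup>2)))"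
      by (simp add: L2_def Bplus_def norm_mult power_mult_distrib mult_ac)
  qed
  then show ?thesis unfolding ell2_def by (subst (asm) summable_Suc_iff)
qed

lemma loss_nonneg: "0 \<le> loss k l"
  by (simp add: loss_def)

lemma cmod_P_le: "0 \<le> t \<Longrightarrow> cmod (P t u k) \<le> cmod (u k)"
proof -
  assume t: "0 \<le> t"
  have "Re (geig r lam mu zp zm k) \<le> 0"
    using Re_rate[of k k] loss_nonneg[of k k] by (simp add: rate_def)
  then have "t * Re (geig r lam mu zp zm k) \<le> 0" using t by (rule mult_nonneg_nonpos[rotated])
  then have "exp (t * Re (geig r lam mu zp zm k)) \<le> 1" by simp
  then show ?thesis using mult_right_mono[of _ 1 "cmod (u k)"] by (simp add: Pt_def norm_mult)
qed

text \<open>For each \<open>s\<close> the sections converge since \<open>semigroup_sol s x\<close>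
  is bounded. Domination is uniform in \<open>s\<close> and \<open>N\<close>: the form bound does
  not depend on \<open>s\<close>, and the vectors are dominated by \<open>a0\<close> and
  \<open>b0\<close>.\<close>

lemma jump_integral:
  assumes x: "bounded_op x" and t: "0 \<le> t"
    and cont: "\<And>k. continuous_on {0..t} (\<lambda>s. a s k)" "\<And>k. continuous_on {0..t} (\<lambda>s. b s k)"
    and a: "\<And>s k. s \<in> {0..t} \<Longrightarrow> cmod (a s k) \<le> cmod (a0 k)" "ell2 a0"
    and b: "\<And>s k. s \<in> {0..t} \<Longrightarrow> cmod (b s k) \<le> cmod (b0 k)" "ell2 b0"
  shows "(\<lambda>s. sform N (semigroup_sol s x) (a s) (b s)) integrable_on {0..t}"
    and "(\<lambda>s. inprod (a s) (mapply (semigroup_sol s x) (b s))) integrable_on {0..t}"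
    and "(\<lambda>N. integral {0..t} (\<lambda>s. sform N (semigroup_sol s x) (a s) (b s)))
      \<longlonglongrightarrow> integral {0..t} (\<lambda>s. inprod (a s) (mapply (semigroup_sol s x) (b s)))"
proof -
  define K where "K = 2 * (2 * norm (op_of x))"
  have K: "0 \<le> K" by (simp add: K_def)
  let ?f = "\<lambda>N s. sform N (semigroup_sol s x) (a s) (b s)"
  show 1: "?f N integrable_on {0..t}" for N
    unfolding sform_def
    by (intro integrable_continuous_interval continuous_intros cont
        semigroup_sol_continuous[OF bounded_op_entry_le[OF x]])
  have 2: "(\<lambda>_. K * vnorm a0 * vnorm b0) integrable_on {0..t}"
    by (rule integrable_continuous_interval[OF continuous_on_const])
  have 3: "norm (?f N s) \<le> K * vnorm a0 * vnorm b0" if s: "s \<in> {0..t}" for N s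
  proof -
    have "norm (?f N s) \<le> K * sqrt (sq N (a s)) * sqrt (sq N (b s))"
      unfolding K_def
      by (rule sform_bound_quadratic[OF pos_contraction_sform_bound[OF pos_contraction_semigroup_sol x]])
        (use s in auto)
    also have "\<dots> \<le> K * vnorm a0 * vnorm b0"
    proof (intro mult_mono)
      have "sq N (a s) \<le> (vnorm a0)\<^sup>2" by (rule order_trans[OF sq_mono sq_le_vnorm]) (use a s in auto)
      then show "sqrt (sq N (a s)) \<le> vnorm a0" by (rule real_le_lsqrt[OF vnorm_nonneg[OF a(2)]])
      have "sq N (b s) \<le> (vnorm b0)\<^sup>2" by (rule order_trans[OF sq_mono sq_le_vnorm]) (use b s in auto)
      then show "sqrt (sq N (b s)) \<le> vnorm b0" by (rule real_le_lsqrt[OF vnorm_nonneg[OF b(2)]])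
    qed (use K vnorm_nonneg a b in auto)
    finally show ?thesis .
  qed
  have 4: "(\<lambda>N. ?f N s) \<longlonglongrightarrow> inprod (a s) (mapply (semigroup_sol s x) (b s))" if s: "s \<in> {0..t}" for s
    using s by (intro sform_LIMSEQ_inprod bounded_op_semigroup_sol x ell2_mono[OF a(2) a(1)] ell2_mono[OF b(2) b(1)]) auto
  show "(\<lambda>s. inprod (a s) (mapply (semigroup_sol s x) (b s))) integrable_on {0..t}"
    by (rule dominated_convergence(1)[OF 1 2 3 4])
  show "(\<lambda>N. integral {0..t} (?f N)) \<longlonglongrightarrow> integral {0..t} (\<lambda>s. inprod (a s) (mapply (semigroup_sol s x) (b s)))"
    by (rule dominated_convergence(2)[OF 1 2 3 4])
qed

text \<open>The identity holds on finite sections and passes to the limit term by term. It makes the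
  Dyson solution a competitor in the definition of minimality.\<close>

lemma solves_semigroup_sol: "solves_qds_eq r lam mu zp zm semigroup_sol"
  unfolding solves_qds_eq_def
proof (intro allI impI)
  fix t :: real and u v :: vec and x :: mat
  assume t: "0 \<le> t" and u: "domG u" and v: "domG v" and x: "bounded_op x"
  have c1: "continuous_on {0..t} (\<lambda>s. L1 r mu (P (t - s) w) k)" for w k
    unfolding L1_def Bop_def Pt_def by (intro continuous_intros)
  have c2: "continuous_on {0..t} (\<lambda>s. L2 r lam (P (t - s) w) k)" for w k
    unfolding L2_def Bplus_def Pt_def by (cases "k = 0") (simp_all, intro continuous_intros)
  have m1: "cmod (L1 r mu (P (t - s) w) k) \<le> cmod (L1 r mu w k)" if "s \<in> {0..t}" for s w k
    unfolding L1_def Bop_def norm_mult using that by (intro mult_left_mono cmod_P_le) auto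
  have m2: "cmod (L2 r lam (P (t - s) w) k) \<le> cmod (L2 r lam w k)" if "s \<in> {0..t}" for s w k
    unfolding L2_def Bplus_def norm_mult using that cmod_P_le[of "t - s" w "k - 1"]
    by (auto simp: norm_mult intro!: mult_left_mono)
  note j1 = jump_integral[where a = "\<lambda>s. L1 r mu (P (t - s) v)" and b = "\<lambda>s. L1 r mu (P (t - s) u)",
      OF x t c1 c1 m1 ell2_L1[OF v] m1 ell2_L1[OF u]]
  note j2 = jump_integral[where a = "\<lambda>s. L2 r lam (P (t - s) v)" and b = "\<lambda>s. L2 r lam (P (t - s) u)",
      OF x t c2 c2 m2 ell2_L2[OF v] m2 ell2_L2[OF u]]
  let ?G1 = "\<lambda>s. inprod (L1 r mu (P (t - s) v)) (mapply (semigroup_sol s x) (L1 r mu (P (t - s) u)))"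
  let ?G2 = "\<lambda>s. inprod (L2 r lam (P (t - s) v)) (mapply (semigroup_sol s x) (L2 r lam (P (t - s) u)))"
  have lu: "ell2 u" "ell2 v" using u v ell2_domG by auto
  have pu: "ell2 (P t u)" "ell2 (P t v)"
    using ell2_mono[OF lu(1), of "P t u"] ell2_mono[OF lu(2), of "P t v"] cmod_P_le[OF t] by auto
  note be = bounded_op_entry_le[OF x]
  have fin: "sform (Suc N) (semigroup_sol t x) v u = sform (Suc N) x (P t v) (P t u)
     + (integral {0..t} (\<lambda>s. sform N (semigroup_sol s x) (L1 r mu (P (t - s) v)) (L1 r mu (P (t - s) u)))
     + integral {0..t} (\<lambda>s. sform (Suc (Suc N)) (semigroup_sol s x) (L2 r lam (P (t - s) v)) (L2 r lam (P (t - s) u))))" for N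
    using sform_duhamel(1)[where N = "Suc N" and v = v and u = u,
      OF semigroup_sol_eq(1)[where x = x, OF be t] semigroup_sol_continuous[where x = x, OF be]]
    unfolding sform_gain by (simp only: integral_add[OF j1(1)[of N] j2(1)[of "Suc (Suc N)"]])
  have "(\<lambda>N. sform (Suc N) x (P t v) (P t u)
     + (integral {0..t} (\<lambda>s. sform N (semigroup_sol s x) (L1 r mu (P (t - s) v)) (L1 r mu (P (t - s) u)))
     + integral {0..t} (\<lambda>s. sform (Suc (Suc N)) (semigroup_sol s x) (L2 r lam (P (t - s) v)) (L2 r lam (P (t - s) u)))))
     \<longlonglongrightarrow> inprod (P t v) (mapply x (P t u)) + (integral {0..t} ?G1 + integral {0..t} ?G2)"
    by (intro tendsto_add LIMSEQ_Suc[OF sform_LIMSEQ_inprod[OF x pu(2,1)]] j1(3) LIMSEQ_Suc[OF LIMSEQ_Suc[OF j2(3)]])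
  moreover have "(\<lambda>N. sform (Suc N) (semigroup_sol t x) v u) \<longlonglongrightarrow> inprod v (mapply (semigroup_sol t x) u)"
    by (intro LIMSEQ_Suc[OF sform_LIMSEQ_inprod] bounded_op_semigroup_sol x t lu)
  ultimately have "inprod v (mapply (semigroup_sol t x) u)
      = inprod (P t v) (mapply x (P t u)) + (integral {0..t} ?G1 + integral {0..t} ?G2)"
    unfolding fin[symmetric] by (intro LIMSEQ_unique)
  then show "\<exists>I1 I2. (?G1 has_integral I1) {0..t} \<and> (?G2 has_integral I2) {0..t} \<and>
     inprod v (mapply (semigroup_sol t x) u) = inprod (P t v) (mapply x (P t u)) + I1 + I2"
    using integrable_integral[OF j1(2)] integrable_integral[OF j2(2)]
    by (intro exI[of _ "integral {0..t} ?G1"] exI[of _ "integral {0..t} ?G2"]) (simp add: add.assoc)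
qed

end

section \<open>Entries of the minimal semigroup\<close>

locale minimal_semigroup = qds_parameters +
  fixes T :: "real \<Rightarrow> mat \<Rightarrow> mat"
  assumes minimal: "minimal_qds r lam mu zp zm T"
begin

lemma positive_map_T: "0 \<le> t \<Longrightarrow> positive_map (T t)"
  and solves_T: "solves_qds_eq r lam mu zp zm T"
  using minimal by (simp_all add: minimal_qds_def)

lemma bounded_op_T: "0 \<le> t \<Longrightarrow> bounded_op x \<Longrightarrow> bounded_op (T t x)"
  using positive_map_T by (simp add: positive_map_def)

lemma positive_op_T: "0 \<le> t \<Longrightarrow> positive_op x \<Longrightarrow> positive_op (T t x)"
  using positive_map_T by (simp add: positive_map_def)

lemma T_lincomb: "0 \<le> t \<Longrightarrow> bounded_op x \<Longrightarrow> bounded_op y \<Longrightarrow>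
    T t (\<lambda>i j. a * x i j + b * y i j) = (\<lambda>i j. a * T t x i j + b * T t y i j)"
  using positive_map_T[of t] unfolding positive_map_def by blast

lemma T_diff: "0 \<le> t \<Longrightarrow> bounded_op x \<Longrightarrow> bounded_op y \<Longrightarrow> T t (x - y) = T t x - T t y"
  using T_lincomb[of t x y 1 "-1"] by (simp add: fun_diff_def)

lemma pos_contraction_T:
  assumes t: "0 \<le> t" shows "pos_contraction (T t)"
proof -
  have p: "positive_op idm" by (rule positive_op_diag[where C = 1]) auto
  have "\<forall>t\<ge>0. \<forall>x. positive_op x \<longrightarrow> op_le (T t x) (semigroup_sol t x)"
    using minimal positive_map_semigroup_sol solves_semigroup_sol unfolding minimal_qds_def by blast
  with t p have 1: "psd (semigroup_sol t idm - T t idm)"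
    by (simp add: op_le_def positive_op_iff_psd)
  have 2: "psd (idm - semigroup_sol t idm)"
    using pos_contraction_semigroup_sol[OF t] by (simp add: pos_contraction_def)
  have "psd (idm - T t idm)"
    unfolding psd_def
  proof (intro allI)
    fix N u
    from psdD[OF 1, of N u] psdD[OF 2, of N u]
    show "Im (sform N (idm - T t idm) u u) = 0 \<and> 0 \<le> Re (sform N (idm - T t idm) u u)"
      by (simp add: sform_diff)
  qed
  then show ?thesis
    unfolding pos_contraction_def using T_lincomb[OF t] positive_op_T[OF t] by (simp add: positive_op_iff_psd)
qed

lemma T_sform_bound:
  "0 \<le> t \<Longrightarrow> bounded_op x \<Longrightarrow> cmod (sform N (T t x) v u) \<le> 2 * (2 * norm (op_of x)) * sqrt (sq N v) * sqrt (sq N u)"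
  by (rule sform_bound_quadratic[OF pos_contraction_sform_bound[OF pos_contraction_T]])

text \<open>The constant 4 combines the factor 2 of \<open>pos_functional_bound\<close> with the
  factor 2 of polarization.\<close>

lemma T_norm_le:
  assumes "0 \<le> t" "bounded_op x" shows "norm (op_of (T t x)) \<le> 4 * norm (op_of x)"
proof (rule norm_blinfun_bound)
  fix u
  let ?w = "op_of (T t x) u"
  have b: "bounded_op (T t x)" using assms by (rule bounded_op_T)
  have "cmod (cinner ?w ?w) \<le> 4 * norm (op_of x) * norm ?w * norm u"
  proof (rule LIMSEQ_le_const2[OF tendsto_norm[OF sform_LIMSEQ[OF b]]])
    have "cmod (sform N (T t x) (coord ?w) (coord u)) \<le> 4 * norm (op_of x) * norm ?w * norm u" for N
    proof -
      have "sqrt (sq N (coord z)) \<le> norm z" for z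
        using sum_coord_le_norm[of z N] by (intro real_le_lsqrt) (auto simp: sq_def)
      then have "4 * norm (op_of x) * sqrt (sq N (coord ?w)) * sqrt (sq N (coord u)) \<le> 4 * norm (op_of x) * norm ?w * norm u"
        by (intro mult_mono) auto
      with T_sform_bound[OF assms, of N "coord ?w" "coord u"] show ?thesis by simp
    qed
    then show "\<exists>N0. \<forall>N\<ge>N0. cmod (sform N (T t x) (coord ?w) (coord u)) \<le> 4 * norm (op_of x) * norm ?w * norm u"
      by blast
  qed
  then have "norm ?w * norm ?w \<le> (4 * norm (op_of x) * norm u) * norm ?w"
    unfolding cinner_self norm_of_real by (simp add: power2_eq_square mult_ac)
  then show "norm ?w \<le> 4 * norm (op_of x) * norm u"
    by (cases "norm ?w = 0") (auto dest: mult_right_le_imp_le)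
qed simp

lemma T_entry_le: "0 \<le> t \<Longrightarrow> bounded_op x \<Longrightarrow> cmod (T t x k l) \<le> 4 * norm (op_of x)"
  by (rule order_trans[OF bounded_op_entry_le[OF bounded_op_T] T_norm_le])

text \<open>The weak equation is tested on basis vectors. \<open>P t\<close> acts on
  \<open>e_k\<close> by a scalar and the jumps move it to a neighbour, so the integrand involves
  only the two neighbouring entries of the same diagonal.\<close>

lemma T_integral_equation:
  assumes x: "bounded_op x" and t: "0 \<le> t"
  shows "T t x k l = duhamel (rate k l) (x k l) (\<lambda>s. gain (T s x) k l) t"
    and "(\<lambda>s. exp (- (s *\<^sub>R rate k l)) * gain (T s x) k l) integrable_on {0..t}"
proof -
  let ?e = "\<lambda>k t. exp (complex_of_real t * geig r lam mu zp zm k)"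
  have ee: "cnj (?e k t) * ?e l t = exp (t *\<^sub>R rate k l)" for t
    by (simp add: rate_def scaleR_conv_of_real distrib_left exp_add exp_cnj)
  have P: "P t (unit_vec k) = (\<lambda>n. ?e k t * unit_vec k n)" for t k
    by (auto simp: Pt_def unit_vec_def)
  \<comment> \<open>At \<open>k = 0\<close> the index \<open>k - 1\<close> is again 0, but the
    factor \<open>sqrt (omega r 0)\<close> vanishes.\<close>
  have L1: "L1 r mu (P t (unit_vec k)) = (\<lambda>n. (mu * sqrt (omega r k) * ?e k t) * unit_vec (k - 1) n)" for t k
    by (cases k) (auto simp: L1_def Bop_def Pt_def unit_vec_def)
  have L2: "L2 r lam (P t (unit_vec k)) = (\<lambda>n. (lam * sqrt (omega r (Suc k)) * ?e k t) * unit_vec (Suc k) n)" for t k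
  proof
    fix n show "L2 r lam (P t (unit_vec k)) n = (lam * sqrt (omega r (Suc k)) * ?e k t) * unit_vec (Suc k) n"
      by (cases n) (auto simp: L2_def Bplus_def Pt_def unit_vec_def)
  qed
  obtain I1 I2 where
    I1: "((\<lambda>s. inprod (L1 r mu (P (t - s) (unit_vec k))) (mapply (T s x) (L1 r mu (P (t - s) (unit_vec l))))) has_integral I1) {0..t}" and
    I2: "((\<lambda>s. inprod (L2 r lam (P (t - s) (unit_vec k))) (mapply (T s x) (L2 r lam (P (t - s) (unit_vec l))))) has_integral I2) {0..t}" and
    eq: "inprod (unit_vec k) (mapply (T t x) (unit_vec l)) = inprod (P t (unit_vec k)) (mapply x (P t (unit_vec l))) + I1 + I2"
    using solves_T x t domG_unit_vec unfolding solves_qds_eq_def by blast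
  have "((\<lambda>s. inprod (L1 r mu (P (t - s) (unit_vec k))) (mapply (T s x) (L1 r mu (P (t - s) (unit_vec l))))
     + inprod (L2 r lam (P (t - s) (unit_vec k))) (mapply (T s x) (L2 r lam (P (t - s) (unit_vec l))))) has_integral (I1 + I2)) {0..t}"
    by (rule has_integral_add[OF I1 I2])
  moreover have "inprod (L1 r mu (P (t - s) (unit_vec k))) (mapply (T s x) (L1 r mu (P (t - s) (unit_vec l))))
     + inprod (L2 r lam (P (t - s) (unit_vec k))) (mapply (T s x) (L2 r lam (P (t - s) (unit_vec l))))
     = exp (t *\<^sub>R rate k l) * (exp (- (s *\<^sub>R rate k l)) * gain (T s x) k l)" for s
  proof -
    have "exp (t *\<^sub>R rate k l) * exp (- (s *\<^sub>R rate k l)) = cnj (?e k (t - s)) * ?e l (t - s)"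
      unfolding ee by (simp add: scaleR_left_diff_distrib flip: exp_add)
    moreover have "inprod (L1 r mu (P (t - s) (unit_vec k))) (mapply (T s x) (L1 r mu (P (t - s) (unit_vec l))))
     + inprod (L2 r lam (P (t - s) (unit_vec k))) (mapply (T s x) (L2 r lam (P (t - s) (unit_vec l))))
      = (cnj (?e k (t - s)) * ?e l (t - s)) * gain (T s x) k l"
      unfolding L1 L2 inprod_scaled_unit_vec
      by (simp add: gain_def down_def up_def scaleR_conv_of_real power2_eq_square algebra_simps)
    ultimately show ?thesis by (simp add: mult.assoc[symmetric])
  qed
  ultimately have J: "((\<lambda>s. exp (t *\<^sub>R rate k l) * (exp (- (s *\<^sub>R rate k l)) * gain (T s x) k l)) has_integral (I1 + I2)) {0..t}"
    by simp
  from has_integral_mult_right[OF this, of "exp (- (t *\<^sub>R rate k l))"]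
  have J': "((\<lambda>s. exp (- (s *\<^sub>R rate k l)) * gain (T s x) k l) has_integral (exp (- (t *\<^sub>R rate k l)) * (I1 + I2))) {0..t}"
    by (simp add: mult.assoc[symmetric] flip: exp_add)
  then show "(\<lambda>s. exp (- (s *\<^sub>R rate k l)) * gain (T s x) k l) integrable_on {0..t}" by blast
  have "T t x k l = exp (t *\<^sub>R rate k l) * x k l + (I1 + I2)"
    using eq unfolding P inprod_scaled_unit_vec ee by (simp add: inprod_unit_vec mapply_unit_vec)
  also have "I1 + I2 = exp (t *\<^sub>R rate k l) * (exp (- (t *\<^sub>R rate k l)) * (I1 + I2))"
    by (simp add: mult.assoc[symmetric] flip: exp_add)
  finally show "T t x k l = duhamel (rate k l) (x k l) (\<lambda>s. gain (T s x) k l) t"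
    by (simp add: duhamel_def integral_unique[OF J'] distrib_left)
qed

lemma T_0: "bounded_op x \<Longrightarrow> T 0 x = x"
  by (intro ext) (simp add: T_integral_equation(1) duhamel_def)

text \<open>The equation supplies only integrability in \<open>s\<close>; through the integral this
  yields continuity of the entries, which in turn permits differentiation.\<close>

lemma T_continuous:
  assumes x: "bounded_op x" shows "continuous_on {0..b} (\<lambda>t. T t x k l)"
proof (cases "0 \<le> b")
  case True
  have "continuous_on {0..b} (duhamel (rate k l) (x k l) (\<lambda>s. gain (T s x) k l))"
    by (rule continuous_on_duhamel[OF T_integral_equation(2)[OF x True]])
  then show ?thesis
    by (rule continuous_on_eq) (rule T_integral_equation(1)[OF x, symmetric], simp)
qed simp

lemma T_has_vector_derivative:
  assumes x: "bounded_op x" and t: "0 \<le> t"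
  shows "((\<lambda>t. T t x k l) has_vector_derivative (rate k l * T t x k l + gain (T t x) k l)) (at t within {0..})"
proof -
  have "(duhamel (rate k l) (x k l) (\<lambda>s. gain (T s x) k l) has_vector_derivative
      (rate k l * duhamel (rate k l) (x k l) (\<lambda>s. gain (T s x) k l) t + gain (T t x) k l)) (at t within {0..})"
    by (intro duhamel_has_vector_derivative gain_continuous T_continuous x t)
  then show ?thesis
    unfolding T_integral_equation(1)[OF x t, of k l, symmetric]
    by (rule has_vector_derivative_transform[rotated 2]) (use t in \<open>auto intro: T_integral_equation(1)[OF x]\<close>)
qed

end

section \<open>Bounded solutions\<close>

lemma compress_tendsto:
  assumes f: "pos_functional f" and ent: "\<And>i j. ((\<lambda>t. y t i j) \<longlongrightarrow> z i j) F"
  shows "((\<lambda>t. f (compress M (y t))) \<longlongrightarrow> f (compress M z)) F"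
proof -
  have "f (compress M w) = (\<Sum>i<M. \<Sum>j<M. w i j * f (munit i j))" for w
  proof -
    have "f (compress M w) = (\<Sum>i<M. \<Sum>j<M. compress M w i j * f (munit i j))"
      by (rule finite_matrix_functional(2)[OF f]) (auto simp: compress_def)
    then show ?thesis by (simp add: compress_def)
  qed
  then show ?thesis by (simp only:) (intro tendsto_intros ent)
qed

text \<open>Replacing an operator by a corner costs an error that depends on it only through its
  norm. Bounded families can thus be compared on corners, where \<open>f\<close> is a finite
  combination of entries.\<close>

lemma pos_functional_tendsto:
  assumes f: "pos_functional f" and lim: "(\<lambda>M. f (proj M)) \<longlonglongrightarrow> f idm"
    and y: "\<forall>\<^sub>F t in F. bounded_op (y t) \<and> norm (op_of (y t)) \<le> K"
    and z: "bounded_op z" and ent: "\<And>i j. ((\<lambda>t. y t i j) \<longlongrightarrow> z i j) F" and K: "0 \<le> K"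
  shows "((\<lambda>t. f (y t)) \<longlongrightarrow> f z) F"
proof -
  define K' where "K' = norm (op_of z)"
  let ?e = "\<lambda>n. inverse (real (Suc n))"
  let ?q = "\<lambda>M. Re (f idm) - Re (f (proj M))"
  have one: "Re (f idm) \<ge> 0"
  proof -
    have "positive_op idm" by (rule positive_op_diag[where C = 1]) auto
    then show ?thesis by (rule pos_functionalD(3)[OF f])
  qed
  \<comment> \<open>The corner is chosen from \<open>f\<close> and \<open>n\<close> alone, before
    any operator is considered.\<close>
  have "\<exists>M. (1 + 1 / ?e n) * ?q M < ?e n" for n
  proof -
    have "(\<lambda>M. (1 + 1 / ?e n) * ?q M) \<longlonglongrightarrow> (1 + 1 / ?e n) * (Re (f idm) - Re (f idm))"
      by (intro tendsto_intros lim)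
    then have "\<forall>\<^sub>F M in sequentially. (1 + 1 / ?e n) * ?q M < ?e n"
      by (intro order_tendstoD(2)) auto
    then show ?thesis by (auto simp: eventually_sequentially)
  qed
  then obtain M where M: "\<And>n. (1 + 1 / ?e n) * ?q (M n) < ?e n" by metis
  let ?r = "\<lambda>n. ?e n * Re (f idm) + ?e n"
  have err: "cmod (f w - f (compress (M n) w)) \<le> 2 * (c * ?r n)" if "bounded_op w" "norm (op_of w) \<le> c" for w n c
  proof -
    have r: "?e n * Re (f idm) + (1 + 1 / ?e n) * ?q (M n) \<le> ?r n" using M[of n] by linarith
    have "cmod (f w - f (compress (M n) w)) \<le> 2 * (norm (op_of w) * (?e n * Re (f idm) + (1 + 1 / ?e n) * ?q (M n)))"
      by (rule compress_error[OF f that(1)]) simp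
    also have "\<dots> \<le> 2 * (norm (op_of w) * ?r n)" by (intro mult_left_mono r) auto
    also have "\<dots> \<le> 2 * (c * ?r n)"
      using that(2) one by (intro mult_left_mono mult_right_mono) auto
    finally show ?thesis .
  qed
  have "((\<lambda>t. cmod (f (y t) - f z)) \<longlongrightarrow> 0) F"
  proof (rule tendsto_zero_by_bounds)
    fix n
    show "\<forall>\<^sub>F t in F. cmod (f (y t) - f z)
      \<le> 2 * (K * ?r n) + (cmod (f (compress (M n) (y t)) - f (compress (M n) z)) + 2 * (K' * ?r n))"
      using y
    proof eventually_elim
      case (elim t)
      have "cmod (f (y t) - f z) \<le> cmod (f (y t) - f (compress (M n) (y t)))
         + (cmod (f (compress (M n) (y t)) - f (compress (M n) z)) + cmod (f z - f (compress (M n) z)))"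
        using norm_triangle_ineq[of "f (y t) - f (compress (M n) (y t))" "f (compress (M n) (y t)) - f z"]
          norm_triangle_ineq4[of "f (compress (M n) (y t)) - f (compress (M n) z)" "f z - f (compress (M n) z)"]
        by simp
      also have "\<dots> \<le> 2 * (K * ?r n) + (cmod (f (compress (M n) (y t)) - f (compress (M n) z)) + 2 * (K' * ?r n))"
        using elim z by (intro add_mono err order_refl) (auto simp: K'_def)
      finally show ?case .
    qed
    show "((\<lambda>t. 2 * (K * ?r n) + (cmod (f (compress (M n) (y t)) - f (compress (M n) z)) + 2 * (K' * ?r n)))
      \<longlongrightarrow> 2 * (K * ?r n) + (cmod (f (compress (M n) z) - f (compress (M n) z)) + 2 * (K' * ?r n))) F"
      by (intro tendsto_intros compress_tendsto[OF f] ent)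
  next
    have r: "?r \<longlonglongrightarrow> 0 * Re (f idm) + 0"
      by (intro tendsto_intros LIMSEQ_inverse_real_of_nat)
    have "(\<lambda>n. 2 * (K * ?r n) + (0 + 2 * (K' * ?r n))) \<longlonglongrightarrow> 2 * (K * (0 * Re (f idm) + 0)) + (0 + 2 * (K' * (0 * Re (f idm) + 0)))"
      by (intro tendsto_add tendsto_mult tendsto_const r)
    then show "(\<lambda>n. 2 * (K * ?r n) + (cmod (f (compress (M n) z) - f (compress (M n) z)) + 2 * (K' * ?r n))) \<longlonglongrightarrow> 0"
      by simp
  qed simp
  then have "((\<lambda>t. f (y t) - f z) \<longlongrightarrow> 0) F" by (simp only: tendsto_norm_zero_iff)
  then show ?thesis by (rule LIM_zero_cancel)
qed

section \<open>Square integrability and decay\<close>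

lemma vector_derivative_lipschitz:
  fixes f :: "real \<Rightarrow> 'a::real_normed_vector"
  assumes d: "\<And>t. 0 \<le> t \<Longrightarrow> (f has_vector_derivative f' t) (at t within {0..})"
    and B: "\<And>t. 0 \<le> t \<Longrightarrow> norm (f' t) \<le> B" and st: "0 \<le> s" "0 \<le> t"
  shows "norm (f t - f s) \<le> B * \<bar>t - s\<bar>"
proof -
  have "norm (f t - f s) \<le> B * norm (t - s)"
  proof (rule differentiable_bound[where S = "{0..}" and f' = "\<lambda>t h. h *\<^sub>R f' t"])
    have "0 \<le> B" using order_trans[OF norm_ge_zero B[of 0]] by simp
    then show "onorm (\<lambda>h. h *\<^sub>R f' u) \<le> B" if "u \<in> {0..}" for u
      using B[of u] that by (intro onorm_bound) (auto simp: mult.commute[of B] mult_left_mono)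
  qed (use d st in \<open>auto simp: has_vector_derivative_def\<close>)
  then show ?thesis by simp
qed

text \<open>A large value persists for a fixed time by the Lipschitz bound and adds a fixed amount
  to an integral that is monotone and bounded; late in time no such increment is left.\<close>

lemma Barbalat_square_integrable:
  fixes z :: "real \<Rightarrow> complex"
  assumes lip: "\<And>s t. 0 \<le> s \<Longrightarrow> 0 \<le> t \<Longrightarrow> cmod (z t - z s) \<le> L * \<bar>t - s\<bar>"
    and bd: "\<And>t. 0 \<le> t \<Longrightarrow> cmod (z t) \<le> K"
    and int: "\<And>t. 0 \<le> t \<Longrightarrow> integral {0..t} (\<lambda>s. (cmod (z s))\<^sup>2) \<le> C"
  shows "(z \<longlongrightarrow> 0) at_top"
proof -
  define f where "f s = (cmod (z s))\<^sup>2" for s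
  \<comment> \<open>\<open>2 * K * L\<close> is a Lipschitz constant of the squared modulus; the
    summand 1 keeps it positive.\<close>
  define M where "M = 2 * K * L + 1"
  have K: "0 \<le> K" using order_trans[OF norm_ge_zero bd[of 0]] by simp
  have L: "0 \<le> L" using order_trans[OF norm_ge_zero lip[of 0 1]] by simp
  have M: "0 < M" using K L by (simp add: M_def add_nonneg_pos)
  have lipf: "f t - M * (s - t) \<le> f s" if "0 \<le> t" "t \<le> s" for s t
  proof -
    have "f t - f s = (cmod (z t) - cmod (z s)) * (cmod (z t) + cmod (z s))"
      by (simp add: f_def power2_eq_square algebra_simps)
    also have "\<dots> \<le> (L * (s - t)) * (K + K)"
    proof (rule mult_mono)
      show "cmod (z t) - cmod (z s) \<le> L * (s - t)"
        using norm_triangle_ineq2[of "z t" "z s"] lip[of s t] that by simp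
      show "cmod (z t) + cmod (z s) \<le> K + K" using bd that by (intro add_mono) auto
    qed (use L that in auto)
    also have "\<dots> \<le> M * (s - t)" using that by (simp add: M_def algebra_simps)
    finally show ?thesis by simp
  qed
  have "L-lipschitz_on {0..} z"
    using L lip by (intro lipschitz_onI) (auto simp: dist_norm)
  then have "continuous_on {0..} z" by (rule lipschitz_on_continuous_on)
  then have cz: "continuous_on {a..b} z" if "0 \<le> a" for a b
    by (rule continuous_on_subset) (use that in auto)
  then have cf: "continuous_on {a..b} f" if "0 \<le> a" for a b
    unfolding f_def using that by (intro continuous_intros)
  then have fi: "f integrable_on {a..b}" if "0 \<le> a" for a b
    using that by (intro integrable_continuous_interval)
  define F where "F t = integral {0..t} f" for t
  have FC: "F t \<le> C" if "0 \<le> t" for t using int[OF that] by (simp add: F_def f_def[abs_def])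
  have Fadd: "F s = F t + integral {t..s} f" if "0 \<le> t" "t \<le> s" for s t
    unfolding F_def using that by (intro Henstock_Kurzweil_Integration.integral_combine[symmetric] fi) auto
  have Fmono: "F t \<le> F s" if "0 \<le> t" "t \<le> s" for s t
    using Fadd[OF that] integral_nonneg[OF fi[OF that(1)], of s] by (simp add: f_def)
  have grow: "F t + \<delta> * (f t - M * \<delta>) \<le> F (t + \<delta>)" if "0 \<le> t" "0 \<le> \<delta>" for t \<delta>
  proof -
    have "integral {t..t+\<delta>} (\<lambda>_. f t - M * \<delta>) \<le> integral {t..t+\<delta>} f"
    proof (rule integral_le)
      fix s assume s: "s \<in> {t..t+\<delta>}"
      then have "M * (s - t) \<le> M * \<delta>" using M by (intro mult_left_mono) auto
      with lipf[of t s] s that show "f t - M * \<delta> \<le> f s" by simp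
    qed (use that fi in \<open>auto intro: integrable_continuous_interval\<close>)
    then show ?thesis using Fadd[of t "t + \<delta>"] that by simp
  qed
  have bdd: "bdd_above (F ` {0..})" using FC by (intro bdd_aboveI2[where M = C]) auto
  have "(f \<longlongrightarrow> 0) at_top"
  proof (rule tendstoI)
    fix e :: real assume e: "0 < e"
    \<comment> \<open>Over a time \<open>\<delta>\<close> the function falls by at most
      \<open>e / 2\<close>.\<close>
    define \<delta> where "\<delta> = e / (2 * M)"
    have \<delta>: "0 < \<delta>" "M * \<delta> = e / 2" using e M by (simp_all add: \<delta>_def)
    obtain T where T: "0 \<le> T" "Sup (F ` {0..}) - \<delta> * (e / 2) < F T"
      using less_cSup_iff[OF _ bdd, of "Sup (F ` {0..}) - \<delta> * (e / 2)"] \<delta> e by auto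
    have "f t < e" if "T \<le> t" for t
    proof -
      have t: "0 \<le> t" using T that by simp
      have "F (t + \<delta>) \<le> Sup (F ` {0..})" using t \<delta> by (intro cSup_upper bdd) auto
      moreover have "F t + \<delta> * (f t - e / 2) \<le> F (t + \<delta>)"
        using grow[OF t, of \<delta>] \<delta> by simp
      ultimately have "\<delta> * (f t - e / 2) < \<delta> * (e / 2)"
        using Fmono[OF T(1) that] T(2) by linarith
      then show ?thesis using \<delta>(1) by simp
    qed
    then show "\<forall>\<^sub>F t in at_top. dist (f t) 0 < e"
      unfolding eventually_at_top_linorder by (intro exI[of _ T]) (simp add: f_def)
  qed
  from tendsto_real_sqrt[OF this] have "((\<lambda>t. cmod (z t)) \<longlongrightarrow> 0) at_top" by (simp add: f_def)
  then show ?thesis by (simp only: tendsto_norm_zero_iff)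
qed

text \<open>All that the asymptotic argument uses of the semigroup: the linear system for the
  entries and one bound for all entries and times.\<close>

locale bounded_solution = qds_parameters +
  fixes X :: "real \<Rightarrow> mat" and K :: real
  assumes X_deriv: "\<And>t k l. 0 \<le> t \<Longrightarrow>
      ((\<lambda>t. X t k l) has_vector_derivative (rate k l * X t k l + gain (X t) k l)) (at t within {0..})"
    and X_le: "\<And>t k l. 0 \<le> t \<Longrightarrow> cmod (X t k l) \<le> K"

context qds_parameters
begin

definition nu :: real where "nu = lam / mu"

lemma nu_pos: "0 < nu" and nu_less_1: "nu < 1" and nu_sq: "nu\<^sup>2 * mu\<^sup>2 = lam\<^sup>2" and nu_sq_less_1: "nu\<^sup>2 < 1"
proof -
  show n: "0 < nu" "nu < 1" "nu\<^sup>2 * mu\<^sup>2 = lam\<^sup>2"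
    using lam_pos mu_pos lam_less_mu by (simp_all add: nu_def power_divide)
  show "nu\<^sup>2 < 1" using n by (simp add: power_less_one_iff)
qed

lemma nu_geometric: "(\<lambda>k. nu ^ (2 * k)) sums (1 / (1 - nu\<^sup>2))"
  unfolding power_mult using nu_sq_less_1 by (intro geometric_sums) simp

lemma nu_summable:
  fixes x :: "nat \<Rightarrow> complex"
  assumes "\<And>k. cmod (x k) \<le> C" shows "summable (\<lambda>k. nu ^ (2 * k) *\<^sub>R x k)"
proof (rule summable_comparison_test'[where N = 0])
  show "summable (\<lambda>k. C * nu ^ (2 * k))" using nu_geometric by (intro summable_mult) (simp add: sums_iff)
  show "norm (nu ^ (2 * k) *\<^sub>R x k) \<le> C * nu ^ (2 * k)" for k
    using mult_left_mono[OF assms[of k], of "nu ^ (2 * k)"] nu_pos by (simp add: mult.commute)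
qed

text \<open>Each linear factor of \<open>omega\<close> is paired with one of the two factors
  \<open>nu ^ n\<close>.\<close>

lemma nu_omega_LIMSEQ: "(\<lambda>n. nu ^ (2 * n) * omega r (Suc n)) \<longlonglongrightarrow> 0"
proof -
  have 1: "(\<lambda>n. real n * nu ^ n) \<longlonglongrightarrow> 0"
    using powser_times_n_limit_0[of nu] nu_pos nu_less_1 by simp
  have 2: "(\<lambda>n. nu ^ n) \<longlonglongrightarrow> 0" using nu_pos nu_less_1 by (intro LIMSEQ_realpow_zero) auto
  have "(\<lambda>n. (real n * nu ^ n + nu ^ n) * (real n * nu ^ n + r * nu ^ n)) \<longlonglongrightarrow> (0 + 0) * (0 + r * 0)"
    by (intro tendsto_intros 1 2)
  moreover have "(real n * nu ^ n + nu ^ n) * (real n * nu ^ n + r * nu ^ n) = nu ^ (2 * n) * omega r (Suc n)" for n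
    unfolding mult_2 power_add by (simp add: omega_def algebra_simps)
  ultimately show ?thesis by simp
qed

lemma rate_diag: "rate k k = - complex_of_real (lam\<^sup>2 * omega r (Suc k) + mu\<^sup>2 * omega r k)"
proof -
  have "Im (rate k k) = 0" by (simp add: rate_def)
  moreover have "Re (rate k k) = - (lam\<^sup>2 * omega r (Suc k) + mu\<^sup>2 * omega r k)" by (simp add: Re_rate loss_def)
  ultimately show ?thesis by (simp add: complex_eq_iff)
qed

text \<open>Detailed balance \<open>\<nu>\<^sup>2 \<mu>\<^sup>2 = \<lambda>\<^sup>2\<close> makes the weighted sum telescope.\<close>
lemma weighted_diag_sum:
  "(\<Sum>k<Suc n. nu ^ (2 * k) *\<^sub>R (rate k k * x k k + gain x k k))
     = (lam\<^sup>2 * (nu ^ (2 * n) * omega r (Suc n))) *\<^sub>R (x (Suc n) (Suc n) - x n n)"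
proof (induction n)
  case 0
  then show ?case by (simp add: rate_diag gain_def up_def scaleR_conv_of_real algebra_simps)
next
  case (Suc n)
  let ?w = "nu ^ (2 * n)" and ?o = "\<lambda>k. omega r k"
  have pw: "nu ^ (2 * Suc n) = nu\<^sup>2 * ?w" by (simp add: power2_eq_square)
  have mw: "nu ^ (2 * Suc n) * mu\<^sup>2 = lam\<^sup>2 * ?w" unfolding pw using nu_sq by (simp add: mult_ac)
  have "nu ^ (2 * Suc n) *\<^sub>R (rate (Suc n) (Suc n) * x (Suc n) (Suc n) + gain x (Suc n) (Suc n))
     = - ((lam\<^sup>2 * (nu ^ (2 * Suc n) * ?o (Suc (Suc n))) + (nu ^ (2 * Suc n) * mu\<^sup>2) * ?o (Suc n)) *\<^sub>R x (Suc n) (Suc n))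
       + ((nu ^ (2 * Suc n) * mu\<^sup>2) * ?o (Suc n)) *\<^sub>R x n n
       + (lam\<^sup>2 * (nu ^ (2 * Suc n) * ?o (Suc (Suc n)))) *\<^sub>R x (Suc (Suc n)) (Suc (Suc n))"
    by (simp add: rate_diag gain_def up_def down_def scaleR_conv_of_real algebra_simps del: power_Suc)
  then have "nu ^ (2 * Suc n) *\<^sub>R (rate (Suc n) (Suc n) * x (Suc n) (Suc n) + gain x (Suc n) (Suc n))
     = (lam\<^sup>2 * (nu ^ (2 * Suc n) * ?o (Suc (Suc n)))) *\<^sub>R (x (Suc (Suc n)) (Suc (Suc n)) - x (Suc n) (Suc n))
      - (lam\<^sup>2 * (?w * ?o (Suc n))) *\<^sub>R (x (Suc n) (Suc n) - x n n)"
    unfolding mw by (simp add: scaleR_left_distrib scaleR_right_diff_distrib mult.assoc)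
  then show ?case using Suc.IH by (simp only: sum.lessThan_Suc[of _ "Suc n"]) simp
qed

end

context bounded_solution
begin

lemma K_nonneg: "0 \<le> K" using order_trans[OF norm_ge_zero X_le[of 0]] by simp

lemma X_lipschitz:
  assumes "0 \<le> s" "0 \<le> t"
  shows "cmod (X t k l - X s k l) \<le> ((cmod (rate k l) + (down k l + up k l)) * K) * \<bar>t - s\<bar>"
proof (rule vector_derivative_lipschitz[OF X_deriv _ assms])
  fix t :: real assume t: "0 \<le> t"
  have "cmod (gain (X t) k l) \<le> gain (\<lambda>_ _. K) k l" by (intro norm_gain_le X_le t)
  moreover have "cmod (rate k l * X t k l) \<le> cmod (rate k l) * K"
    unfolding norm_mult by (intro mult_left_mono X_le t) auto
  ultimately show "cmod (rate k l * X t k l + gain (X t) k l) \<le> (cmod (rate k l) + (down k l + up k l)) * K"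
    using norm_triangle_ineq[of "rate k l * X t k l" "gain (X t) k l"] by (simp add: gain_def algebra_simps)
qed auto

lemma X_continuous: "continuous_on {0..} (\<lambda>t. X t k l)"
  by (rule continuous_on_vector_derivative) (use X_deriv in auto)

text \<open>The n-th partial mean has a derivative of size at most \<open>?a n * (2 * K)\<close> at
  all times, so its change over the fixed interval vanishes as \<open>n\<close> grows. The infinite
  series itself is never differentiated.\<close>

lemma mean_conserved:
  assumes t: "0 \<le> t"
  shows "(\<Sum>k. nu ^ (2 * k) *\<^sub>R X t k k) = (\<Sum>k. nu ^ (2 * k) *\<^sub>R X 0 k k)"
proof -
  define m where "m n t = (\<Sum>k<Suc n. nu ^ (2 * k) *\<^sub>R X t k k)" for n t
  let ?a = "\<lambda>n. lam\<^sup>2 * (nu ^ (2 * n) * omega r (Suc n))"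
  have a: "0 \<le> ?a n" for n using nu_pos by simp
  have mle: "norm (m n t - m n 0) \<le> (?a n * (2 * K)) * \<bar>t - 0\<bar>" for n
  proof (rule vector_derivative_lipschitz)
    fix s :: real assume s: "0 \<le> s"
    have D: "((\<lambda>t. nu ^ (2 * k) *\<^sub>R X t k k) has_vector_derivative
        nu ^ (2 * k) *\<^sub>R (rate k k * X s k k + gain (X s) k k)) (at s within {0..})" for k
      by (rule bounded_linear.has_vector_derivative[OF bounded_linear_scaleR_right X_deriv[OF s]])
    show "(m n has_vector_derivative (?a n *\<^sub>R (X s (Suc n) (Suc n) - X s n n))) (at s within {0..})"
      unfolding m_def[abs_def] weighted_diag_sum[symmetric]
      by (intro has_vector_derivative_sum D)
    have "cmod (X s (Suc n) (Suc n) - X s n n) \<le> 2 * K"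
      using norm_triangle_ineq4[of "X s (Suc n) (Suc n)" "X s n n"] X_le[OF s, of "Suc n" "Suc n"] X_le[OF s, of n n] by linarith
    then show "norm (?a n *\<^sub>R (X s (Suc n) (Suc n) - X s n n)) \<le> ?a n * (2 * K)"
      unfolding norm_scaleR abs_of_nonneg[OF a] by (intro mult_left_mono a)
  qed (use t in auto)
  have "(\<lambda>n. (?a n * (2 * K)) * \<bar>t - 0\<bar>) \<longlonglongrightarrow> (lam\<^sup>2 * 0 * (2 * K)) * \<bar>t - 0\<bar>"
    by (intro tendsto_intros nu_omega_LIMSEQ)
  then have "(\<lambda>n. (?a n * (2 * K)) * \<bar>t - 0\<bar>) \<longlonglongrightarrow> 0" by (simp only: mult_zero_left mult_zero_right)
  then have m0: "(\<lambda>n. m n t - m n 0) \<longlonglongrightarrow> 0"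
    by (rule Lim_null_comparison[OF always_eventually[OF allI[OF mle]]])
  have mlim: "(\<lambda>n. m n s) \<longlonglongrightarrow> (\<Sum>k. nu ^ (2 * k) *\<^sub>R X s k k)" if "0 \<le> s" for s
    unfolding m_def using summable_LIMSEQ[OF nu_summable[OF X_le[OF that]]] by (rule LIMSEQ_Suc)
  have "(\<lambda>n. m n t - m n 0) \<longlonglongrightarrow> (\<Sum>k. nu ^ (2 * k) *\<^sub>R X t k k) - (\<Sum>k. nu ^ (2 * k) *\<^sub>R X 0 k k)"
    by (intro tendsto_diff mlim t order_refl)
  from LIMSEQ_unique[OF this m0]
  have "(\<Sum>k. nu ^ (2 * k) *\<^sub>R X t k k) - (\<Sum>k. nu ^ (2 * k) *\<^sub>R X 0 k k) = 0" .
  then show ?thesis by simp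
qed

end

section \<open>Energy dissipation along a diagonal\<close>

context qds_parameters
begin

definition cA :: "nat \<Rightarrow> nat \<Rightarrow> real" where
  "cA k l = (omega r k + omega r l) / 2"

definition cB :: "nat \<Rightarrow> nat \<Rightarrow> real" where
  "cB k l = sqrt (omega r k) * sqrt (omega r l)"

lemma cB_le_cA: "cB k l \<le> cA k l" and cB_nonneg: "0 \<le> cB k l" and cA_nonneg: "0 \<le> cA k l"
  using sqrt_omega_mult_le by (simp_all add: cA_def cB_def)

lemma down_eq: "down k l = mu\<^sup>2 * cB k l" and up_eq: "up k l = lam\<^sup>2 * cB (Suc k) (Suc l)"
  and loss_eq: "loss k l = lam\<^sup>2 * cA (Suc k) (Suc l) + mu\<^sup>2 * cA k l"
  by (simp_all add: down_def up_def loss_def cA_def cB_def)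

lemma inner_complex_mult_self: "inner z (g * z) = Re g * (cmod z)\<^sup>2" for z g :: complex
  unfolding inner_complex_def cmod_power2 by (simp add: power2_eq_square algebra_simps)

text \<open>Energy lost on the edge between two neighbours \<open>y\<close>, \<open>z\<close> of a
  diagonal; with \<open>A\<close>, \<open>B\<close> for \<open>cA\<close>, \<open>cB\<close> it
  equals \<open>B |y - z|^2 + (A - B) (|y|^2 + |z|^2)\<close>.\<close>

definition dissipation :: "nat \<Rightarrow> nat \<Rightarrow> mat \<Rightarrow> real" where
  "dissipation k l x = cA (Suc k) (Suc l) * ((cmod (x k l))\<^sup>2 + (cmod (x (Suc k) (Suc l)))\<^sup>2)
     - 2 * cB (Suc k) (Suc l) * inner (x k l) (x (Suc k) (Suc l))"

text \<open>The first bound serves the main diagonal, where both means agree and only increments are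
  damped; the second serves the other diagonals, where the gap damps the entries.\<close>

lemma dissipation_ge:
  shows "cB (Suc k) (Suc l) * (cmod (x k l - x (Suc k) (Suc l)))\<^sup>2 \<le> dissipation k l x"
    and "(cA (Suc k) (Suc l) - cB (Suc k) (Suc l)) * (cmod (x k l))\<^sup>2 \<le> dissipation k l x"
    and "0 \<le> dissipation k l x"
proof -
  let ?A = "cA (Suc k) (Suc l)" and ?B = "cB (Suc k) (Suc l)" and ?y = "x k l" and ?z = "x (Suc k) (Suc l)"
  have d: "(cmod (?y - ?z))\<^sup>2 = (cmod ?y)\<^sup>2 + (cmod ?z)\<^sup>2 - 2 * inner ?y ?z"
    by (simp add: power2_norm_eq_inner inner_diff_left inner_diff_right inner_commute)
  have eq: "dissipation k l x = ?B * (cmod (?y - ?z))\<^sup>2 + (?A - ?B) * (cmod ?y)\<^sup>2 + (?A - ?B) * (cmod ?z)\<^sup>2"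
    unfolding d dissipation_def by (simp add: algebra_simps)
  have p: "0 \<le> ?B * (cmod (?y - ?z))\<^sup>2" "0 \<le> (?A - ?B) * (cmod ?y)\<^sup>2" "0 \<le> (?A - ?B) * (cmod ?z)\<^sup>2"
    using cB_le_cA[of "Suc k" "Suc l"] cB_nonneg by (auto intro!: mult_nonneg_nonneg)
  show "?B * (cmod (?y - ?z))\<^sup>2 \<le> dissipation k l x" "(?A - ?B) * (cmod ?y)\<^sup>2 \<le> dissipation k l x"
    "0 \<le> dissipation k l x" using p unfolding eq by linarith+
qed

text \<open>The loss at a site is shared between its two edges. By detailed balance both shares of
  an edge carry the weight of its lower end and combine to \<open>dissipation\<close>; the last edge
  is only half covered and leaves the remainder. Starting at the border means no gain from
  below.\<close>

lemma energy_inequality: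
  fixes x :: mat
  assumes ij: "i = 0 \<or> j = 0"
  defines "y \<equiv> \<lambda>k. x (i + k) (j + k)"
  shows "(\<Sum>k<Suc n. nu ^ (2 * k) * (2 * inner (y k) (rate (i + k) (j + k) * y k + gain x (i + k) (j + k))))
    \<le> - 2 * (\<Sum>k<n. lam\<^sup>2 * nu ^ (2 * k) * dissipation (i + k) (j + k) x)
      + 2 * (lam\<^sup>2 * nu ^ (2 * n)) * (cB (i + Suc n) (j + Suc n) * inner (y n) (y (Suc n)) - cA (i + Suc n) (j + Suc n) * (cmod (y n))\<^sup>2)"
proof (induction n)
  case 0
  have "inner (y 0) (rate i j * y 0 + gain x i j) = - (lam\<^sup>2 * cA (Suc i) (Suc j) + mu\<^sup>2 * cA i j) * (cmod (y 0))\<^sup>2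
      + lam\<^sup>2 * cB (Suc i) (Suc j) * inner (y 0) (y (Suc 0))"
    using ij by (auto simp: inner_add_right inner_complex_mult_self Re_rate loss_eq gain_def up_eq y_def)
  \<comment> \<open>The loss share of the first site that belongs to no edge; dropping it is the
    only inequality.\<close>
  moreover have "0 \<le> mu\<^sup>2 * cA i j * (cmod (y 0))\<^sup>2" by (intro mult_nonneg_nonneg) (auto simp: cA_nonneg)
  ultimately show ?case by (simp add: algebra_simps)
next
  case (Suc n)
  let ?w = "nu ^ (2 * n)" and ?w' = "nu ^ (2 * Suc n)"
  have pw: "?w' = nu\<^sup>2 * ?w" by (simp add: power2_eq_square)
  have mw: "?w' * mu\<^sup>2 = lam\<^sup>2 * ?w" unfolding pw using nu_sq by (simp add: mult_ac)
  let ?A = "cA (i + Suc n) (j + Suc n)" and ?B = "cB (i + Suc n) (j + Suc n)"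
  let ?A' = "cA (i + Suc (Suc n)) (j + Suc (Suc n))" and ?B' = "cB (i + Suc (Suc n)) (j + Suc (Suc n))"
  have e: "inner (y (Suc n)) (rate (i + Suc n) (j + Suc n) * y (Suc n) + gain x (i + Suc n) (j + Suc n))
     = - (lam\<^sup>2 * ?A' + mu\<^sup>2 * ?A) * (cmod (y (Suc n)))\<^sup>2 + mu\<^sup>2 * ?B * inner (y (Suc n)) (y n)
       + lam\<^sup>2 * ?B' * inner (y (Suc n)) (y (Suc (Suc n)))"
    by (simp add: inner_add_right inner_complex_mult_self Re_rate loss_eq gain_def up_eq down_eq y_def)
  have "?w' * (2 * inner (y (Suc n)) (rate (i + Suc n) (j + Suc n) * y (Suc n) + gain x (i + Suc n) (j + Suc n)))
     = 2 * (lam\<^sup>2 * ?w') * (?B' * inner (y (Suc n)) (y (Suc (Suc n))) - ?A' * (cmod (y (Suc n)))\<^sup>2)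
       + 2 * (?w' * mu\<^sup>2) * (?B * inner (y (Suc n)) (y n) - ?A * (cmod (y (Suc n)))\<^sup>2)"
    unfolding e by (simp add: algebra_simps del: power_Suc)
  then have step: "?w' * (2 * inner (y (Suc n)) (rate (i + Suc n) (j + Suc n) * y (Suc n) + gain x (i + Suc n) (j + Suc n)))
     = 2 * (lam\<^sup>2 * ?w') * (?B' * inner (y (Suc n)) (y (Suc (Suc n))) - ?A' * (cmod (y (Suc n)))\<^sup>2)
       + 2 * (lam\<^sup>2 * ?w) * (?B * inner (y n) (y (Suc n)) - ?A * (cmod (y (Suc n)))\<^sup>2)"
    unfolding mw by (simp add: inner_commute)
  have dis: "dissipation (i + n) (j + n) x = ?A * ((cmod (y n))\<^sup>2 + (cmod (y (Suc n)))\<^sup>2) - 2 * ?B * inner (y n) (y (Suc n))"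
    by (simp add: dissipation_def y_def)
  have "(\<Sum>k<Suc (Suc n). nu ^ (2 * k) * (2 * inner (y k) (rate (i + k) (j + k) * y k + gain x (i + k) (j + k))))
     \<le> (- 2 * (\<Sum>k<n. lam\<^sup>2 * nu ^ (2 * k) * dissipation (i + k) (j + k) x)
      + 2 * (lam\<^sup>2 * ?w) * (?B * inner (y n) (y (Suc n)) - ?A * (cmod (y n))\<^sup>2))
      + (2 * (lam\<^sup>2 * ?w') * (?B' * inner (y (Suc n)) (y (Suc (Suc n))) - ?A' * (cmod (y (Suc n)))\<^sup>2)
       + 2 * (lam\<^sup>2 * ?w) * (?B * inner (y n) (y (Suc n)) - ?A * (cmod (y (Suc n)))\<^sup>2))"
    unfolding sum.lessThan_Suc[of _ "Suc n"] step using Suc.IH by (rule add_right_mono)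
  also have "\<dots> = - 2 * (\<Sum>k<Suc n. lam\<^sup>2 * nu ^ (2 * k) * dissipation (i + k) (j + k) x)
      + 2 * (lam\<^sup>2 * ?w') * (?B' * inner (y (Suc n)) (y (Suc (Suc n))) - ?A' * (cmod (y (Suc n)))\<^sup>2)"
    unfolding sum.lessThan_Suc[of _ n] dis by (simp add: algebra_simps del: power_Suc)
  finally show ?case .
qed

end

section \<open>Convergence to the invariant state\<close>

context qds_parameters
begin

lemma nu_omega_shift: "(\<lambda>n. nu ^ (2 * n) * omega r (i + Suc n)) \<longlonglongrightarrow> 0"
proof -
  have "(\<lambda>n. nu ^ (2 * (n + i)) * omega r (Suc (n + i))) \<longlonglongrightarrow> 0"
    by (rule LIMSEQ_ignore_initial_segment[OF nu_omega_LIMSEQ])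
  from tendsto_divide[OF this tendsto_const[of "nu ^ (2 * i)"]] nu_pos
  have "(\<lambda>n. nu ^ (2 * (n + i)) * omega r (Suc (n + i)) / nu ^ (2 * i)) \<longlonglongrightarrow> 0" by simp
  moreover have "nu ^ (2 * (n + i)) * omega r (Suc (n + i)) / nu ^ (2 * i) = nu ^ (2 * n) * omega r (i + Suc n)" for n
    unfolding distrib_left power_add using nu_pos by (simp add: add.commute)
  ultimately show ?thesis by simp
qed

lemma nu_cB_LIMSEQ: "(\<lambda>n. nu ^ (2 * n) * cB (i + Suc n) (j + Suc n)) \<longlonglongrightarrow> 0"
proof (rule tendsto_sandwich[where f = "\<lambda>_. 0"])
  show "(\<lambda>n. (nu ^ (2 * n) * omega r (i + Suc n) + nu ^ (2 * n) * omega r (j + Suc n)) / 2) \<longlonglongrightarrow> 0"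
    using tendsto_divide[OF tendsto_add[OF nu_omega_shift[of i] nu_omega_shift[of j]] tendsto_const[of 2]] by simp
  show "\<forall>\<^sub>F n in sequentially. nu ^ (2 * n) * cB (i + Suc n) (j + Suc n)
      \<le> (nu ^ (2 * n) * omega r (i + Suc n) + nu ^ (2 * n) * omega r (j + Suc n)) / 2"
  proof (intro always_eventually allI)
    fix n
    have "nu ^ (2 * n) * cB (i + Suc n) (j + Suc n) \<le> nu ^ (2 * n) * cA (i + Suc n) (j + Suc n)"
      using nu_pos by (intro mult_left_mono cB_le_cA) auto
    then show "nu ^ (2 * n) * cB (i + Suc n) (j + Suc n)
      \<le> (nu ^ (2 * n) * omega r (i + Suc n) + nu ^ (2 * n) * omega r (j + Suc n)) / 2"
      by (simp add: cA_def distrib_left del: add_Suc_right)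
  qed
qed (use nu_pos cB_nonneg in auto)

lemma omega_strict_mono: "k < l \<Longrightarrow> omega r (Suc k) < omega r (Suc l)"
proof -
  assume "k < l"
  then have "real (Suc k) * (real k + r) < real (Suc l) * (real l + r)"
    using r_pos by (intro mult_strict_mono) auto
  then show ?thesis by (simp add: omega_def)
qed

text \<open>The means differ strictly because \<open>omega\<close> is injective on positive indices.
  This gap is the damping of an off-diagonal entry.\<close>

lemma cB_less_cA: assumes "k \<noteq> l" shows "cB (Suc k) (Suc l) < cA (Suc k) (Suc l)"
proof -
  have "omega r (Suc k) \<noteq> omega r (Suc l)"
    using assms omega_strict_mono[of k l] omega_strict_mono[of l k] by linarith
  then have "0 < (sqrt (omega r (Suc k)) - sqrt (omega r (Suc l)))\<^sup>2" by simp
  also have "\<dots> = omega r (Suc k) + omega r (Suc l) - 2 * (sqrt (omega r (Suc k)) * sqrt (omega r (Suc l)))"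
    by (simp add: power2_diff)
  finally show ?thesis by (simp add: cA_def cB_def)
qed

end

context bounded_solution
begin

text \<open>The inequality is integrated over a finite section. The initial energy is at most
  \<open>K\<^sup>2\<close> times the geometric sum, and the remainder
  \<open>\<epsilon> n * t\<close> vanishes at fixed \<open>t\<close> as the section grows; the
  resulting bound is independent of \<open>t\<close>.\<close>

lemma energy_bound:
  assumes ij: "i = 0 \<or> j = 0" and c: "0 \<le> c" and z: "continuous_on {0..} z"
    and le: "\<And>t. 0 \<le> t \<Longrightarrow> c * (cmod (z t))\<^sup>2 \<le> lam\<^sup>2 * nu ^ (2 * m) * dissipation (i + m) (j + m) (X t)"
    and t: "0 \<le> t"
  shows "2 * c * integral {0..t} (\<lambda>s. (cmod (z s))\<^sup>2) \<le> K\<^sup>2 * (1 / (1 - nu\<^sup>2))"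
proof -
  define Y where "Y k s = X s (i + k) (j + k)" for k s
  define D where "D k s = rate (i + k) (j + k) * Y k s + gain (X s) (i + k) (j + k)" for k s
  define \<Phi> where "\<Phi> n s = (\<Sum>k<Suc n. nu ^ (2 * k) * inner (Y k s) (Y k s))" for n s
  define \<Phi>' where "\<Phi>' n s = (\<Sum>k<Suc n. nu ^ (2 * k) * (2 * inner (Y k s) (D k s)))" for n s
  \<comment> \<open>Bounds the remainder of the last edge: its mixed term is at most
    \<open>K\<^sup>2\<close>, its square term has the favourable sign.\<close>
  define \<epsilon> where "\<epsilon> n = 2 * lam\<^sup>2 * (nu ^ (2 * n) * cB (i + Suc n) (j + Suc n)) * K\<^sup>2" for n
  let ?I = "integral {0..t} (\<lambda>s. (cmod (z s))\<^sup>2)"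
  have Yle: "cmod (Y k s) \<le> K" if "0 \<le> s" for k s using X_le[OF that] by (simp add: Y_def)
  have dY: "(Y k has_vector_derivative D k s) (at s within {0..})" if "0 \<le> s" for k s
    using X_deriv[OF that] by (simp add: Y_def[abs_def] D_def)
  have d\<Phi>: "(\<Phi> n has_vector_derivative \<Phi>' n s) (at s within {0..})" if s: "0 \<le> s" for n s
  proof -
    have "((\<lambda>s. inner (Y k s) (Y k s)) has_vector_derivative (2 * inner (Y k s) (D k s))) (at s within {0..})" for k
      using bounded_bilinear.has_vector_derivative[OF bounded_bilinear_inner dY[OF s, of k] dY[OF s, of k]]
      by (simp add: inner_commute)
    from bounded_linear.has_vector_derivative[OF bounded_linear_mult_right this]
    have "((\<lambda>s. nu ^ (2 * k) * inner (Y k s) (Y k s)) has_vector_derivative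
        nu ^ (2 * k) * (2 * inner (Y k s) (D k s))) (at s within {0..})" for k .
    then show ?thesis unfolding \<Phi>_def[abs_def] \<Phi>'_def by (intro has_vector_derivative_sum)
  qed
  have \<Phi>'_le: "\<Phi>' n s \<le> (- 2 * c) * (cmod (z s))\<^sup>2 + \<epsilon> n" if n: "m < n" and s: "0 \<le> s" for n s
  proof -
    let ?E = "\<lambda>k. lam\<^sup>2 * nu ^ (2 * k) * dissipation (i + k) (j + k) (X s)"
    have "?E m \<le> (\<Sum>k<n. ?E k)"
      using n nu_pos dissipation_ge(3) by (intro member_le_sum) auto
    with le[OF s] have 1: "- 2 * (\<Sum>k<n. ?E k) \<le> (- 2 * c) * (cmod (z s))\<^sup>2" by simp
    have "inner (Y n s) (Y (Suc n) s) \<le> K * K"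
      using norm_cauchy_schwarz[of "Y n s" "Y (Suc n) s"] mult_mono[OF Yle[OF s, of n] Yle[OF s, of "Suc n"] K_nonneg]
      by simp
    then have "cB (i + Suc n) (j + Suc n) * inner (Y n s) (Y (Suc n) s) \<le> cB (i + Suc n) (j + Suc n) * (K * K)"
      by (intro mult_left_mono cB_nonneg)
    moreover have "0 \<le> cA (i + Suc n) (j + Suc n) * (cmod (Y n s))\<^sup>2" using cA_nonneg by simp
    ultimately have 2: "2 * (lam\<^sup>2 * nu ^ (2 * n)) * (cB (i + Suc n) (j + Suc n) * inner (Y n s) (Y (Suc n) s)
        - cA (i + Suc n) (j + Suc n) * (cmod (Y n s))\<^sup>2) \<le> 2 * (lam\<^sup>2 * nu ^ (2 * n)) * (cB (i + Suc n) (j + Suc n) * (K * K))"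
      using nu_pos by (intro mult_left_mono) auto
    also have "\<dots> = \<epsilon> n" by (simp add: \<epsilon>_def power2_eq_square mult_ac)
    finally show ?thesis
      using energy_inequality[OF ij, where n = n and x = "X s"] 1 unfolding \<Phi>'_def D_def Y_def by linarith
  qed
  have zi: "(\<lambda>s. (cmod (z s))\<^sup>2) integrable_on {0..t}"
    by (intro integrable_continuous_interval continuous_intros continuous_on_subset[OF z]) auto
  have key: "2 * c * ?I \<le> K\<^sup>2 * (1 / (1 - nu\<^sup>2)) + \<epsilon> n * t" if n: "m < n" for n
  proof -
    have "(\<Phi>' n has_integral (\<Phi> n t - \<Phi> n 0)) {0..t}"
      using t by (intro fundamental_theorem_of_calculus)
        (auto intro!: has_vector_derivative_within_subset[OF d\<Phi>])
    moreover have "((\<lambda>s. (- 2 * c) * (cmod (z s))\<^sup>2 + \<epsilon> n) has_integral ((- 2 * c) * ?I + \<epsilon> n * t)) {0..t}"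
      using has_integral_add[OF has_integral_mult_right[OF integrable_integral[OF zi], of "- 2 * c"]
        has_integral_const_real[of "\<epsilon> n" 0 t]] t by (simp add: mult.commute)
    ultimately have "\<Phi> n t - \<Phi> n 0 \<le> (- 2 * c) * ?I + \<epsilon> n * t"
      by (rule has_integral_le) (use \<Phi>'_le[OF n] in auto)
    moreover have "0 \<le> \<Phi> n t" unfolding \<Phi>_def using nu_pos by (intro sum_nonneg) auto
    moreover have "\<Phi> n 0 \<le> K\<^sup>2 * (1 / (1 - nu\<^sup>2))"
    proof -
      have "\<Phi> n 0 \<le> (\<Sum>k<Suc n. nu ^ (2 * k) * K\<^sup>2)"
        unfolding \<Phi>_def power2_norm_eq_inner[symmetric] using nu_pos Yle[of 0]
        by (intro sum_mono mult_left_mono power_mono) auto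
      also have "\<dots> = K\<^sup>2 * (\<Sum>k<Suc n. nu ^ (2 * k))"
        unfolding sum_distrib_left by (intro sum.cong refl) (rule mult.commute)
      also have "\<dots> \<le> K\<^sup>2 * (1 / (1 - nu\<^sup>2))"
        using nu_geometric nu_pos sum_le_suminf[of "\<lambda>k. nu ^ (2 * k)" "{..<Suc n}"]
        by (intro mult_left_mono) (auto simp: sums_iff)
      finally show ?thesis .
    qed
    ultimately show ?thesis by simp
  qed
  have "\<epsilon> \<longlonglongrightarrow> 2 * lam\<^sup>2 * 0 * K\<^sup>2"
    unfolding \<epsilon>_def[abs_def] by (intro tendsto_mult tendsto_const nu_cB_LIMSEQ)
  then have "(\<lambda>n. K\<^sup>2 * (1 / (1 - nu\<^sup>2)) + \<epsilon> n * t) \<longlonglongrightarrow> K\<^sup>2 * (1 / (1 - nu\<^sup>2)) + (2 * lam\<^sup>2 * 0 * K\<^sup>2) * t"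
    by (intro tendsto_intros)
  from LIMSEQ_le_const[OF this, of "2 * c * ?I"] key
  have "2 * c * ?I \<le> K\<^sup>2 * (1 / (1 - nu\<^sup>2)) + (2 * lam\<^sup>2 * 0 * K\<^sup>2) * t"
    using Suc_le_lessD by blast
  then show ?thesis by simp
qed

lemma off_diag_tendsto:
  assumes kl: "k \<noteq> l" shows "((\<lambda>t. X t k l) \<longlongrightarrow> 0) at_top"
proof -
  \<comment> \<open>The entry sits at position \<open>m\<close> of the diagonal that starts at the
    border point \<open>(i, j)\<close>.\<close>
  define m where "m = min k l"
  define i where "i = k - m"
  define j where "j = l - m"
  have ij: "i = 0 \<or> j = 0" and k: "k = i + m" and l: "l = j + m" by (auto simp: m_def i_def j_def min_def)
  define c where "c = lam\<^sup>2 * nu ^ (2 * m) * (cA (Suc k) (Suc l) - cB (Suc k) (Suc l))"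
  have c: "0 < c" using lam_pos nu_pos cB_less_cA[OF kl] by (simp add: c_def)
  show ?thesis
  proof (rule Barbalat_square_integrable[OF X_lipschitz X_le])
    fix t :: real assume t: "0 \<le> t"
    have "2 * c * integral {0..t} (\<lambda>s. (cmod (X s k l))\<^sup>2) \<le> K\<^sup>2 * (1 / (1 - nu\<^sup>2))"
    proof (rule energy_bound[OF ij less_imp_le[OF c] X_continuous _ t, where m = m])
      fix s :: real
      have "lam\<^sup>2 * nu ^ (2 * m) * ((cA (Suc k) (Suc l) - cB (Suc k) (Suc l)) * (cmod (X s k l))\<^sup>2)
        \<le> lam\<^sup>2 * nu ^ (2 * m) * dissipation k l (X s)"
        using nu_pos by (intro mult_left_mono dissipation_ge(2)) auto
      then show "c * (cmod (X s k l))\<^sup>2 \<le> lam\<^sup>2 * nu ^ (2 * m) * dissipation (i + m) (j + m) (X s)"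
        by (simp add: c_def mult.assoc flip: k l)
    qed
    then show "integral {0..t} (\<lambda>s. (cmod (X s k l))\<^sup>2) \<le> K\<^sup>2 * (1 / (1 - nu\<^sup>2)) / (2 * c)"
      using c by (simp only: pos_le_divide_eq mult.commute)
  qed
qed

lemma diag_diff_tendsto: "((\<lambda>t. X t k k - X t (Suc k) (Suc k)) \<longlongrightarrow> 0) at_top"
proof -
  define c where "c = lam\<^sup>2 * nu ^ (2 * k) * cB (Suc k) (Suc k)"
  have c: "0 < c" using lam_pos nu_pos omega_Suc_pos[of k] by (simp add: c_def cB_def)
  let ?L = "\<lambda>k. (cmod (rate k k) + (down k k + up k k)) * K"
  show ?thesis
  proof (rule Barbalat_square_integrable)
    fix s t :: real assume st: "0 \<le> s" "0 \<le> t"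
    show "cmod ((X t k k - X t (Suc k) (Suc k)) - (X s k k - X s (Suc k) (Suc k))) \<le> (?L k + ?L (Suc k)) * \<bar>t - s\<bar>"
      using X_lipschitz[OF st, of k k] X_lipschitz[OF st, of "Suc k" "Suc k"]
        norm_triangle_ineq4[of "X t k k - X s k k" "X t (Suc k) (Suc k) - X s (Suc k) (Suc k)"]
      by (simp add: algebra_simps)
  next
    fix t :: real assume t: "0 \<le> t"
    show "cmod (X t k k - X t (Suc k) (Suc k)) \<le> K + K"
      using norm_triangle_ineq4[of "X t k k" "X t (Suc k) (Suc k)"] X_le[OF t, of k k] X_le[OF t, of "Suc k" "Suc k"] by linarith
    have "2 * c * integral {0..t} (\<lambda>s. (cmod (X s k k - X s (Suc k) (Suc k)))\<^sup>2) \<le> K\<^sup>2 * (1 / (1 - nu\<^sup>2))"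
    proof (rule energy_bound[of 0 0 c _ k, OF _ less_imp_le[OF c] _ _ t])
      show "continuous_on {0..} (\<lambda>s. X s k k - X s (Suc k) (Suc k))"
        by (intro continuous_on_diff X_continuous)
      fix s :: real
      have "lam\<^sup>2 * nu ^ (2 * k) * (cB (Suc k) (Suc k) * (cmod (X s k k - X s (Suc k) (Suc k)))\<^sup>2)
        \<le> lam\<^sup>2 * nu ^ (2 * k) * dissipation k k (X s)"
        using nu_pos by (intro mult_left_mono dissipation_ge(1)) auto
      then show "c * (cmod (X s k k - X s (Suc k) (Suc k)))\<^sup>2 \<le> lam\<^sup>2 * nu ^ (2 * k) * dissipation (0 + k) (0 + k) (X s)"
        by (simp add: c_def mult.assoc)
    qed simp
    then show "integral {0..t} (\<lambda>s. (cmod (X s k k - X s (Suc k) (Suc k)))\<^sup>2) \<le> K\<^sup>2 * (1 / (1 - nu\<^sup>2)) / (2 * c)"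
      using c by (simp only: pos_le_divide_eq mult.commute)
  qed
qed

text \<open>All diagonal entries approach the first one, so the conserved mean, of total weight
  \<open>1 / (1 - nu\<^sup>2)\<close>, fixes the common limit. The bound \<open>2 * K\<close>
  justifies the exchange of limit and series.\<close>

lemma diag_tendsto:
  "((\<lambda>t. X t k k) \<longlongrightarrow> (1 - nu\<^sup>2) *\<^sub>R (\<Sum>k. nu ^ (2 * k) *\<^sub>R X 0 k k)) at_top"
proof -
  have dif: "((\<lambda>t. X t k k - X t 0 0) \<longlongrightarrow> 0) at_top" for k
  proof (induction k)
    case (Suc k)
    from tendsto_diff[OF Suc diag_diff_tendsto[of k]] show ?case by simp
  qed simp
  define m where "m = (\<Sum>k. nu ^ (2 * k) *\<^sub>R X 0 k k)"
  have "((\<lambda>t. \<Sum>k. nu ^ (2 * k) *\<^sub>R (X t k k - X t 0 0)) \<longlongrightarrow> (\<Sum>k::nat. 0)) at_top"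
  proof (rule tannerys_theorem[THEN conjunct2, THEN conjunct2])
    show "((\<lambda>t. nu ^ (2 * k) *\<^sub>R (X t k k - X t 0 0)) \<longlongrightarrow> 0) at_top" for k
      using tendsto_scaleR[OF tendsto_const dif, of "nu ^ (2 * k)" k] by simp
    show "summable (\<lambda>k. nu ^ (2 * k) * (2 * K))"
      using nu_geometric by (intro summable_mult2) (simp add: sums_iff)
    have "norm (nu ^ (2 * k) *\<^sub>R (X t k k - X t 0 0)) \<le> nu ^ (2 * k) * (2 * K)" if t: "0 \<le> t" for k t
    proof -
      have "cmod (X t k k - X t 0 0) \<le> 2 * K"
        using norm_triangle_ineq4[of "X t k k" "X t 0 0"] X_le[OF t, of k k] X_le[OF t, of 0 0] by linarith
      then show ?thesis using nu_pos by (simp add: mult_left_mono)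
    qed
    then show "\<forall>\<^sub>F (k, t) in at_top \<times>\<^sub>F at_top. norm (nu ^ (2 * k) *\<^sub>R (X t k k - X t 0 0)) \<le> nu ^ (2 * k) * (2 * K)"
      unfolding eventually_prod_filter
      by (intro exI[of _ "\<lambda>_. True"] exI[of _ "\<lambda>t. 0 \<le> t"]) (auto intro: eventually_ge_at_top)
  qed simp
  then have "((\<lambda>t. (1 - nu\<^sup>2) *\<^sub>R (m - (\<Sum>k. nu ^ (2 * k) *\<^sub>R (X t k k - X t 0 0)))) \<longlongrightarrow> (1 - nu\<^sup>2) *\<^sub>R (m - 0)) at_top"
    by (intro tendsto_intros) simp
  moreover have "(1 - nu\<^sup>2) *\<^sub>R (m - (\<Sum>k. nu ^ (2 * k) *\<^sub>R (X t k k - X t 0 0))) = X t 0 0" if t: "0 \<le> t" for t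
  proof -
    have s1: "(\<lambda>k. nu ^ (2 * k) *\<^sub>R X t k k) sums m"
      unfolding m_def mean_conserved[OF t, symmetric] by (intro summable_sums nu_summable[where C = K] X_le t)
    have s2: "(\<lambda>k. nu ^ (2 * k) *\<^sub>R X t 0 0) sums ((1 / (1 - nu\<^sup>2)) *\<^sub>R X t 0 0)"
      by (rule bounded_linear.sums[OF bounded_linear_scaleR_left nu_geometric])
    have "(\<Sum>k. nu ^ (2 * k) *\<^sub>R (X t k k - X t 0 0)) = m - (1 / (1 - nu\<^sup>2)) *\<^sub>R X t 0 0"
      using sums_diff[OF s1 s2] by (simp add: scaleR_right_diff_distrib sums_iff)
    then show ?thesis using nu_sq_less_1 by simp
  qed
  then have "\<forall>\<^sub>F t in at_top. (1 - nu\<^sup>2) *\<^sub>R (m - (\<Sum>k. nu ^ (2 * k) *\<^sub>R (X t k k - X t 0 0))) = X t 0 0"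
    using eventually_ge_at_top[of 0] by (rule eventually_mono[rotated])
  ultimately have "((\<lambda>t. X t 0 0) \<longlongrightarrow> (1 - nu\<^sup>2) *\<^sub>R m) at_top"
    by (simp add: tendsto_cong)
  from tendsto_add[OF this dif[of k]] show ?thesis by (simp add: m_def)
qed

end

section \<open>Conservation, normality and convergence of the minimal semigroup\<close>

context minimal_semigroup
begin

lemma bounded_solution_T:
  assumes "bounded_op x"
  shows "bounded_solution r lam mu zp zm (\<lambda>t. T t x) (4 * norm (op_of x))"
  by unfold_locales (auto intro: T_has_vector_derivative T_entry_le assms)

lemma T_weighted_sums:
  assumes x: "bounded_op x" and t: "0 \<le> t" and s: "(\<lambda>k. nu ^ (2 * k) *\<^sub>R x k k) sums S"
  shows "(\<lambda>k. nu ^ (2 * k) *\<^sub>R T t x k k) sums S"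
proof -
  have "(\<Sum>k. nu ^ (2 * k) *\<^sub>R T t x k k) = S"
    using bounded_solution.mean_conserved[OF bounded_solution_T[OF x] t] s by (simp add: T_0[OF x] sums_iff)
  moreover have "summable (\<lambda>k. nu ^ (2 * k) *\<^sub>R T t x k k)" by (intro nu_summable[where C = "4 * norm (op_of x)"] T_entry_le t x)
  ultimately show ?thesis by (simp add: sums_iff)
qed

lemma psd_weighted_le:
  assumes Z: "psd Z" and s: "(\<lambda>k. nu ^ (2 * k) *\<^sub>R Z k k) sums S"
  shows "nu ^ (2 * k) * Re (Z k k) \<le> Re S"
proof -
  have s': "(\<lambda>k. nu ^ (2 * k) * Re (Z k k)) sums Re S" using sums_Re[OF s] by simp
  have "nu ^ (2 * k) * Re (Z k k) \<le> (\<Sum>j<Suc k. nu ^ (2 * j) * Re (Z j j))"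
    using nu_pos psd_diag(2)[OF Z] by (intro member_le_sum) auto
  also have "\<dots> \<le> Re S"
    using sum_le_suminf[of "\<lambda>k. nu ^ (2 * k) * Re (Z k k)" "{..<Suc k}"] s' nu_pos psd_diag(2)[OF Z]
    by (auto simp: sums_iff)
  finally show ?thesis .
qed

text \<open>The defect is positive with weighted mean 0, so its diagonal vanishes, and the minor
  inequality removes the remaining entries.\<close>

lemma T_idm: assumes t: "0 \<le> t" shows "T t idm = idm"
proof -
  let ?Z = "idm - T t idm"
  have Z: "psd ?Z" using pos_contraction_T[OF t] by (simp add: pos_contraction_def)
  have s: "(\<lambda>k. nu ^ (2 * k) *\<^sub>R idm k k) sums ((1 / (1 - nu\<^sup>2)) *\<^sub>R 1)"
    using bounded_linear.sums[OF bounded_linear_scaleR_left nu_geometric, of "1::complex"] by (simp add: diag_def)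
  have "(\<lambda>k. nu ^ (2 * k) *\<^sub>R ?Z k k) sums 0"
    using sums_diff[OF s T_weighted_sums[OF bounded_op_idm t s]] by (simp add: scaleR_right_diff_distrib)
  from psd_weighted_le[OF Z this] have "nu ^ (2 * k) * Re (?Z k k) \<le> 0" for k by simp
  moreover have "0 < nu ^ (2 * k)" for k using nu_pos by simp
  ultimately have "Re (?Z k k) \<le> 0" for k by (metis mult_le_0_iff not_le)
  then have d: "Re (?Z k k) = 0" for k using psd_diag(2)[OF Z, of k] by (simp add: order_antisym)
  have "?Z k l = 0" for k l using psd_entry_le[OF Z, of k l] unfolding d by simp
  then show ?thesis by (auto simp: fun_eq_iff)
qed

text \<open>The weighted mean of the image of \<open>idm - proj N\<close> stays equal to a geometric
  tail. Positivity passes its decay on to each diagonal entry and, through the minors, to every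
  entry.\<close>

lemma T_proj_LIMSEQ: assumes t: "0 \<le> t" shows "(\<lambda>N. T t (proj N) k l) \<longlonglongrightarrow> idm k l"
proof -
  define Z where "Z N = T t (idm - proj N)" for N
  have Zeq: "Z N = idm - T t (proj N)" for N
    unfolding Z_def T_diff[OF t bounded_op_idm bounded_op_proj] T_idm[OF t] ..
  define e where "e N = 1 / (1 - nu\<^sup>2) - (\<Sum>k<N. nu ^ (2 * k))" for N
  have e: "e \<longlonglongrightarrow> 0"
    using tendsto_diff[OF tendsto_const[of "1 / (1 - nu\<^sup>2)"] nu_geometric[unfolded sums_def]] unfolding e_def[abs_def] by simp
  have pos: "positive_op (idm - proj N)" for N
  proof -
    have "idm - proj N = diag (\<lambda>k. if k < N then 0 else 1)" by (auto simp: diag_def proj_def fun_eq_iff)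
    then show ?thesis using positive_op_diag[of "\<lambda>k. if k < N then 0 else 1" 1] by simp
  qed
  then have Z: "psd (Z N)" for N
    unfolding Z_def using positive_op_T[OF t] by (simp add: positive_op_iff_psd)
  have "(\<lambda>k. nu ^ (2 * k) *\<^sub>R (idm - proj N) k k) sums (complex_of_real (e N))" for N
  proof -
    have "(\<lambda>k. if k \<in> {..<N} then nu ^ (2 * k) else 0) sums (\<Sum>k<N. nu ^ (2 * k))"
      by (rule sums_If_finite_set) simp
    from sums_of_real[OF sums_diff[OF nu_geometric this], where 'a = complex]
    show ?thesis unfolding e_def
      by (rule sums_cong[THEN iffD1, rotated]) (auto simp: diag_def proj_def scaleR_conv_of_real)
  qed
  then have "(\<lambda>k. nu ^ (2 * k) *\<^sub>R Z N k k) sums (complex_of_real (e N))" for N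
    unfolding Z_def using pos by (intro T_weighted_sums t) (simp_all add: positive_op_def)
  from psd_weighted_le[OF Z this] have le: "nu ^ (2 * k) * Re (Z N k k) \<le> e N" for N k by simp
  have d: "(\<lambda>N. Re (Z N k k)) \<longlonglongrightarrow> 0" for k
  proof (rule tendsto_sandwich[where f = "\<lambda>_. 0"])
    show "(\<lambda>N. e N / nu ^ (2 * k)) \<longlonglongrightarrow> 0"
      using tendsto_divide[OF e tendsto_const[of "nu ^ (2 * k)"]] nu_pos by simp
    show "\<forall>\<^sub>F N in sequentially. Re (Z N k k) \<le> e N / nu ^ (2 * k)"
      using le[of k] nu_pos by (intro always_eventually allI) (simp add: pos_le_divide_eq mult.commute)
  qed (use psd_diag(2)[OF Z] in auto)
  have "(\<lambda>N. cmod (Z N k l)) \<longlonglongrightarrow> 0"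
  proof (rule tendsto_sandwich[where f = "\<lambda>_. 0"])
    show "(\<lambda>N. sqrt (Re (Z N k k) * Re (Z N l l))) \<longlonglongrightarrow> 0"
      using tendsto_real_sqrt[OF tendsto_mult[OF d[of k] d[of l]]] by simp
    show "\<forall>\<^sub>F N in sequentially. cmod (Z N k l) \<le> sqrt (Re (Z N k k) * Re (Z N l l))"
      using psd_entry_le[OF Z] by (intro always_eventually allI real_le_rsqrt)
  qed auto
  then have "(\<lambda>N. Z N k l) \<longlonglongrightarrow> 0" by (simp only: tendsto_norm_zero_iff)
  from tendsto_diff[OF tendsto_const[of "idm k l"] this] show ?thesis by (simp add: Zeq)
qed

lemma density_rho: "density (rho nu)"
proof (rule densityI)
  have "rho nu = diag (\<lambda>k. (1 - nu\<^sup>2) * nu ^ (2 * k))" by (simp add: rho_def diag_def)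
  moreover have "(1 - nu\<^sup>2) * nu ^ (2 * k) \<le> 1" for k
    using nu_pos nu_less_1 nu_sq_less_1 by (intro mult_le_one power_le_one) auto
  ultimately show "positive_op (rho nu)"
    using nu_sq_less_1 nu_pos by (simp only:) (rule positive_op_diag[where C = 1], auto)
  have "(\<lambda>k. (1 - nu\<^sup>2) * nu ^ (2 * k)) sums ((1 - nu\<^sup>2) * (1 / (1 - nu\<^sup>2)))"
    by (intro sums_mult nu_geometric)
  then have "(\<lambda>k. (1 - nu\<^sup>2) * nu ^ (2 * k)) sums 1" using nu_sq_less_1 by simp
  from sums_of_real[OF this, where 'a = complex] show "(\<lambda>k. rho nu k k) sums 1" by (simp add: rho_def)
qed

lemma tr_mmult_rho: "tr (mmult (rho nu) y) = (\<Sum>k. (1 - nu\<^sup>2) *\<^sub>R (nu ^ (2 * k) *\<^sub>R y k k))"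
proof -
  have "mmult (rho nu) y k k = (1 - nu\<^sup>2) *\<^sub>R (nu ^ (2 * k) *\<^sub>R y k k)" for k
  proof -
    have "(\<lambda>j. rho nu k j * y j k) sums (\<Sum>j\<in>{k}. rho nu k j * y j k)"
      by (rule sums_finite) (auto simp: rho_def)
    then show ?thesis by (simp add: mmult_def sums_iff rho_def scaleR_conv_of_real)
  qed
  then show ?thesis by (simp add: tr_def)
qed

lemma invariant_rho: "invariant_state T (rho nu)"
  unfolding invariant_state_def
proof (intro conjI allI impI density_rho)
  fix t :: real and x assume t: "0 \<le> t" and x: "bounded_op x"
  have s: "summable (\<lambda>k. nu ^ (2 * k) *\<^sub>R x k k)" by (intro nu_summable[where C = "norm (op_of x)"] bounded_op_entry_le x)
  have "(\<Sum>k. nu ^ (2 * k) *\<^sub>R T t x k k) = (\<Sum>k. nu ^ (2 * k) *\<^sub>R x k k)"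
    using T_weighted_sums[OF x t summable_sums[OF s]] by (simp add: sums_iff)
  moreover have s': "summable (\<lambda>k. nu ^ (2 * k) *\<^sub>R T t x k k)" by (intro nu_summable[where C = "4 * norm (op_of x)"] T_entry_le t x)
  ultimately show "tr (mmult (rho nu) (T t x)) = tr (mmult (rho nu) x)"
    unfolding tr_mmult_rho by (simp only: suminf_scaleR_right[OF s, symmetric] suminf_scaleR_right[OF s', symmetric])
qed

text \<open>The weighted mean of a matrix unit is the trace of \<open>rho nu\<close> against it,
  hence the swapped indices; it is 0 for \<open>a \<noteq> b\<close>.\<close>

lemma T_munit_tendsto: "((\<lambda>t. T t (munit a b) k l) \<longlongrightarrow> rho nu b a * idm k l) at_top"
proof (cases "k = l")
  case False
  then show ?thesis
    using bounded_solution.off_diag_tendsto[OF bounded_solution_T[OF bounded_op_munit] False]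
    by (simp add: diag_def)
next
  case True
  have "(\<lambda>k. nu ^ (2 * k) *\<^sub>R munit a b k k) sums (\<Sum>k\<in>{a}. nu ^ (2 * k) *\<^sub>R munit a b k k)"
    by (rule sums_finite) (auto simp: munit_def)
  then have "(1 - nu\<^sup>2) *\<^sub>R (\<Sum>k. nu ^ (2 * k) *\<^sub>R munit a b k k) = rho nu b a"
    by (auto simp: sums_iff munit_def rho_def scaleR_conv_of_real)
  then show ?thesis
    using bounded_solution.diag_tendsto[OF bounded_solution_T[OF bounded_op_munit], of a b k] True
    by (simp add: T_0 diag_def)
qed

context
  fixes \<eta> assumes \<eta>: "density \<eta>"
begin

lemma pos_functional_\<eta>: "pos_functional (\<lambda>y. tr (mmult \<eta> y))"
  using density_sums[OF \<eta>] by (intro pos_functional_tr)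

lemma tr_\<eta>_idm: "tr (mmult \<eta> idm) = 1"
  using \<eta> by (simp add: mmult_idm density_def)

lemma tr_\<eta>_proj_LIMSEQ: "(\<lambda>M. tr (mmult \<eta> (proj M))) \<longlonglongrightarrow> tr (mmult \<eta> idm)"
  using density_sums(3)[OF \<eta>] unfolding sums_def tr_\<eta>_idm pos_functional_proj[OF pos_functional_\<eta>] tr_mmult_munit .

lemma pos_functional_\<eta>_T:
  assumes t: "0 \<le> t" shows "pos_functional (\<lambda>x. tr (mmult \<eta> (T t x)))"
  unfolding pos_functional_def
  using pos_functionalD[OF pos_functional_\<eta>] T_lincomb[OF t] bounded_op_T[OF t] positive_op_T[OF t] by simp

text \<open>Normality of the evolved functional, which lets a density matrix represent it; entrywise
  convergence suffices because the images of projections have norm at most 4.\<close>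

lemma tr_\<eta>_T_proj_LIMSEQ:
  assumes t: "0 \<le> t" shows "(\<lambda>M. tr (mmult \<eta> (T t (proj M)))) \<longlonglongrightarrow> 1"
proof -
  have "norm (op_of (T t (proj M))) \<le> 4" for M
  proof -
    have "norm (op_of (proj M)) \<le> 1"
    proof (rule pos_op_norm_le[OF pos_op_op_of[OF positive_op_proj]])
      fix u
      have "coord (op_of (proj M) u) n = (if n < M then coord u n else 0)" for n
      proof -
        have "(\<lambda>j. proj M n j * coord u j) sums (\<Sum>j\<in>{n}. proj M n j * coord u j)"
          by (rule sums_finite) (auto simp: proj_def diag_def)
        from sums_unique[OF this, symmetric]
        have "coord (op_of (proj M) u) n = (\<Sum>j\<in>{n}. proj M n j * coord u j)"
          unfolding coord_op_of[OF bounded_op_proj] mapply_def .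
        then show ?thesis by (simp add: proj_def diag_def)
      qed
      then have "norm (op_of (proj M) u) \<le> norm u"
        by (intro norm_l2_le order_trans[OF sum_mono sum_coord_le_norm[of u]]) auto
      then have "inner u (op_of (proj M) u) \<le> norm u * norm u"
        using norm_cauchy_schwarz[of u "op_of (proj M) u"] mult_left_mono[of _ "norm u" "norm u"] by fastforce
      then show "inner u (op_of (proj M) u) \<le> 1 * (norm u)\<^sup>2" by (simp add: power2_eq_square)
    qed simp
    then show ?thesis using T_norm_le[OF t bounded_op_proj, of M] by linarith
  qed
  then have "(\<lambda>M. tr (mmult \<eta> (T t (proj M)))) \<longlonglongrightarrow> tr (mmult \<eta> idm)"
    by (intro pos_functional_tendsto[OF pos_functional_\<eta> tr_\<eta>_proj_LIMSEQ, where K = 4])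
      (auto simp: bounded_op_T[OF t] T_proj_LIMSEQ[OF t])
  then show ?thesis by (simp only: tr_\<eta>_idm)
qed

lemma tr_\<eta>_T_munit_tendsto: "((\<lambda>t. tr (mmult \<eta> (T t (munit j i)))) \<longlongrightarrow> rho nu i j) at_top"
proof -
  let ?z = "\<lambda>k l. rho nu i j * idm k l"
  have "((\<lambda>t. tr (mmult \<eta> (T t (munit j i)))) \<longlongrightarrow> tr (mmult \<eta> ?z)) at_top"
  proof (rule pos_functional_tendsto[OF pos_functional_\<eta> tr_\<eta>_proj_LIMSEQ])
    show "\<forall>\<^sub>F t in at_top. bounded_op (T t (munit j i)) \<and> norm (op_of (T t (munit j i))) \<le> 4 * norm (op_of (munit j i))"
      using eventually_ge_at_top[of 0] by eventually_elim (simp add: bounded_op_T T_norm_le)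
  qed (simp_all add: bounded_op_smult T_munit_tendsto)
  also have "tr (mmult \<eta> ?z) = rho nu i j"
    using pos_functional_smult[OF pos_functional_\<eta> bounded_op_idm, of "rho nu i j"] by (simp add: tr_\<eta>_idm)
  finally show ?thesis .
qed

lemma predual_properties:
  assumes t: "0 \<le> t"
  shows "density (predual T t \<eta>)" "predual T t \<eta> i j = tr (mmult \<eta> (T t (munit j i)))"
proof -
  let ?\<sigma> = "\<lambda>i j. tr (mmult \<eta> (T t (munit j i)))"
  have "tr (mmult \<eta> (T t idm)) = 1" by (simp add: T_idm[OF t] tr_\<eta>_idm)
  note n = normal_functional_density[OF pos_functional_\<eta>_T[OF t] this tr_\<eta>_T_proj_LIMSEQ[OF t]]
  then have "predual T t \<eta> = ?\<sigma>"
    by (intro predual_eqI) (auto simp: density_def)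
  with n(1) show "density (predual T t \<eta>)" "predual T t \<eta> i j = tr (mmult \<eta> (T t (munit j i)))" by simp_all
qed

lemma trace_norm_predual_tendsto: "((\<lambda>t. trace_norm (predual T t \<eta> - rho nu)) \<longlongrightarrow> 0) at_top"
proof (rule trace_norm_tendsto_zero[OF density_rho])
  show "\<forall>\<^sub>F t in at_top. density (predual T t \<eta>)"
    using eventually_ge_at_top[of 0] by eventually_elim (rule predual_properties)
  fix i j
  have "\<forall>\<^sub>F t in at_top. tr (mmult \<eta> (T t (munit j i))) = predual T t \<eta> i j"
    using eventually_ge_at_top[of 0] by eventually_elim (rule predual_properties(2)[symmetric])
  from Lim_transform_eventually[OF tr_\<eta>_T_munit_tendsto this]
  show "((\<lambda>t. predual T t \<eta> i j) \<longlongrightarrow> rho nu i j) at_top" .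
qed

end

text \<open>For an invariant state the pairing with an evolved matrix unit is constant in time and
  also converges to the entry of \<open>rho nu\<close>.\<close>

lemma invariant_state_unique:
  assumes "invariant_state T \<sigma>" shows "\<sigma> = rho nu"
proof (intro ext)
  fix i j
  have \<sigma>: "density \<sigma>" using assms by (simp add: invariant_state_def)
  have "\<forall>\<^sub>F t in at_top. tr (mmult \<sigma> (T t (munit j i))) = \<sigma> i j"
    using eventually_ge_at_top[of 0]
  proof eventually_elim
    case (elim t)
    then have "tr (mmult \<sigma> (T t (munit j i))) = tr (mmult \<sigma> (munit j i))"
      using assms by (simp add: invariant_state_def)
    then show ?case by (simp add: tr_mmult_munit)
  qed
  from Lim_transform_eventually[OF tr_\<eta>_T_munit_tendsto[OF \<sigma>] this]
  have "((\<lambda>t::real. \<sigma> i j) \<longlongrightarrow> rho nu i j) at_top" .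
  then show "\<sigma> i j = rho nu i j" by (simp add: tendsto_const_iff)
qed

end

theorem theorem3p4:
  fixes r lam mu zp zm :: real and T :: "real \<Rightarrow> mat \<Rightarrow> mat"
  assumes "0 < r" and "0 < lam" and "lam < mu"
    and "minimal_qds r lam mu zp zm T"
  shows "invariant_state T (rho (lam / mu)) \<and>
         (\<forall>\<sigma>. invariant_state T \<sigma> \<longrightarrow> \<sigma> = rho (lam / mu)) \<and>
         (\<forall>\<eta>. density \<eta> \<longrightarrow>
            ((\<lambda>t. trace_norm (predual T t \<eta> - rho (lam / mu))) \<longlongrightarrow> 0) at_top)"
proof -
  interpret minimal_semigroup r lam mu zp zm T
    using assms by unfold_locales
  show ?thesis
    using invariant_rho invariant_state_unique trace_norm_predual_tendsto unfolding nu_def by blast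
qed

end
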